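(* Let $k$ be an algebraically closed field of characteristic zero. For each $m\ge 1$, the operad $$\mathcal{D}end^{\,\blacksquare\, m}=\mathcal{D}end\,\blacksquare\cdots\blacksquare\,\mathcal{D}end\quad(m\text{ factors})$$ over $k$ is Koszul.
   Context: Conventions. All operads come from non-symmetric operads over an algebraically closed field $k$ of characteristic zero, and we work with the non-symmetric operads throughout (the symmetric operad is recovered by tensoring with $k[\Sigma_n]$ in arity $n$). For a finite-dimensional vector space $\Omega$ and a subspace $\Lambda\subset\Omega^{\otimes 2}\oplus\Omega^{\otimes 2}$, $\mathcal{P}(\Omega,\Lambda)$ denotes the quadratic operad generated by the binary operations $\Omega$ subject to the relations $\Lambda$: an element $(u,v)\in\Lambda$ stands for the relation $u=v$, where $\circ_1\otimes\circ_2$ in the first summand stands for $(x\circ_1 y)\circ_2 z$ and $\circ_3\otimes\circ_4$ in the second summand stands for $x\circ_3(y\circ_4 z)$. The operad $\mathcal{D}end$ (dendriform algebras) is generated by two binary operations $\prec,\succ$ with the three relations, where $*=\prec+\succ$: $(x\prec y)\prec z=x\prec(y*z)$, $(x\succ y)\prec z=x\succ(y\prec z)$, $(x*y)\succ z=x\succ(y\succ z)$. Black square product: $\mathcal{P}(\Omega_1,\Lambda_1)\,\blacksquare\,\mathcal{P}(\Omega_2,\Lambda_2)=\mathcal{P}(\Omega_1\otimes\Omega_2,\,S_{23}(\Lambda_1\otimes\Lambda_2))$, where $S_{23}(\Lambda_1\otimes\Lambda_2)$ is the span of the elements $(S_{23}(u\otimes u'),S_{23}(v\otimes v'))$ for $(u,v)\in\Lambda_1$,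 $(u',v')\in\Lambda_2$, and $S_{23}:\Omega_1^{\otimes2}\otimes\Omega_2^{\otimes2}\to(\Omega_1\otimes\Omega_2)^{\otimes2}$ switches the second and third tensor factors. Thus $\mathcal{D}end^{\,\blacksquare\, m}$ has $2^m$ generating operations ($m$-tuples of operations of $\mathcal{D}end$) and $3^m$ relations ($m$-tuples of relations of $\mathcal{D}end$). Quadratic dual: $\mathcal{P}(\Omega,\Lambda)^!=\mathcal{P}(\Omega^\vee,\Lambda^\perp)$, where $\Lambda^\perp=\{(f,g): f(u)=g(v)\text{ for all }(u,v)\in\Lambda\}\subset(\Omega^\vee)^{\otimes2}\oplus(\Omega^\vee)^{\otimes2}$. Bar complex: for a quadratic binary operad $\mathcal{P}$ with finite-dimensional components, its bar complex is the free dg operad on the (suitably shifted) linear dual of $\mathcal{P}$; in arity $n\ge2$ its degree $j$ part ($-n+2\le j\le 0$) is $\bigoplus_T\bigotimes_{v}\mathcal{P}(|v|)^\vee$, over planar rooted trees $T$ with $n$ leaves and $n+j-1$ vertices, each vertex $v$ having $|v|\ge2$ incoming edges. The differential raises degree by one; its component from $T$ to $T'$ is nonzero only if $T$ is obtained from $T'$ by contracting an internal edge, and it is then, up to the usual sign, the dual of the corresponding partial composition of $\mathcal{P}$. Its homology in degree $0$ is $\mathcal{P}^!$. A quadratic binary operad $\mathcal{P}$ is Koszul if its bar complex is a resolution of $\mathcal{P}^!$, i.e. has no homology in nonzero degrees. *)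

theory Defs
  imports
    "HOL-Computational_Algebra.Polynomial"
    "HOL-Library.Function_Algebras"
    "HOL-Library.Product_Plus"
    "HOL-Library.Tree"
begin

section \<open>Non-symmetric operads\<close>

text \<open>
  Arity-wise vector spaces \<open>comps P n\<close> over \<open>'k\<close>; \<open>pcomp P m n i x y\<close> is the partial composition
  of \<open>x \<in> P(m)\<close> with \<open>y \<in> P(n)\<close> in the \<open>i\<close>-th input of \<open>x\<close>, \<open>1 \<le> i \<le> m\<close>. The operations carry the
  arities as arguments because an element of \<open>'a\<close> need not determine them.
\<close>

record ('k, 'a) ns_operad =
  comps :: "nat \<Rightarrow> 'a set"
  add :: "nat \<Rightarrow> 'a \<Rightarrow> 'a \<Rightarrow> 'a"
  smul :: "nat \<Rightarrow> 'k \<Rightarrow> 'a \<Rightarrow> 'a"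
  unit_op :: "'a"
  pcomp :: "nat \<Rightarrow> nat \<Rightarrow> nat \<Rightarrow> 'a \<Rightarrow> 'a \<Rightarrow> 'a"


section \<open>Quadratic data\<close>

definition fscale :: "'k::field \<Rightarrow> ('x \<Rightarrow> 'k) \<Rightarrow> ('x \<Rightarrow> 'k)" where
  "fscale c f = (\<lambda>x. c * f x)"

definition basis_vec :: "'x \<Rightarrow> ('x \<Rightarrow> 'k::field)" where
  "basis_vec p = (\<lambda>x. if x = p then 1 else 0)"

definition tens :: "('b \<Rightarrow> 'k::field) \<Rightarrow> ('b \<Rightarrow> 'k) \<Rightarrow> ('b \<times> 'b \<Rightarrow> 'k)" where
  "tens f g = (\<lambda>(a, b). f a * g b)"

text \<open>
  The space \<open>\<Omega>\<close> is given by a finite basis \<open>ops Q\<close>: its elements are the functions \<open>'b \<Rightarrow> 'k\<close> supported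
  on \<open>ops Q\<close>, and those of \<open>\<Omega> \<otimes> \<Omega>\<close> are the functions supported on \<open>ops Q \<times> ops Q\<close>. An element \<open>(u, v)\<close>
  of \<open>rels Q\<close> is the relation \<open>u = v\<close>, where the basis vector \<open>(a, b)\<close> means \<open>(x a y) b z\<close> in \<open>u\<close> and
  \<open>x a (y b z)\<close> in \<open>v\<close>.
\<close>

type_synonym ('b, 'k) relation = "('b \<times> 'b \<Rightarrow> 'k) \<times> ('b \<times> 'b \<Rightarrow> 'k)"

record ('b, 'k) quad_data =
  ops :: "'b set"
  rels :: "('b, 'k) relation set"

definition rscale :: "'k::field \<Rightarrow> ('b, 'k) relation \<Rightarrow> ('b, 'k) relation" where
  "rscale c = (\<lambda>(u, v). (fscale c u, fscale c v))"

interpretation rel: vector_space rscale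
  by standard (auto simp: rscale_def fscale_def fun_eq_iff algebra_simps)


section \<open>The operad of a quadratic datum\<close>

text \<open>
  The free non-symmetric operad on binary operations has as basis in arity \<open>n\<close> the planar binary
  trees with \<open>n\<close> leaves and inner nodes labelled by \<open>ops Q\<close>; \<open>\<langle>s, a, t\<rangle>\<close> is the monomial \<open>s a t\<close>.
\<close>

definition monomials :: "('b, 'k) quad_data \<Rightarrow> nat \<Rightarrow> 'b tree set" where
  "monomials Q n = {t. set_tree t \<subseteq> ops Q \<and> size1 t = n}"

type_synonym ('b, 'k) tvec = "'b tree \<Rightarrow> 'k"

definition free_comps :: "('b, 'k::field) quad_data \<Rightarrow> nat \<Rightarrow> ('b, 'k) tvec set" where
  "free_comps Q n = {x. \<forall>t. x t \<noteq> 0 \<longrightarrow> t \<in> monomials Q n}"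

text \<open>Leaves are numbered from 1, from left to right.\<close>

fun graft :: "nat \<Rightarrow> 'b tree \<Rightarrow> 'b tree \<Rightarrow> 'b tree" where
  "graft i \<langle>\<rangle> u = u"
| "graft i \<langle>l, a, r\<rangle> u =
     (if i \<le> size1 l then \<langle>graft i l u, a, r\<rangle> else \<langle>l, a, graft (i - size1 l) r u\<rangle>)"

definition free_pcomp ::
    "('b, 'k::field) quad_data \<Rightarrow> nat \<Rightarrow> nat \<Rightarrow> nat \<Rightarrow> ('b, 'k) tvec \<Rightarrow> ('b, 'k) tvec \<Rightarrow> ('b, 'k) tvec" where
  "free_pcomp Q m n i x y =
     (\<lambda>t. \<Sum>(s, u) \<in> {(s, u). s \<in> monomials Q m \<and> u \<in> monomials Q n \<and> graft i s u = t}. x s * y u)"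

fun rel_vec :: "('b, 'k::field) relation \<Rightarrow> ('b, 'k) tvec" where
  "rel_vec (u, v) \<langle>\<langle>\<langle>\<rangle>, a, \<langle>\<rangle>\<rangle>, b, \<langle>\<rangle>\<rangle> = u (a, b)"
| "rel_vec (u, v) \<langle>\<langle>\<rangle>, a, \<langle>\<langle>\<rangle>, b, \<langle>\<rangle>\<rangle>\<rangle> = - v (a, b)"
| "rel_vec (u, v) _ = 0"

inductive in_ideal :: "('b, 'k::field) quad_data \<Rightarrow> nat \<Rightarrow> ('b, 'k) tvec \<Rightarrow> bool"
  for Q :: "('b, 'k) quad_data" where
  rel: "r \<in> rels Q \<Longrightarrow> in_ideal Q 3 (rel_vec r)"
| zero: "in_ideal Q n 0"
| plus: "in_ideal Q n x \<Longrightarrow> in_ideal Q n y \<Longrightarrow> in_ideal Q n (x + y)"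
| scale: "in_ideal Q n x \<Longrightarrow> in_ideal Q n (fscale c x)"
| comp_left: "in_ideal Q m x \<Longrightarrow> y \<in> free_comps Q n \<Longrightarrow> 1 \<le> i \<Longrightarrow> i \<le> m \<Longrightarrow>
    in_ideal Q (m + n - 1) (free_pcomp Q m n i x y)"
| comp_right: "x \<in> free_comps Q m \<Longrightarrow> in_ideal Q n y \<Longrightarrow> 1 \<le> i \<Longrightarrow> i \<le> m \<Longrightarrow>
    in_ideal Q (m + n - 1) (free_pcomp Q m n i x y)"

definition ideal_rel :: "('b, 'k::field) quad_data \<Rightarrow> nat \<Rightarrow> (('b, 'k) tvec \<times> ('b, 'k) tvec) set" where
  "ideal_rel Q n = {(x, y). x \<in> free_comps Q n \<and> y \<in> free_comps Q n \<and> in_ideal Q n (x - y)}"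

abbreviation coset :: "('b, 'k::field) quad_data \<Rightarrow> nat \<Rightarrow> ('b, 'k) tvec \<Rightarrow> ('b, 'k) tvec set" where
  "coset Q n x \<equiv> ideal_rel Q n `` {x}"

definition quadratic_operad :: "('b, 'k::field) quad_data \<Rightarrow> ('k, ('b, 'k) tvec set) ns_operad" where
  "quadratic_operad Q =
     \<lparr> comps = (\<lambda>n. free_comps Q n // ideal_rel Q n),
       add = (\<lambda>n X Y. \<Union>x\<in>X. \<Union>y\<in>Y. coset Q n (x + y)),
       smul = (\<lambda>n c X. \<Union>x\<in>X. coset Q n (fscale c x)),
       unit_op = coset Q 1 (basis_vec \<langle>\<rangle>),
       pcomp = (\<lambda>m n i X Y. \<Union>x\<in>X. \<Union>y\<in>Y. coset Q (m + n - 1) (free_pcomp Q m n i x y)) \<rparr>"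


section \<open>Dendriform algebras and the black square product\<close>

text \<open>
  Basis labels form a type closed under formal pairing, so that the black square product can be
  iterated: \<open>Tensor a b\<close> is the basis vector \<open>a \<otimes> b\<close> of \<open>\<Omega>\<^sub>1 \<otimes> \<Omega>\<^sub>2\<close>.
\<close>

datatype 'a label = Gen 'a | Tensor "'a label" "'a label"

definition s23 ::
    "('a label \<times> 'a label \<Rightarrow> 'k::field) \<Rightarrow> ('a label \<times> 'a label \<Rightarrow> 'k) \<Rightarrow> ('a label \<times> 'a label \<Rightarrow> 'k)" where
  "s23 u u' = (\<lambda>p. case p of (Tensor a a', Tensor b b') \<Rightarrow> u (a, b) * u' (a', b') | _ \<Rightarrow> 0)"

definition black_square ::
    "('a label, 'k::field) quad_data \<Rightarrow> ('a label, 'k) quad_data \<Rightarrow> ('a label, 'k) quad_data" where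
  "black_square Q Q' =
     \<lparr> ops = {Tensor a a' | a a'. a \<in> ops Q \<and> a' \<in> ops Q'},
       rels = rel.span {(s23 u u', s23 v v') | u v u' v'. (u, v) \<in> rels Q \<and> (u', v') \<in> rels Q'} \<rparr>"

datatype dend_op = Prec | Succ

definition Dend :: "(dend_op label, 'k::field) quad_data" where
  "Dend =
     (let prec = basis_vec (Gen Prec); succ = basis_vec (Gen Succ); star = prec + succ in
     \<lparr> ops = {Gen Prec, Gen Succ},
       rels = rel.span {(tens prec prec, tens prec star),
                        (tens succ prec, tens succ prec),
                        (tens star succ, tens succ succ)} \<rparr>)"

text \<open>The product of \<open>m \<ge> 1\<close> factors, bracketed to the right.\<close>

definition black_power ::
    "('a label, 'k::field) quad_data \<Rightarrow> nat \<Rightarrow> ('a label, 'k) quad_data" where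
  "black_power Q m = (black_square Q ^^ (m - 1)) Q"


section \<open>The bar complex and Koszulness\<close>

datatype 'a ptree = PLeaf | Vertex 'a "'a ptree list"

primrec nleaves :: "'a ptree \<Rightarrow> nat" where
  "nleaves PLeaf = 1"
| "nleaves (Vertex x ts) = sum_list (map nleaves ts)"

primrec nverts :: "'a ptree \<Rightarrow> nat" where
  "nverts PLeaf = 0"
| "nverts (Vertex x ts) = Suc (sum_list (map nverts ts))"

text \<open>Every vertex \<open>v\<close> has \<open>|v| \<ge> 2\<close> incoming edges and is decorated by an element of \<open>P(|v|)\<close>.\<close>

primrec decorated :: "('k, 'a) ns_operad \<Rightarrow> 'a ptree \<Rightarrow> bool" where
  "decorated P PLeaf \<longleftrightarrow> True"
| "decorated P (Vertex x ts) \<longleftrightarrow>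
     length ts \<ge> 2 \<and> x \<in> comps P (length ts) \<and> list_all (decorated P) ts"

text \<open>
  \<open>vertex_slot n C\<close>: \<open>C\<close> sends \<open>x\<close> to a fixed tree in which one fixed vertex, with \<open>n\<close> incoming
  edges, is decorated by \<open>x\<close> and all other vertices have fixed decorations.
\<close>

inductive vertex_slot :: "nat \<Rightarrow> ('a \<Rightarrow> 'a ptree) \<Rightarrow> bool" where
  here: "vertex_slot (length ts) (\<lambda>x. Vertex x ts)"
| below: "vertex_slot n C \<Longrightarrow> vertex_slot n (\<lambda>x. Vertex y (ts @ C x # us))"

definition multilinear :: "('k::field, 'a) ns_operad \<Rightarrow> ('a ptree \<Rightarrow> 'k) \<Rightarrow> bool" where
  "multilinear P \<phi> \<longleftrightarrow>
     (\<forall>n C. vertex_slot n C \<longrightarrow>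
       (\<forall>x\<in>comps P n. \<forall>y\<in>comps P n. \<phi> (C (add P n x y)) = \<phi> (C x) + \<phi> (C y)) \<and>
       (\<forall>c. \<forall>x\<in>comps P n. \<phi> (C (smul P n c x)) = c * \<phi> (C x)))"

text \<open>
  The part of arity \<open>n\<close> and degree \<open>j\<close>. As the components of \<open>P\<close> are finite-dimensional, the space
  \<open>\<Otimes>\<^sub>v P(|v|)\<^sup>\<or>\<close> attached to a tree \<open>T\<close> is the space of multilinear forms on \<open>\<Prod>\<^sub>v P(|v|)\<close>, that is, of
  functions of the decorations of \<open>T\<close> that are linear in each of them. The (finite) direct sum over
  \<open>T\<close> consists of the functions of decorated trees of all the shapes \<open>T\<close>.
\<close>

definition bar :: "('k::field, 'a) ns_operad \<Rightarrow> nat \<Rightarrow> int \<Rightarrow> ('a ptree \<Rightarrow> 'k) set" where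
  "bar P n j =
     {\<phi>. multilinear P \<phi> \<and>
         (\<forall>t. \<phi> t \<noteq> 0 \<longrightarrow> decorated P t \<and> nleaves t = n \<and> int (nverts t) = int n + j - 1)}"

text \<open>
  All contractions of an internal edge, the decorations of its two ends being composed. The internal
  edges are listed in the depth-first order of their upper ends.
\<close>

primrec contractions :: "('k, 'a) ns_operad \<Rightarrow> 'a ptree \<Rightarrow> 'a ptree list" where
  "contractions P PLeaf = []"
| "contractions P (Vertex x ts) =
     (let css = map (contractions P) ts in
      concat (map (\<lambda>i.
          (case ts ! i of
             PLeaf \<Rightarrow> []
           | Vertex y us \<Rightarrow>
               [Vertex (pcomp P (length ts) (length us) (i + 1) x y) (take i ts @ us @ drop (i + 1) ts)])
          @ map (\<lambda>t. Vertex x (ts[i := t])) (css ! i))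
        [0..<length ts]))"

text \<open>
  The sign is the one of the orientation of a tree by the exterior product of its internal edges:
  contracting the \<open>e\<close>-th of them (counted from 0) contributes \<open>(-1)^e\<close>.
\<close>

definition bar_diff :: "('k::field, 'a) ns_operad \<Rightarrow> ('a ptree \<Rightarrow> 'k) \<Rightarrow> ('a ptree \<Rightarrow> 'k)" where
  "bar_diff P \<phi> =
     (\<lambda>t. if decorated P t
          then \<Sum>e<length (contractions P t). (- 1) ^ e * \<phi> (contractions P t ! e) else 0)"

definition koszul :: "('k::field, 'a) ns_operad \<Rightarrow> bool" where
  "koszul P \<longleftrightarrow>
     (\<forall>n\<ge>2. \<forall>j. j \<noteq> 0 \<longrightarrow> {\<phi> \<in> bar P n j. bar_diff P \<phi> = 0} = bar_diff P ` bar P n (j - 1))"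

end

theory Submission
  imports Defs
begin

text \<open>
  The proof exhibits a Poincare-Birkhoff-Witt basis of the operad and contracts the bar complex along
  it.

  Call a labelled binary tree normal if every right edge, from a node \<open>a\<close> to its right child \<open>b\<close>,
  satisfies a fixed condition \<open>ok a b\<close>; left edges are always allowed. Suppose that each monomial
  \<open>x a (y b z)\<close> violating the condition can be rewritten by a relation into left combs and into monomials
  \<open>x a (y b' z)\<close> of smaller weight, and that normal trees are linearly independent in the operad. The
  rewriting lowers a well-founded order which is stable under grafting, so normal trees form a basis,
  and a composite of two of them is either normal or a combination of lower normal trees.

  A tree whose vertices are decorated by normal trees is the same as one labelled binary tree in which
  some inner edges are cut, all bad edges being among them. A form in the bar complex is an arbitrary
  function of such cut trees, and the differential of a form sums, with signs, its values after gluing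
  one cut. To leading order only good cuts matter: gluing a bad one produces lower terms
  (\<open>vanish_nonnormal\<close>). Hence cutting the first good edge pairs off the cut trees, and induction over
  the order makes this pairing a contraction of the complex (\<open>first_good_contraction\<close>,
  \<open>cocycle_is_coboundary\<close>). Only trees without good edges remain; all their edges are cut, so they live
  in degree 0. This gives \<open>koszul_right_pbw\<close>.

  For powers of the dendriform operad, \<open>ok a b\<close> says that in some factor \<open>a\<close> is \<open>\<prec>\<close> and \<open>b\<close> is \<open>\<succ>\<close>. The
  rewriting exists because this condition fails exactly if it fails in each factor. For
  linear independence, put a point of \<open>\<nat>\<^sup>m\<close> at each leaf and label each node of an unlabelled tree by
  comparing, in each coordinate, the maxima over its left and right subtrees. The sum of the
  coefficients of all monomials labelled in this way is a functional that vanishes on the ideal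
  (\<open>evaluate_ideal\<close>), since both sides of a dendriform relation collect the labellings with the
  maximum at a given leaf. For each normal tree there are points at which it fits and every other
  fitting normal tree has a larger left part at the first difference (\<open>separating_point\<close>), and a
  triangularity argument concludes.
\<close>


section \<open>Alternating sums and contractions of decorated trees\<close>

definition alt :: "('a \<Rightarrow> 'k::field) \<Rightarrow> 'a list \<Rightarrow> 'k" where
  "alt \<phi> xs = (\<Sum>e<length xs. (- 1) ^ e * \<phi> (xs ! e))"

lemma alt_Nil [simp]: "alt \<phi> [] = 0"
  by (simp add: alt_def)

lemma alt_Cons [simp]: "alt \<phi> (x # xs) = \<phi> x - alt \<phi> xs"
  by (simp add: alt_def sum.lessThan_Suc_shift sum_negf del: sum.lessThan_Suc)

lemma alt_append [simp]: "alt \<phi> (xs @ ys) = alt \<phi> xs + (- 1) ^ length xs * alt \<phi> ys"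
  by (induction xs) (auto simp: algebra_simps)

lemma alt_map [simp]: "alt \<phi> (map f xs) = alt (\<lambda>x. \<phi> (f x)) xs"
  by (induction xs) auto

lemma alt_cong: "(\<And>x. x \<in> set xs \<Longrightarrow> \<phi> x = \<psi> x) \<Longrightarrow> alt \<phi> xs = alt \<psi> xs"
  by (induction xs) auto

lemma alt_add: "alt (\<lambda>x. \<phi> x + \<psi> x) xs = alt \<phi> xs + alt \<psi> xs"
  by (induction xs) auto

lemma alt_diff: "alt (\<lambda>x. \<phi> x - \<psi> x) xs = alt \<phi> xs - alt \<psi> xs"
  by (induction xs) auto

lemma alt_scale: "alt (\<lambda>x. c * \<phi> x) xs = c * alt \<phi> xs"
  by (induction xs) (auto simp: algebra_simps)

lemma alt_zero: "(\<And>x. x \<in> set xs \<Longrightarrow> \<phi> x = 0) \<Longrightarrow> alt \<phi> xs = 0"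
  by (induction xs) auto

lemma bar_diff_alt:
  "bar_diff P \<phi> t = (if decorated P t then alt \<phi> (contractions P t) else 0)"
  by (simp add: bar_diff_def alt_def)

lemma vertex_slot_replace:
  "vertex_slot n C \<Longrightarrow> decorated P (C x) \<Longrightarrow> y \<in> comps P n \<Longrightarrow> decorated P (C y)"
  by (induction rule: vertex_slot.induct) auto

lemma vertex_slot_nleaves: "vertex_slot n C \<Longrightarrow> nleaves (C x) = nleaves (C y)"
  by (induction rule: vertex_slot.induct) auto

text \<open>
  One summand of the concatenation that defines \<open>contractions\<close>. It is isolated because the dependence
  of the contractions on one decoration has to be discussed separately at its vertex, at the parent
  and at the siblings.
\<close>

definition edge_contractions :: "('k, 'a) ns_operad \<Rightarrow> 'a \<Rightarrow> 'a ptree list \<Rightarrow> nat \<Rightarrow> 'a ptree list" where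
  "edge_contractions P x ts i =
     (case ts ! i of
        PLeaf \<Rightarrow> []
      | Vertex y us \<Rightarrow>
          [Vertex (pcomp P (length ts) (length us) (i + 1) x y) (take i ts @ us @ drop (i + 1) ts)])
     @ map (\<lambda>t. Vertex x (ts[i := t])) (contractions P (ts ! i))"

lemma contractions_Vertex:
  "contractions P (Vertex x ts) = concat (map (edge_contractions P x ts) [0..<length ts])"
  by (auto simp: edge_contractions_def Let_def intro!: arg_cong[where f = concat] map_cong split: ptree.splits)

declare contractions.simps(2) [simp del]

lemma edge_contractions_arity:
  assumes "decorated P (Vertex x ts)" "i < length ts" "t \<in> set (edge_contractions P x ts i)"
    and "\<And>s. s \<in> set (contractions P (ts ! i)) \<Longrightarrow> nleaves s = nleaves (ts ! i) \<and> Suc (nverts s) = nverts (ts ! i)"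
  shows "nleaves t = nleaves (Vertex x ts) \<and> Suc (nverts t) = nverts (Vertex x ts)"
proof -
  have id: "ts = take i ts @ ts ! i # drop (Suc i) ts"
    using assms(2) by (simp add: id_take_nth_drop)
  have split: "sum_list (map f ts) = sum_list (map f (take i ts)) + f (ts ! i) + sum_list (map f (drop (Suc i) ts))"
    for f :: "'b ptree \<Rightarrow> nat"
    by (subst id) simp
  consider (edge) y us where "ts ! i = Vertex y us"
      "t = Vertex (pcomp P (length ts) (length us) (i + 1) x y) (take i ts @ us @ drop (Suc i) ts)"
    | (inner) s where "s \<in> set (contractions P (ts ! i))" "t = Vertex x (ts[i := s])"
    using assms(3) by (cases "ts ! i") (auto simp: edge_contractions_def)
  then show ?thesis
  proof cases
    case edge
    then show ?thesis
      using split[of nleaves] split[of nverts] by simp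
  next
    case inner
    then show ?thesis
      using split[of nleaves] split[of nverts] assms(4)[of s] assms(2)
      by (simp add: upd_conv_take_nth_drop)
  qed
qed

lemma contractions_arity:
  "decorated P t \<Longrightarrow> s \<in> set (contractions P t) \<Longrightarrow> nleaves s = nleaves t \<and> Suc (nverts s) = nverts t"
proof (induction t arbitrary: s)
  case (Vertex x ts)
  from Vertex.prems(2) obtain i where i: "i < length ts" "s \<in> set (edge_contractions P x ts i)"
    by (auto simp: contractions_Vertex)
  have "decorated P (ts ! i)"
    using Vertex.prems(1) i(1) by (auto simp: list_all_iff)
  then show ?case
    using edge_contractions_arity[OF Vertex.prems(1) i] Vertex.IH[of "ts ! i"] i(1) by auto
qed auto


section \<open>Multilinearity of the bar differential\<close>

text \<open>
  Bilinearity of the partial compositions is what makes the differential of a multilinear form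
  multilinear again.
\<close>

locale linear_operad =
  fixes P :: "('k::field, 'a) ns_operad"
  assumes add_closed: "x \<in> comps P n \<Longrightarrow> y \<in> comps P n \<Longrightarrow> add P n x y \<in> comps P n"
    and smul_closed: "x \<in> comps P n \<Longrightarrow> smul P n c x \<in> comps P n"
    and pcomp_closed: "x \<in> comps P m \<Longrightarrow> y \<in> comps P n \<Longrightarrow> 1 \<le> i \<Longrightarrow> i \<le> m \<Longrightarrow>
          pcomp P m n i x y \<in> comps P (m + n - 1)"
    and pcomp_add_left: "x \<in> comps P m \<Longrightarrow> x' \<in> comps P m \<Longrightarrow> y \<in> comps P n \<Longrightarrow> 1 \<le> i \<Longrightarrow> i \<le> m \<Longrightarrow>
          pcomp P m n i (add P m x x') y = add P (m + n - 1) (pcomp P m n i x y) (pcomp P m n i x' y)"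
    and pcomp_smul_left: "x \<in> comps P m \<Longrightarrow> y \<in> comps P n \<Longrightarrow> 1 \<le> i \<Longrightarrow> i \<le> m \<Longrightarrow>
          pcomp P m n i (smul P m c x) y = smul P (m + n - 1) c (pcomp P m n i x y)"
    and pcomp_add_right: "x \<in> comps P m \<Longrightarrow> y \<in> comps P n \<Longrightarrow> y' \<in> comps P n \<Longrightarrow> 1 \<le> i \<Longrightarrow> i \<le> m \<Longrightarrow>
          pcomp P m n i x (add P n y y') = add P (m + n - 1) (pcomp P m n i x y) (pcomp P m n i x y')"
    and pcomp_smul_right: "x \<in> comps P m \<Longrightarrow> y \<in> comps P n \<Longrightarrow> 1 \<le> i \<Longrightarrow> i \<le> m \<Longrightarrow>
          pcomp P m n i x (smul P n c y) = smul P (m + n - 1) c (pcomp P m n i x y)"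
begin

definition linear_map :: "nat \<Rightarrow> nat \<Rightarrow> ('a \<Rightarrow> 'a) \<Rightarrow> bool" where
  "linear_map n n' h \<longleftrightarrow>
     (\<forall>x\<in>comps P n. h x \<in> comps P n' \<and> (\<forall>y\<in>comps P n. h (add P n x y) = add P n' (h x) (h y)) \<and>
        (\<forall>c. h (smul P n c x) = smul P n' c (h x)))"

text \<open>
  Contracting an edge at a vertex replaces its decoration \<open>x\<close> by a composite with \<open>x\<close>: a tree that
  depends on \<open>x\<close> through a linear map followed by a slot.
\<close>

definition linear_slot :: "nat \<Rightarrow> ('a \<Rightarrow> 'a ptree) \<Rightarrow> bool" where
  "linear_slot n D \<longleftrightarrow> (\<exists>n' C h. vertex_slot n' C \<and> linear_map n n' h \<and> D = (\<lambda>x. C (h x)))"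

lemma linear_slotI: "vertex_slot n' C \<Longrightarrow> linear_map n n' h \<Longrightarrow> linear_slot n (\<lambda>x. C (h x))"
  unfolding linear_slot_def by blast

lemma linear_slot_vertex_slot: "vertex_slot n C \<Longrightarrow> linear_slot n C"
  using linear_slotI[of n C n "\<lambda>x. x"] by (simp add: linear_map_def)

lemma linear_slot_below:
  assumes "linear_slot n D"
  shows "linear_slot n (\<lambda>x. Vertex y (ts @ D x # us))"
proof -
  obtain n' C h where *: "vertex_slot n' C" "linear_map n n' h" "D = (\<lambda>x. C (h x))"
    using assms unfolding linear_slot_def by blast
  show ?thesis
    using linear_slotI[OF vertex_slot.below[OF *(1), of y ts us] *(2)] *(3) by simp
qed

lemma linear_slot_additive:
  assumes "multilinear P \<phi>" "linear_slot n D" "x \<in> comps P n"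
  shows "y \<in> comps P n \<Longrightarrow> \<phi> (D (add P n x y)) = \<phi> (D x) + \<phi> (D y)"
    and "\<phi> (D (smul P n c x)) = c * \<phi> (D x)"
proof -
  obtain n' C h where *: "vertex_slot n' C" "linear_map n n' h" "D = (\<lambda>x. C (h x))"
    using assms(2) unfolding linear_slot_def by blast
  show "y \<in> comps P n \<Longrightarrow> \<phi> (D (add P n x y)) = \<phi> (D x) + \<phi> (D y)"
    using * assms(1,3) by (simp add: linear_map_def multilinear_def)
  show "\<phi> (D (smul P n c x)) = c * \<phi> (D x)"
    using * assms(1,3) by (simp add: linear_map_def multilinear_def)
qed

text \<open>
  A list of trees depending linearly on one decoration, with entries at fixed positions; so signs
  given by positions do not spoil the linearity of an alternating sum.
\<close>

definition slot_family :: "nat \<Rightarrow> ('a \<Rightarrow> 'a ptree list) \<Rightarrow> bool" where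
  "slot_family n f \<longleftrightarrow> (\<exists>Ds. f = (\<lambda>x. map (\<lambda>D. D x) Ds) \<and> (\<forall>D\<in>set Ds. linear_slot n D))"

lemma slot_family_Nil: "slot_family n (\<lambda>x. [])"
  unfolding slot_family_def by (rule exI[of _ "[]"]) auto

lemma slot_family_single: "linear_slot n D \<Longrightarrow> slot_family n (\<lambda>x. [D x])"
  unfolding slot_family_def by (rule exI[of _ "[D]"]) auto

lemma slot_family_append:
  "slot_family n f \<Longrightarrow> slot_family n g \<Longrightarrow> slot_family n (\<lambda>x. f x @ g x)"
  unfolding slot_family_def
proof (elim exE conjE)
  fix Ds Es
  assume "f = (\<lambda>x. map (\<lambda>D. D x) Ds)" "g = (\<lambda>x. map (\<lambda>D. D x) Es)"
    "\<forall>D\<in>set Ds. linear_slot n D" "\<forall>D\<in>set Es. linear_slot n D"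
  then show "\<exists>Ds. (\<lambda>x. f x @ g x) = (\<lambda>x. map (\<lambda>D. D x) Ds) \<and> (\<forall>D\<in>set Ds. linear_slot n D)"
    by (intro exI[of _ "Ds @ Es"]) auto
qed

lemma slot_family_map_const:
  assumes "\<And>t. t \<in> set ts \<Longrightarrow> linear_slot n (h t)"
  shows "slot_family n (\<lambda>x. map (\<lambda>t. h t x) ts)"
  unfolding slot_family_def
  by (rule exI[of _ "map h ts"]) (use assms in \<open>auto simp: comp_def\<close>)

lemma slot_family_map_below:
  assumes "slot_family n f"
  shows "slot_family n (\<lambda>x. map (\<lambda>t. Vertex y (ts @ t # us)) (f x))"
proof -
  obtain Ds where Ds: "f = (\<lambda>x. map (\<lambda>D. D x) Ds)" "\<forall>D\<in>set Ds. linear_slot n D"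
    using assms unfolding slot_family_def by blast
  show ?thesis
    unfolding slot_family_def
    by (rule exI[of _ "map (\<lambda>D x. Vertex y (ts @ D x # us)) Ds"])
      (use Ds in \<open>auto simp: comp_def intro: linear_slot_below\<close>)
qed

lemma slot_family_concat:
  assumes "\<And>i. i < l \<Longrightarrow> slot_family n (\<lambda>x. f x i)"
  shows "slot_family n (\<lambda>x. concat (map (f x) [0..<l]))"
  using assms by (induction l) (auto intro: slot_family_Nil slot_family_append)

lemma edge_contractions_slot_root:
  assumes "length ts \<ge> 2" "i < length ts" "list_all (decorated P) ts"
  shows "slot_family (length ts) (\<lambda>x. edge_contractions P x ts i)"
proof -
  have "slot_family (length ts) (\<lambda>x. map (\<lambda>t. Vertex x (ts[i := t])) (contractions P (ts ! i)))"
    using vertex_slot.here[of "ts[i := t]" for t]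
    by (intro slot_family_map_const linear_slot_vertex_slot) simp
  moreover have "slot_family (length ts) (\<lambda>x. case ts ! i of PLeaf \<Rightarrow> [] | Vertex y us \<Rightarrow>
      [Vertex (pcomp P (length ts) (length us) (i + 1) x y) (take i ts @ us @ drop (i + 1) ts)])"
  proof (cases "ts ! i")
    case PLeaf
    then show ?thesis by (simp add: slot_family_Nil)
  next
    case (Vertex y us)
    have "decorated P (Vertex y us)"
      using assms Vertex by (metis list_all_length)
    then have y: "y \<in> comps P (length us)" and len: "length us \<ge> 2"
      by auto
    have "linear_map (length ts) (length ts + length us - 1)
        (\<lambda>x. pcomp P (length ts) (length us) (i + 1) x y)"
      unfolding linear_map_def
      using assms(2) y by (intro ballI conjI allI pcomp_closed pcomp_add_left pcomp_smul_left) simp_all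
    moreover have "length (take i ts @ us @ drop (i + 1) ts) = length ts + length us - 1"
      using assms by simp
    ultimately have "linear_map (length ts) (length (take i ts @ us @ drop (i + 1) ts))
        (\<lambda>x. pcomp P (length ts) (length us) (i + 1) x y)"
      by (simp only:)
    from linear_slotI[OF vertex_slot.here this]
    have "linear_slot (length ts) (\<lambda>x. Vertex (pcomp P (length ts) (length us) (i + 1) x y)
        (take i ts @ us @ drop (i + 1) ts))" .
    then show ?thesis
      using Vertex by (auto intro: slot_family_single)
  qed
  ultimately show ?thesis
    unfolding edge_contractions_def by (rule slot_family_append[rotated])
qed

lemma edge_contractions_slot_sibling:
  assumes "vertex_slot n C" "i < length ts + length us + 1" "i \<noteq> length ts"
  shows "slot_family n (\<lambda>x. edge_contractions P y (ts @ C x # us) i)"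
proof -
  let ?t = "if i < length ts then ts ! i else us ! (i - length ts - 1)"
  have nth: "(ts @ C x # us) ! i = ?t" for x
    using assms(3) by (auto simp: nth_append)
  have "slot_family n (\<lambda>x. map (\<lambda>t. Vertex y ((ts @ C x # us)[i := t])) (contractions P ?t))"
  proof (cases "i < length ts")
    case True
    then show ?thesis
      by (auto simp: list_update_append intro!: slot_family_map_const linear_slot_vertex_slot vertex_slot.below assms)
  next
    case False
    then obtain k where k: "i = Suc (length ts + k)"
      using assms(3) by (metis add_Suc_right linorder_neqE_nat less_imp_Suc_add)
    then show ?thesis
      by (auto simp: list_update_append intro!: slot_family_map_const linear_slot_vertex_slot vertex_slot.below assms)
  qed
  moreover have "slot_family n (\<lambda>x. case ?t of PLeaf \<Rightarrow> [] | Vertex z vs \<Rightarrow>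
      [Vertex (pcomp P (length (ts @ C x # us)) (length vs) (i + 1) y z)
        (take i (ts @ C x # us) @ vs @ drop (i + 1) (ts @ C x # us))])"
  proof (cases ?t)
    case PLeaf
    then show ?thesis by (simp only: slot_family_Nil ptree.case)
  next
    case (Vertex z vs)
    have "linear_slot n (\<lambda>x. Vertex (pcomp P (length (ts @ C x # us)) (length vs) (i + 1) y z)
        (take i (ts @ C x # us) @ vs @ drop (i + 1) (ts @ C x # us)))"
    proof (cases "i < length ts")
      case True
      show ?thesis
        using linear_slot_vertex_slot[OF vertex_slot.below[OF assms(1),
            of "pcomp P (length ts + length us + 1) (length vs) (i + 1) y z"
               "take i ts @ vs @ drop (i + 1) ts" us]] True
        by simp
    next
      case False
      then obtain k where k: "i = Suc (length ts + k)"
        using assms(3) by (metis add_Suc_right linorder_neqE_nat less_imp_Suc_add)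
      show ?thesis
        using linear_slot_vertex_slot[OF vertex_slot.below[OF assms(1),
            of "pcomp P (length ts + length us + 1) (length vs) (i + 1) y z"
               ts "take k us @ vs @ drop (k + 1) us"]] k
        by simp
    qed
    then show ?thesis
      unfolding Vertex ptree.case by (rule slot_family_single)
  qed
  ultimately show ?thesis
    unfolding edge_contractions_def nth by (rule slot_family_append[rotated])
qed

lemma edge_contractions_slot_child:
  assumes C: "vertex_slot n C" and dec: "decorated P (Vertex y (ts @ C x0 # us))"
    and IH: "slot_family n (\<lambda>x. contractions P (C x))"
  shows "slot_family n (\<lambda>x. edge_contractions P y (ts @ C x # us) (length ts))"
proof -
  let ?l = "length ts + length us + 1"
  have "slot_family n (\<lambda>x. map (\<lambda>t. Vertex y ((ts @ C x # us)[length ts := t])) (contractions P (C x)))"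
    using slot_family_map_below[OF IH, of y ts us] by simp
  moreover have "slot_family n (\<lambda>x. case C x of PLeaf \<Rightarrow> [] | Vertex z vs \<Rightarrow>
      [Vertex (pcomp P ?l (length vs) (length ts + 1) y z) (ts @ vs @ us)])"
    using C
  proof (cases rule: vertex_slot.cases)
    case (here vs)
    have y: "y \<in> comps P ?l"
      using dec by simp
    have "linear_map n (?l + length vs - 1) (\<lambda>x. pcomp P ?l (length vs) (length ts + 1) y x)"
      unfolding linear_map_def here
      using y by (intro ballI conjI allI pcomp_closed pcomp_add_right pcomp_smul_right) simp_all
    moreover have "length (ts @ vs @ us) = ?l + length vs - 1"
      by simp
    ultimately have "linear_map n (length (ts @ vs @ us)) (\<lambda>x. pcomp P ?l (length vs) (length ts + 1) y x)"
      by (simp only:)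
    from linear_slotI[OF vertex_slot.here this] show ?thesis
      unfolding here by (auto intro: slot_family_single)
  next
    case (below C' z vs ws)
    show ?thesis
      using linear_slot_vertex_slot[OF vertex_slot.below[OF below(2),
          of "pcomp P ?l (length (vs @ x # ws)) (length ts + 1) y z" "ts @ vs" "ws @ us" for x]]
      unfolding below by (auto intro!: slot_family_single)
  qed
  moreover have "edge_contractions P y (ts @ C x # us) (length ts) = (case C x of PLeaf \<Rightarrow> [] | Vertex z vs \<Rightarrow>
      [Vertex (pcomp P ?l (length vs) (length ts + 1) y z) (ts @ vs @ us)]) @
      map (\<lambda>t. Vertex y ((ts @ C x # us)[length ts := t])) (contractions P (C x))" for x
    by (simp add: edge_contractions_def split: ptree.split)
  ultimately show ?thesis
    by (simp only: slot_family_append)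
qed

lemma contractions_slot:
  "vertex_slot n C \<Longrightarrow> decorated P (C x0) \<Longrightarrow> slot_family n (\<lambda>x. contractions P (C x))"
proof (induction rule: vertex_slot.induct)
  case (here ts)
  then show ?case
    unfolding contractions_Vertex
    by (intro slot_family_concat edge_contractions_slot_root) auto
next
  case (below n C y ts us)
  have "slot_family n (\<lambda>x. edge_contractions P y (ts @ C x # us) i)" if "i < length ts + length us + 1" for i
    using edge_contractions_slot_sibling[OF below.hyps, of i ts us y] that
      edge_contractions_slot_child[OF below.hyps below.prems] below.IH below.prems
    by (cases "i = length ts") auto
  then show ?case
    unfolding contractions_Vertex length_append list.size(4)
    by (intro slot_family_concat) simp
qed

lemma bar_diff_multilinear:
  assumes "multilinear P \<phi>"
  shows "multilinear P (bar_diff P \<phi>)"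
  unfolding multilinear_def
proof (intro allI impI)
  fix n and C :: "'a \<Rightarrow> 'a ptree"
  assume C: "vertex_slot n C"
  show "(\<forall>x\<in>comps P n. \<forall>y\<in>comps P n. bar_diff P \<phi> (C (add P n x y)) = bar_diff P \<phi> (C x) + bar_diff P \<phi> (C y)) \<and>
       (\<forall>c. \<forall>x\<in>comps P n. bar_diff P \<phi> (C (smul P n c x)) = c * bar_diff P \<phi> (C x))"
  proof (cases "\<exists>x0. decorated P (C x0)")
    case True
    then obtain x0 where x0: "decorated P (C x0)" by blast
    obtain Ds where Ds: "\<And>x. contractions P (C x) = map (\<lambda>D. D x) Ds" "\<forall>D\<in>set Ds. linear_slot n D"
      using contractions_slot[OF C x0] unfolding slot_family_def by metis
    have dec: "decorated P (C x)" if "x \<in> comps P n" for x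
      using vertex_slot_replace[OF C x0 that] .
    show ?thesis
      using Ds(2) by (auto simp: bar_diff_alt dec Ds(1) add_closed smul_closed alt_add[symmetric] alt_scale[symmetric]
          linear_slot_additive[OF assms] intro!: alt_cong)
  next
    case False
    then show ?thesis by (auto simp: bar_diff_alt)
  qed
qed

lemma bar_diff_bar:
  assumes "\<phi> \<in> bar P n (j - 1)"
  shows "bar_diff P \<phi> \<in> bar P n j"
proof -
  have "nleaves t = n \<and> int (nverts t) = int n + j - 1" if nz: "bar_diff P \<phi> t \<noteq> 0" for t
  proof -
    have dec: "decorated P t" and "alt \<phi> (contractions P t) \<noteq> 0"
      using nz by (auto simp: bar_diff_alt split: if_splits)
    then obtain s where s: "s \<in> set (contractions P t)" "\<phi> s \<noteq> 0"
      using alt_zero[of "contractions P t" \<phi>] by metis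
    then show ?thesis
      using assms contractions_arity[OF dec s(1)] by (auto simp: bar_def)
  qed
  then show ?thesis
    using assms bar_diff_multilinear by (auto simp: bar_def bar_diff_alt)
qed

end

lemma alt_swap: "alt (\<lambda>x. alt (f x) ys) xs = alt (\<lambda>y. alt (\<lambda>x. f x y) xs) ys"
  by (induction xs) (auto simp: alt_zero alt_diff)


section \<open>Cut binary trees\<close>

text \<open>
  \<open>ok a b\<close> means that the monomial \<open>x a (y b z)\<close> is normal.
\<close>

definition right_ok :: "('b \<Rightarrow> 'b \<Rightarrow> bool) \<Rightarrow> 'b \<Rightarrow> 'b tree \<Rightarrow> bool" where
  "right_ok ok a t \<longleftrightarrow> (case t of \<langle>\<rangle> \<Rightarrow> True | \<langle>_, b, _\<rangle> \<Rightarrow> ok a b)"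

primrec normal :: "('b \<Rightarrow> 'b \<Rightarrow> bool) \<Rightarrow> 'b tree \<Rightarrow> bool" where
  "normal ok \<langle>\<rangle> \<longleftrightarrow> True"
| "normal ok \<langle>l, a, r\<rangle> \<longleftrightarrow> normal ok l \<and> normal ok r \<and> right_ok ok a r"

text \<open>
  The components consist of the normal trees only. Bare trees carry no linear structure: the record is
  there so that \<open>decorated\<close> and \<open>contractions\<close> apply to trees of binary trees. With the trivial
  condition \<open>ok\<close> the decorations are arbitrary monomials.
\<close>

definition tree_operad :: "('b \<Rightarrow> 'b \<Rightarrow> bool) \<Rightarrow> 'b set \<Rightarrow> (unit, 'b tree) ns_operad" where
  "tree_operad ok \<Omega> =
     \<lparr> comps = (\<lambda>n. {t. set_tree t \<subseteq> \<Omega> \<and> size1 t = n \<and> normal ok t}),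
       add = undefined, smul = undefined, unit_op = \<langle>\<rangle>, pcomp = (\<lambda>m n i. graft i) \<rparr>"

text \<open>
  The flag at a node tells whether the edge above it is cut. There is no edge above the root, whose
  flag is required to be \<open>False\<close> (\<open>root_uncut\<close>) when the whole tree is considered; flagged roots occur
  in subtrees.
\<close>

type_synonym 'b cut_tree = "('b \<times> bool) tree"

text \<open>
  The piece at the root together with the trees of pieces hanging from its leaves. Above a cut edge
  this piece is trivial, and everything hangs from its only leaf.
\<close>

primrec top_block :: "'b cut_tree \<Rightarrow> 'b tree \<times> 'b tree ptree list" where
  "top_block \<langle>\<rangle> = (\<langle>\<rangle>, [PLeaf])"
| "top_block \<langle>l, x, r\<rangle> =
     (let s = \<langle>fst (top_block l), fst x, fst (top_block r)\<rangle>;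
          ts = snd (top_block l) @ snd (top_block r)
      in if snd x then (\<langle>\<rangle>, [Vertex s ts]) else (s, ts))"

definition blocks :: "'b cut_tree \<Rightarrow> 'b tree ptree" where
  "blocks T = Vertex (fst (top_block T)) (snd (top_block T))"

definition root_uncut :: "'b cut_tree \<Rightarrow> bool" where
  "root_uncut T \<longleftrightarrow> (\<exists>l a r. T = \<langle>l, (a, False), r\<rangle>)"

primrec ncuts :: "'b cut_tree \<Rightarrow> nat" where
  "ncuts \<langle>\<rangle> = 0"
| "ncuts \<langle>l, x, r\<rangle> = ncuts l + ncuts r + (if snd x then 1 else 0)"

primrec cut_ok :: "('b \<Rightarrow> 'b \<Rightarrow> bool) \<Rightarrow> 'b set \<Rightarrow> 'b cut_tree \<Rightarrow> bool" where
  "cut_ok ok \<Omega> \<langle>\<rangle> \<longleftrightarrow> True"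
| "cut_ok ok \<Omega> \<langle>l, x, r\<rangle> \<longleftrightarrow> cut_ok ok \<Omega> l \<and> cut_ok ok \<Omega> r \<and> fst x \<in> \<Omega> \<and>
     (case r of \<langle>\<rangle> \<Rightarrow> True | \<langle>_, y, _\<rangle> \<Rightarrow> snd y \<or> ok (fst x) (fst y))"

text \<open>
  Gluing one cut, in the preorder of the nodes. This is the order in which \<open>contractions\<close> runs through
  the edges of the tree of pieces.
\<close>

primrec uncuts :: "'b cut_tree \<Rightarrow> 'b cut_tree list" where
  "uncuts \<langle>\<rangle> = []"
| "uncuts \<langle>l, x, r\<rangle> =
     (if snd x then [\<langle>l, (fst x, False), r\<rangle>] else []) @
     map (\<lambda>l'. \<langle>l', x, r\<rangle>) (uncuts l) @ map (\<lambda>r'. \<langle>l, x, r'\<rangle>) (uncuts r)"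

lemma size1_top_block: "size1 (fst (top_block T)) = length (snd (top_block T))"
  by (induction T) (auto simp: Let_def)

lemma nleaves_top_block: "sum_list (map nleaves (snd (top_block T))) = size1 T"
  by (induction T) (auto simp: Let_def)

lemma nverts_top_block: "sum_list (map nverts (snd (top_block T))) = ncuts T"
  by (induction T) (auto simp: Let_def)

lemma nleaves_blocks: "nleaves (blocks T) = size1 T"
  by (simp add: blocks_def nleaves_top_block)

lemma nverts_blocks: "nverts (blocks T) = Suc (ncuts T)"
  by (simp add: blocks_def nverts_top_block)

lemma top_block_root: "fst (top_block T) = \<langle>\<rangle> \<longleftrightarrow> \<not> root_uncut T"
  by (cases T) (auto simp: root_uncut_def Let_def)

lemma right_ok_top_block:
  "right_ok ok a (fst (top_block r)) \<longleftrightarrow> (case r of \<langle>\<rangle> \<Rightarrow> True | \<langle>_, y, _\<rangle> \<Rightarrow> snd y \<or> ok a (fst y))"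
  by (cases r) (auto simp: Let_def right_ok_def)

lemma size1_ge_2: "size1 l + size1 r \<ge> 2" for l r :: "'a tree"
  by (simp add: size1_size)

lemma decorated_top_block:
  "list_all (decorated (tree_operad ok \<Omega>)) (snd (top_block T)) \<and> normal ok (fst (top_block T)) \<and>
     set_tree (fst (top_block T)) \<subseteq> \<Omega> \<longleftrightarrow> cut_ok ok \<Omega> T"
proof (induction T)
  case (Node l x r)
  have "length (snd (top_block l)) + length (snd (top_block r)) \<ge> 2"
    using size1_ge_2[of "fst (top_block l)" "fst (top_block r)"] by (simp add: size1_top_block)
  then show ?case
    using Node by (auto simp: Let_def tree_operad_def size1_top_block right_ok_top_block)
qed auto

lemma decorated_blocks:
  assumes "root_uncut T"
  shows "decorated (tree_operad ok \<Omega>) (blocks T) \<longleftrightarrow> cut_ok ok \<Omega> T"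
proof -
  obtain l a r where T: "T = \<langle>l, (a, False), r\<rangle>"
    using assms by (auto simp: root_uncut_def)
  have "length (snd (top_block T)) \<ge> 2"
    using size1_ge_2[of "fst (top_block l)" "fst (top_block r)"] by (simp add: size1_top_block T)
  then show ?thesis
    using decorated_top_block[of ok \<Omega> T] by (auto simp: blocks_def tree_operad_def size1_top_block)
qed

text \<open>
  The numbers of leaves of the pieces determine how the list of hanging trees splits between the two
  subtrees of a node.
\<close>

lemma top_block_inject: "top_block T = top_block T' \<Longrightarrow> T = T'"
proof (induction T arbitrary: T')
  case Leaf
  then show ?case by (cases T') (auto simp: Let_def split: if_splits)
next
  case (Node l x r)
  obtain l' x' r' where T': "T' = \<langle>l', x', r'\<rangle>"
    using Node.prems by (cases T') (auto simp: Let_def split: if_splits)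
  have eq: "fst (top_block l) = fst (top_block l')" "fst x = fst x'" "snd x = snd x'"
      "fst (top_block r) = fst (top_block r')"
      "snd (top_block l) @ snd (top_block r) = snd (top_block l') @ snd (top_block r')"
    using Node.prems unfolding T' by (auto simp: Let_def split: if_splits)
  then have "length (snd (top_block l)) = length (snd (top_block l'))"
    by (metis size1_top_block)
  then have "top_block l = top_block l'" "top_block r = top_block r'"
    using eq by (auto simp: prod_eq_iff)
  then show ?case
    using Node.IH eq T' by (auto simp: prod_eq_iff)
qed

lemma blocks_inject: "blocks T = blocks T' \<Longrightarrow> T = T'"
  by (rule top_block_inject) (simp add: blocks_def prod_eq_iff)

lemma top_block_surj_tree:
  "size1 s = length ts \<Longrightarrow> (\<And>t. t \<in> set ts \<Longrightarrow> \<exists>T. top_block T = (\<langle>\<rangle>, [t])) \<Longrightarrow> \<exists>T. top_block T = (s, ts)"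
proof (induction s arbitrary: ts)
  case Leaf
  then show ?case by (cases ts) auto
next
  case (Node l a r)
  let ?us = "take (size1 l) ts" and ?vs = "drop (size1 l) ts"
  have "\<exists>T. top_block T = (l, ?us)"
    using Node.prems by (intro Node.IH(1)) (auto dest: in_set_takeD)
  moreover have "\<exists>T. top_block T = (r, ?vs)"
    using Node.prems by (intro Node.IH(2)) (auto dest: in_set_dropD)
  ultimately obtain L R where "top_block L = (l, ?us)" "top_block R = (r, ?vs)"
    by blast
  then have "top_block \<langle>L, (a, False), R\<rangle> = (\<langle>l, a, r\<rangle>, ts)"
    by simp
  then show ?case by blast
qed

lemma top_block_surj:
  "decorated (tree_operad ok \<Omega>) Z \<Longrightarrow> \<exists>T. top_block T = (\<langle>\<rangle>, [Z])"
proof (induction Z)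
  case PLeaf
  then show ?case by (intro exI[of _ "\<langle>\<rangle>"]) simp
next
  case (Vertex s ts)
  have len: "length ts \<ge> 2" "size1 s = length ts"
    using Vertex.prems by (auto simp: tree_operad_def)
  obtain T where T: "top_block T = (s, ts)"
    using top_block_surj_tree[of s ts] Vertex len by (auto simp: list_all_iff)
  have "s \<noteq> \<langle>\<rangle>"
    using len by auto
  then obtain l a r where "T = \<langle>l, (a, False), r\<rangle>"
    using top_block_root[of T] T by (auto simp: root_uncut_def)
  then have "top_block \<langle>l, (a, True), r\<rangle> = (\<langle>\<rangle>, [Vertex s ts])"
    using T by (simp add: Let_def)
  then show ?case by blast
qed

text \<open>
  Together with \<open>blocks_inject\<close>: trees of binary trees and cut binary trees are the same thing.
\<close>

lemma blocks_surj:
  assumes "decorated (tree_operad ok \<Omega>) Z" "nleaves Z \<ge> 2"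
  obtains T where "root_uncut T" "Z = blocks T"
proof -
  obtain T where T: "top_block T = (\<langle>\<rangle>, [Z])"
    using top_block_surj[OF assms(1)] by blast
  then obtain l a c r where T': "T = \<langle>l, (a, c), r\<rangle>"
    using assms(2) by (cases T) auto
  have "Z = blocks \<langle>l, (a, False), r\<rangle>"
    using T unfolding T' by (auto simp: Let_def blocks_def split: if_splits)
  then show ?thesis
    using that[of "\<langle>l, (a, False), r\<rangle>"] by (simp add: root_uncut_def)
qed

text \<open>
  The contractions of a vertex with its children, as pairs, so that they can be computed by recursion
  over the decoration of the vertex.
\<close>

definition block_contractions ::
    "('k, 'b tree) ns_operad \<Rightarrow> 'b tree \<Rightarrow> 'b tree ptree list \<Rightarrow> ('b tree \<times> 'b tree ptree list) list" where
  "block_contractions P s ts = concat (map (\<lambda>i.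
     (case ts ! i of PLeaf \<Rightarrow> [] | Vertex y us \<Rightarrow> [(graft (i + 1) s y, take i ts @ us @ drop (i + 1) ts)])
     @ map (\<lambda>t. (s, ts[i := t])) (contractions P (ts ! i))) [0..<length ts])"

lemma contractions_block:
  assumes "\<And>m n i. pcomp P m n i = graft i"
  shows "contractions P (Vertex s ts) = map (case_prod Vertex) (block_contractions P s ts)"
  unfolding contractions_Vertex block_contractions_def map_concat map_map
  by (intro arg_cong[where f = concat] map_cong refl)
    (auto simp: edge_contractions_def assms split: ptree.split)

lemma block_contractions_Leaf:
  "block_contractions P \<langle>\<rangle> [t] =
     (case t of PLeaf \<Rightarrow> [] | Vertex y us \<Rightarrow> [(y, us)]) @ map (\<lambda>t'. (\<langle>\<rangle>, [t'])) (contractions P t)"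
  by (auto simp: block_contractions_def split: ptree.split)

lemma block_contractions_Node:
  assumes "length ts = size1 l"
  shows "block_contractions P \<langle>l, a, r\<rangle> (ts @ us) =
     map (\<lambda>(s, vs). (\<langle>s, a, r\<rangle>, vs @ us)) (block_contractions P l ts) @
     map (\<lambda>(s, vs). (\<langle>l, a, s\<rangle>, ts @ vs)) (block_contractions P r us)"
proof -
  have upt: "[0..<length (ts @ us)] = [0..<length ts] @ map (\<lambda>i. length ts + i) [0..<length us]"
    using upt_add_eq_append[of 0 "length ts" "length us"] by (simp add: map_add_upt add.commute)
  show ?thesis
    unfolding block_contractions_def upt map_append concat_append map_concat map_map
    using assms
    by (intro arg_cong2[where f = append] arg_cong[where f = concat] map_cong refl)
      (auto simp: nth_append list_update_append split: ptree.split)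
qed

lemma block_contractions_top_block:
  assumes "\<And>m n i. pcomp P m n i = graft i"
  shows "block_contractions P (fst (top_block T)) (snd (top_block T)) = map top_block (uncuts T)"
proof (induction T)
  case Leaf
  then show ?case by (simp add: block_contractions_Leaf)
next
  case (Node l x r)
  let ?s = "\<langle>fst (top_block l), fst x, fst (top_block r)\<rangle>"
  let ?ts = "snd (top_block l) @ snd (top_block r)"
  have bl: "block_contractions P ?s ?ts = map (\<lambda>l'. top_block \<langle>l', (fst x, False), r\<rangle>) (uncuts l) @
      map (\<lambda>r'. top_block \<langle>l, (fst x, False), r'\<rangle>) (uncuts r)"
    by (subst block_contractions_Node) (auto simp: size1_top_block Node.IH case_prod_unfold)
  show ?case
  proof (cases "snd x")
    case True
    then show ?thesis
      by (simp add: Let_def block_contractions_Leaf contractions_block[OF assms] bl)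
  next
    case False
    then show ?thesis
      using bl by (simp add: Let_def)
  qed
qed

text \<open>
  In terms of cut trees the bar differential is as simple as possible: grafting two adjacent pieces
  glues the cut between them and leaves the binary tree itself unchanged.
\<close>

lemma contractions_blocks: "contractions (tree_operad ok \<Omega>) (blocks T) = map blocks (uncuts T)"
  unfolding blocks_def
  by (subst contractions_block) (auto simp: block_contractions_top_block tree_operad_def case_prod_unfold)

lemma length_uncuts: "length (uncuts T) = ncuts T"
  by (induction T) auto

lemma uncuts_invariants:
  "T' \<in> set (uncuts T) \<Longrightarrow> map_tree fst T' = map_tree fst T \<and> Suc (ncuts T') = ncuts T \<and>
     (root_uncut T \<longrightarrow> root_uncut T')"
proof (induction T arbitrary: T')
  case (Node l x r)
  from Node.prems consider "snd x" "T' = \<langle>l, (fst x, False), r\<rangle>"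
    | l' where "l' \<in> set (uncuts l)" "T' = \<langle>l', x, r\<rangle>"
    | r' where "r' \<in> set (uncuts r)" "T' = \<langle>l, x, r'\<rangle>"
    by (auto split: if_splits)
  then show ?case
    using Node.IH by cases (auto simp: root_uncut_def)
qed auto

text \<open>
  Two cuts can be glued in either order. Gluing the earlier one first lowers the position of the later
  one by one, so the two results carry opposite signs.
\<close>

lemma uncuts_squared:
  fixes \<phi> :: "'b cut_tree \<Rightarrow> 'k::field"
  shows "alt (\<lambda>T'. alt \<phi> (uncuts T')) (uncuts T) = 0"
proof (induction T arbitrary: \<phi>)
  case Leaf
  then show ?case by simp
next
  case (Node l x r)
  let ?X = "\<lambda>c. alt (\<lambda>l'. alt (\<lambda>r'. \<phi> \<langle>l', c, r'\<rangle>) (uncuts r)) (uncuts l)"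
  have swap: "alt (\<lambda>r'. alt (\<lambda>l'. \<phi> \<langle>l', c, r'\<rangle>) (uncuts l)) (uncuts r) = ?X c" for c
    by (simp add: alt_swap[of _ "uncuts l"])
  \<comment> \<open>Gluing a cut on the left removes it from \<open>ncuts l\<close>, the number of signs picked up by cuts on the
    right. Hence the mixed terms cancel.\<close>
  have left: "alt (\<lambda>l'. (- 1) ^ ncuts l' * f l') (uncuts l) = - ((- 1) ^ ncuts l * alt f (uncuts l))"
    for f :: "'b cut_tree \<Rightarrow> 'k"
  proof -
    have "alt (\<lambda>l'. (- 1) ^ ncuts l' * f l') (uncuts l) = alt (\<lambda>l'. - ((- 1) ^ ncuts l) * f l') (uncuts l)"
    proof (rule alt_cong)
      fix l'
      assume "l' \<in> set (uncuts l)"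
      then have "ncuts l = Suc (ncuts l')"
        using uncuts_invariants[of l' l] by simp
      then show "(- 1) ^ ncuts l' * f l' = - ((- 1) ^ ncuts l) * f l'"
        by simp
    qed
    then show ?thesis by (simp add: alt_scale del: mult_minus_left) simp
  qed
  have sq: "(- 1) ^ k * ((- 1) ^ k * z) = z" for k and z :: 'k
    by (simp flip: mult.assoc power_add)
  have neg: "alt (\<lambda>x. - f x) xs = - alt f xs" for f :: "'b cut_tree \<Rightarrow> 'k" and xs
    using alt_scale[of "- 1" f xs] by simp
  show ?case
    by (cases "snd x")
      (auto simp: length_uncuts alt_add alt_diff alt_scale left Node.IH swap neg sq algebra_simps)
qed


section \<open>The first good edge\<close>

text \<open>
  Sets the flag of the first good edge in preorder. Since all left edges are good, the search descends
  along the right spine as long as left children are leaves and right edges are bad.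
\<close>

fun mark :: "('b \<Rightarrow> 'b \<Rightarrow> bool) \<Rightarrow> bool \<Rightarrow> 'b cut_tree \<Rightarrow> 'b cut_tree" where
  "mark ok c \<langle>\<langle>ll, y, lr\<rangle>, x, r\<rangle> = \<langle>\<langle>ll, (fst y, c), lr\<rangle>, x, r\<rangle>"
| "mark ok c \<langle>\<langle>\<rangle>, x, \<langle>rl, y, rr\<rangle>\<rangle> =
     (if ok (fst x) (fst y) then \<langle>\<langle>\<rangle>, x, \<langle>rl, (fst y, c), rr\<rangle>\<rangle> else \<langle>\<langle>\<rangle>, x, mark ok c \<langle>rl, y, rr\<rangle>\<rangle>)"
| "mark ok c \<langle>\<langle>\<rangle>, x, \<langle>\<rangle>\<rangle> = \<langle>\<langle>\<rangle>, x, \<langle>\<rangle>\<rangle>"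
| "mark ok c \<langle>\<rangle> = \<langle>\<rangle>"

fun has_good :: "('b \<Rightarrow> 'b \<Rightarrow> bool) \<Rightarrow> 'b cut_tree \<Rightarrow> bool" where
  "has_good ok \<langle>\<langle>ll, y, lr\<rangle>, x, r\<rangle> \<longleftrightarrow> True"
| "has_good ok \<langle>\<langle>\<rangle>, x, \<langle>rl, y, rr\<rangle>\<rangle> \<longleftrightarrow> ok (fst x) (fst y) \<or> has_good ok \<langle>rl, y, rr\<rangle>"
| "has_good ok \<langle>\<langle>\<rangle>, x, \<langle>\<rangle>\<rangle> \<longleftrightarrow> False"
| "has_good ok \<langle>\<rangle> \<longleftrightarrow> False"

lemma mark_Node: "\<exists>l' r'. mark ok c \<langle>l, x, r\<rangle> = \<langle>l', x, r'\<rangle>"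
  by (cases l; cases r) auto

lemma map_tree_mark: "map_tree fst (mark ok c T) = map_tree fst T"
  by (induction ok c T rule: mark.induct) auto

lemma size1_mark: "size1 (mark ok c T) = size1 T"
  by (induction ok c T rule: mark.induct) auto

lemma root_uncut_mark: "root_uncut (mark ok c T) \<longleftrightarrow> root_uncut T"
  by (induction ok c T rule: mark.induct) (auto simp: root_uncut_def)

lemma mark_mark: "mark ok c (mark ok d T) = mark ok c T"
proof (induction ok d T rule: mark.induct)
  case (2 ok d x rl y rr)
  then show ?case using mark_Node[of ok d rl y rr] by auto
qed auto

lemma has_good_mark: "has_good ok (mark ok d T) \<longleftrightarrow> has_good ok T"
proof (induction ok d T rule: mark.induct)
  case (2 ok d x rl y rr)
  then show ?case using mark_Node[of ok d rl y rr] by auto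
qed auto

lemma ncuts_mark: "has_good ok T \<Longrightarrow> ncuts (mark ok True T) = Suc (ncuts (mark ok False T))"
  by (induction ok T rule: has_good.induct) auto

lemma mark_cases: "T = mark ok True T \<or> T = mark ok False T"
  by (induction ok T rule: has_good.induct) auto

lemma cut_ok_mark: "cut_ok ok \<Omega> (mark ok c T) \<longleftrightarrow> cut_ok ok \<Omega> T"
proof (induction ok c T rule: mark.induct)
  case (2 ok d x rl y rr)
  then show ?case using mark_Node[of ok d rl y rr] by (cases rr) auto
next
  case (1 ok c ll y lr x r)
  then show ?case by (cases lr) auto
qed auto

text \<open>
  A tree without good edges is a right comb with bad edges only, and these are all cut.
\<close>

lemma ncuts_no_good:
  "\<not> has_good ok T \<Longrightarrow> cut_ok ok \<Omega> T \<Longrightarrow> T \<noteq> \<langle>\<rangle> \<Longrightarrow> ncuts T = size T - (if root_uncut T then 1 else 0)"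
proof (induction ok T rule: has_good.induct)
  case (2 ok x rl y rr)
  then show ?case by (auto simp: root_uncut_def prod_eq_iff split: if_splits)
qed (auto simp: root_uncut_def prod_eq_iff)

text \<open>
  Gluing another cut does not change which edge is the first good one, because this depends on the
  labelled tree only. So the flag of that edge survives in all entries but one.
\<close>

lemma uncuts_first_good:
  "has_good ok T \<Longrightarrow> mark ok True T = T \<Longrightarrow>
     \<exists>xs ys. uncuts T = xs @ mark ok False T # ys \<and>
       (\<forall>T'\<in>set xs \<union> set ys. has_good ok T' \<and> mark ok True T' = T')"
proof (induction ok T rule: has_good.induct)
  case (1 ok ll y lr x r)
  then have "snd y" by (auto simp: prod_eq_iff)
  let ?ps = "if snd x then [\<langle>\<langle>ll, y, lr\<rangle>, (fst x, False), r\<rangle>] else []"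
  let ?qs = "map (\<lambda>l'. \<langle>\<langle>l', y, lr\<rangle>, x, r\<rangle>) (uncuts ll) @ map (\<lambda>r'. \<langle>\<langle>ll, y, r'\<rangle>, x, r\<rangle>) (uncuts lr) @
      map (\<lambda>r'. \<langle>\<langle>ll, y, lr\<rangle>, x, r'\<rangle>) (uncuts r)"
  show ?case
    using \<open>snd y\<close> 1 by (intro exI[of _ ?ps] exI[of _ ?qs]) auto
next
  case (2 ok x rl y rr)
  let ?R = "\<langle>rl, y, rr\<rangle>"
  let ?ps = "if snd x then [\<langle>\<langle>\<rangle>, (fst x, False), ?R\<rangle>] else []"
  show ?case
  proof (cases "ok (fst x) (fst y)")
    case True
    then have "snd y" using 2 by (auto simp: prod_eq_iff)
    let ?qs = "map (\<lambda>l'. \<langle>\<langle>\<rangle>, x, \<langle>l', y, rr\<rangle>\<rangle>) (uncuts rl) @ map (\<lambda>r'. \<langle>\<langle>\<rangle>, x, \<langle>rl, y, r'\<rangle>\<rangle>) (uncuts rr)"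
    show ?thesis
      using \<open>snd y\<close> 2 True by (intro exI[of _ ?ps] exI[of _ ?qs]) auto
  next
    case False
    then have "has_good ok ?R" "mark ok True ?R = ?R"
      using 2 by auto
    then obtain xs ys where IH: "uncuts ?R = xs @ mark ok False ?R # ys"
        "\<forall>T'\<in>set xs \<union> set ys. has_good ok T' \<and> mark ok True T' = T'"
      using 2 False by blast
    have "has_good ok \<langle>\<langle>\<rangle>, x, R'\<rangle> \<and> mark ok True \<langle>\<langle>\<rangle>, x, R'\<rangle> = \<langle>\<langle>\<rangle>, x, R'\<rangle>"
      if "R' \<in> set xs \<union> set ys" for R'
    proof -
      have "map_tree fst R' = map_tree fst ?R"
        using that IH(1) uncuts_invariants[of R' ?R] by auto
      then obtain l' y' r' where "R' = \<langle>l', y', r'\<rangle>" "fst y' = fst y"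
        by (cases R') auto
      then show ?thesis
        using that IH(2) False by auto
    qed
    moreover have "has_good ok \<langle>\<langle>\<rangle>, (fst x, False), ?R\<rangle> \<and>
        mark ok True \<langle>\<langle>\<rangle>, (fst x, False), ?R\<rangle> = \<langle>\<langle>\<rangle>, (fst x, False), ?R\<rangle>"
      using 2 False by auto
    ultimately show ?thesis
      using False IH(1)
      by (intro exI[of _ "?ps @ map (\<lambda>R'. \<langle>\<langle>\<rangle>, x, R'\<rangle>) xs"] exI[of _ "map (\<lambda>R'. \<langle>\<langle>\<rangle>, x, R'\<rangle>) ys"]) auto
  qed
qed auto


section \<open>A well-founded order stable under grafting\<close>

text \<open>
  The number of right edges above each leaf. Rotating \<open>x a (y b z)\<close> to \<open>(x a' y) b' z\<close> lowers it at the
  leaves of \<open>z\<close> and preserves it elsewhere. The list rather than its sum is recorded since a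
  comparison of lists, leaf by leaf, persists after grafting trees of different sizes on the leaves.
\<close>

primrec right_depths :: "'a tree \<Rightarrow> nat list" where
  "right_depths \<langle>\<rangle> = [0]"
| "right_depths \<langle>l, a, r\<rangle> = right_depths l @ map Suc (right_depths r)"

primrec label_weight :: "('b \<Rightarrow> nat) \<Rightarrow> 'b tree \<Rightarrow> nat" where
  "label_weight w \<langle>\<rangle> = 0"
| "label_weight w \<langle>l, a, r\<rangle> = label_weight w l + w a + label_weight w r"

text \<open>
  The sum of the right depths in the binary tree obtained by gluing all pieces, as
  \<open>depth_sum_blocks\<close> shows.
\<close>

primrec depth_sum :: "'b tree ptree \<Rightarrow> nat" where
  "depth_sum PLeaf = 0"
| "depth_sum (Vertex s ts) =
     sum_list (map2 (*) (right_depths s) (map nleaves ts)) + sum_list (map depth_sum ts)"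

primrec label_sum :: "('b \<Rightarrow> nat) \<Rightarrow> 'b tree ptree \<Rightarrow> nat" where
  "label_sum w PLeaf = 0"
| "label_sum w (Vertex s ts) = label_weight w s + sum_list (map (label_sum w) ts)"

lemma length_right_depths: "length (right_depths t) = size1 t"
  by (induction t) auto

lemma right_depths_map_tree: "right_depths (map_tree f t) = right_depths t"
  by (induction t) auto

lemma sum_map2_Suc:
  "length ds = length ns \<Longrightarrow> sum_list (map2 (*) (map Suc ds) ns) = sum_list (map2 (*) ds ns) + sum_list ns"
  by (induction ds ns rule: list_induct2) auto

lemma sum_list_map_Suc: "sum_list (map Suc ds) = sum_list ds + length ds"
  by (induction ds) auto

lemma depth_sum_blocks: "depth_sum (blocks T) = sum_list (right_depths T)"
proof -
  have "sum_list (map2 (*) (right_depths (fst (top_block T))) (map nleaves (snd (top_block T)))) +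
      sum_list (map depth_sum (snd (top_block T))) = sum_list (right_depths T)"
  proof (induction T)
    case (Node l x r)
    let ?s = "\<langle>fst (top_block l), fst x, fst (top_block r)\<rangle>"
    let ?ts = "snd (top_block l) @ snd (top_block r)"
    have "sum_list (map2 (*) (right_depths ?s) (map nleaves ?ts)) + sum_list (map depth_sum ?ts)
        = sum_list (right_depths \<langle>l, x, r\<rangle>)"
      using Node.IH
      by (simp add: zip_append length_right_depths size1_top_block sum_map2_Suc nleaves_top_block sum_list_map_Suc)
    then show ?case
      by (auto simp: Let_def)
  qed auto
  then show ?thesis by (simp add: blocks_def)
qed

lemma label_sum_blocks: "label_sum w (blocks T) = label_weight w (map_tree fst T)"
proof -
  have "label_weight w (fst (top_block T)) + sum_list (map (label_sum w) (snd (top_block T)))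
      = label_weight w (map_tree fst T)"
    by (induction T) (auto simp: Let_def)
  then show ?thesis by (simp add: blocks_def)
qed

text \<open>
  The order in which rewriting descends. Equal depths force equal shapes, and then the labels decide.
\<close>

definition lower :: "('b \<Rightarrow> nat) \<Rightarrow> 'b tree \<Rightarrow> 'b tree \<Rightarrow> bool" where
  "lower w t s \<longleftrightarrow> list_all2 (\<le>) (right_depths t) (right_depths s) \<and>
     (right_depths t = right_depths s \<longrightarrow> label_weight w t < label_weight w s)"

lemma sum_map2_mono:
  fixes ds es ns :: "nat list"
  assumes "list_all2 (\<le>) ds es" "length ds = length ns" "\<forall>n\<in>set ns. n \<ge> 1"
  shows "sum_list (map2 (*) ds ns) < sum_list (map2 (*) es ns) \<or> ds = es"
  using assms
proof (induction ds es arbitrary: ns rule: list_all2_induct)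
  case (Cons d ds e es)
  obtain n ns' where ns: "ns = n # ns'" "n \<ge> 1"
    using Cons.prems by (cases ns) auto
  have IH: "sum_list (map2 (*) ds ns') < sum_list (map2 (*) es ns') \<or> ds = es"
    using Cons.IH[of ns'] Cons.prems ns by simp
  show ?case
  proof (cases "d = e")
    case False
    then have "d * n < e * n"
      using Cons.hyps(1) ns(2) by simp
    then show ?thesis
      using IH ns(1) by (auto simp del: mult_less_cancel2 intro: add_less_le_mono)
  qed (use IH ns in auto)
qed auto

definition ptree_less :: "('b \<Rightarrow> nat) \<Rightarrow> ('b tree ptree \<times> 'b tree ptree) set" where
  "ptree_less w = measures [depth_sum, label_sum w]"

lemma wf_ptree_less: "wf (ptree_less w)"
  by (simp add: ptree_less_def)

lemma nleaves_pos: "decorated P Z \<Longrightarrow> nleaves Z \<ge> 1"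
proof (induction Z)
  case (Vertex x ts)
  then obtain t us where ts: "ts = t # us" by (cases ts) auto
  then have "nleaves t \<ge> 1" using Vertex by auto
  then show ?case using ts by auto
qed auto

text \<open>
  Replacing one piece by a lower one lowers the total depth, each leaf of the piece being counted with
  the positive number of leaves hanging from it, or keeps it and lowers the labels.
\<close>

lemma vertex_slot_lower:
  assumes "vertex_slot n C" "decorated (tree_operad ok \<Omega>) (C s)" "size1 t = n" "lower w t s"
  shows "(C t, C s) \<in> ptree_less w"
  using assms
proof (induction rule: vertex_slot.induct)
  case (here ts)
  have "\<forall>n\<in>set (map nleaves ts). n \<ge> 1"
    using here.prems(1) nleaves_pos by (auto simp: list_all_iff)
  then show ?case
    using sum_map2_mono[of "right_depths t" "right_depths s" "map nleaves ts"] here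
    by (auto simp: lower_def length_right_depths ptree_less_def)
next
  case (below n C y ts us)
  then show ?case
    using vertex_slot_nleaves[OF below.hyps(1), of t s] by (auto simp: ptree_less_def)
qed

lemma multilinear_add:
  "multilinear P \<phi> \<Longrightarrow> vertex_slot n C \<Longrightarrow> x \<in> comps P n \<Longrightarrow> y \<in> comps P n \<Longrightarrow>
     \<phi> (C (add P n x y)) = \<phi> (C x) + \<phi> (C y)"
  unfolding multilinear_def by blast

lemma multilinear_smul:
  "multilinear P \<phi> \<Longrightarrow> vertex_slot n C \<Longrightarrow> x \<in> comps P n \<Longrightarrow> \<phi> (C (smul P n c x)) = c * \<phi> (C x)"
  unfolding multilinear_def by blast


section \<open>Linear algebra of the free operad\<close>

lemma size1_graft:
  "1 \<le> i \<Longrightarrow> i \<le> size1 s \<Longrightarrow> size1 (graft i s u) = size1 s + size1 u - 1"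
proof (induction s arbitrary: i)
  case (Node l a r)
  have "size1 l \<ge> 1" "size1 r \<ge> 1" by (simp_all add: size1_size)
  then show ?case using Node.IH(1)[of i] Node.IH(2)[of "i - size1 l"] Node.prems by auto
qed auto

lemma set_tree_graft: "set_tree (graft i s u) \<subseteq> set_tree s \<union> set_tree u"
  by (induction i s u rule: graft.induct) auto

lemma finite_trees:
  assumes "finite \<Omega>"
  shows "finite {t. set_tree t \<subseteq> \<Omega> \<and> size1 t = n}"
proof -
  have "finite {t. set_tree t \<subseteq> \<Omega> \<and> size t \<le> k}" for k
  proof (induction k)
    case 0
    have "{t. set_tree t \<subseteq> \<Omega> \<and> size t \<le> 0} \<subseteq> {\<langle>\<rangle>}" by auto
    then show ?case by (rule finite_subset) simp
  next
    case (Suc k)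
    let ?A = "{t. set_tree t \<subseteq> \<Omega> \<and> size t \<le> k}"
    have "t \<in> insert \<langle>\<rangle> ((\<lambda>(l, a, r). \<langle>l, a, r\<rangle>) ` (?A \<times> \<Omega> \<times> ?A))"
      if "set_tree t \<subseteq> \<Omega>" "size t \<le> Suc k" for t
    proof (cases t)
      case (Node l a r)
      then have "(l, a, r) \<in> ?A \<times> \<Omega> \<times> ?A" using that by auto
      then show ?thesis using Node by force
    qed simp
    then have "{t. set_tree t \<subseteq> \<Omega> \<and> size t \<le> Suc k} \<subseteq> insert \<langle>\<rangle> ((\<lambda>(l, a, r). \<langle>l, a, r\<rangle>) ` (?A \<times> \<Omega> \<times> ?A))"
      by blast
    then show ?case
      by (rule finite_subset) (use Suc assms in auto)
  qed
  from this[of n] show ?thesis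
    by (rule rev_finite_subset) (auto simp: size1_size)
qed

lemma finite_monomials: "finite (ops Q) \<Longrightarrow> finite (monomials Q n)"
  unfolding monomials_def by (rule finite_trees)

lemma graft_monomials:
  "s \<in> monomials Q m \<Longrightarrow> u \<in> monomials Q n \<Longrightarrow> 1 \<le> i \<Longrightarrow> i \<le> m \<Longrightarrow> graft i s u \<in> monomials Q (m + n - 1)"
  using set_tree_graft[of i s u] by (auto simp: monomials_def size1_graft)

lemma free_comps_zero: "0 \<in> free_comps Q n"
  by (simp add: free_comps_def)

lemma free_comps_add: "x \<in> free_comps Q n \<Longrightarrow> y \<in> free_comps Q n \<Longrightarrow> x + y \<in> free_comps Q n"
  by (auto simp: free_comps_def) (metis add_0)

lemma free_comps_fscale: "x \<in> free_comps Q n \<Longrightarrow> fscale c x \<in> free_comps Q n"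
  by (auto simp: free_comps_def fscale_def)

lemma free_comps_diff: "x \<in> free_comps Q n \<Longrightarrow> y \<in> free_comps Q n \<Longrightarrow> x - y \<in> free_comps Q n"
  by (auto simp: free_comps_def fun_diff_def) (metis diff_0_right)

lemma free_comps_sum: "(\<And>i. i \<in> I \<Longrightarrow> x i \<in> free_comps Q n) \<Longrightarrow> sum x I \<in> free_comps Q n"
  by (induction I rule: infinite_finite_induct) (auto intro: free_comps_zero free_comps_add)

lemma basis_vec_nonzero: "basis_vec t s \<noteq> (0 :: 'k::field) \<longleftrightarrow> s = t"
  by (simp add: basis_vec_def)

lemma free_comps_basis_vec: "t \<in> monomials Q n \<Longrightarrow> basis_vec t \<in> free_comps Q n"
  by (auto simp: free_comps_def basis_vec_def)

lemma fscale_simps: "fscale 1 x = x" "fscale 0 x = 0" "fscale c (0 :: _ \<Rightarrow> 'k::field) = 0" "fscale (- 1) x = - x"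
  "fscale c (x - y) = fscale c x - fscale c y"
  by (auto simp: fscale_def fun_eq_iff algebra_simps)

lemma sum_fun_apply: "(\<Sum>i\<in>I. f i) t = (\<Sum>i\<in>I. f i t)" for f :: "'i \<Rightarrow> 'a \<Rightarrow> 'k::field"
  by (induction I rule: infinite_finite_induct) auto

lemma in_ideal_diff: "in_ideal Q n x \<Longrightarrow> in_ideal Q n y \<Longrightarrow> in_ideal Q n (x - y)"
  using in_ideal.plus[of Q n x "fscale (- 1) y"] in_ideal.scale[of Q n y "- 1"] by (simp add: fscale_simps)

lemma in_ideal_sum: "(\<And>i. i \<in> I \<Longrightarrow> in_ideal Q n (x i)) \<Longrightarrow> in_ideal Q n (sum x I)"
  by (induction I rule: infinite_finite_induct) (auto intro: in_ideal.zero in_ideal.plus)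


section \<open>Forms on the bar complex of a quadratic operad\<close>

primrec coset_tree :: "('b, 'k::field) quad_data \<Rightarrow> 'b tree ptree \<Rightarrow> ('b, 'k) tvec set ptree" where
  "coset_tree Q PLeaf = PLeaf"
| "coset_tree Q (Vertex s ts) = Vertex (coset Q (length ts) (basis_vec s)) (map (coset_tree Q) ts)"

lemma nverts_coset_tree: "nverts (coset_tree Q Z) = nverts Z"
  by (induction Z) (auto simp: comp_def intro: arg_cong[where f = sum_list])

text \<open>
  The analogue of \<open>vertex_slot\<close> for a whole subtree: forms are analysed by replacing decorations by
  monomials below a moving subtree.
\<close>

inductive subtree_slot :: "('a ptree \<Rightarrow> 'a ptree) \<Rightarrow> bool" where
  here: "subtree_slot (\<lambda>t. t)"
| below: "subtree_slot D \<Longrightarrow> subtree_slot (\<lambda>t. Vertex y (ts @ D t # us))"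

lemma subtree_slot_vertex: "subtree_slot D \<Longrightarrow> vertex_slot (length ts) (\<lambda>x. D (Vertex x ts))"
  by (induction rule: subtree_slot.induct) (auto intro: vertex_slot.intros)

lemma subtree_slot_child: "subtree_slot D \<Longrightarrow> subtree_slot (\<lambda>t. D (Vertex y (ts @ t # us)))"
proof (induction rule: subtree_slot.induct)
  case here
  show ?case using subtree_slot.below[OF subtree_slot.here] .
qed (rule subtree_slot.below)

text \<open>
  Slots for monomials become slots for classes, at which a multilinear form can be expanded.
\<close>

lemma vertex_slot_coset_tree:
  "vertex_slot n C \<Longrightarrow> \<exists>C'. vertex_slot n C' \<and> (\<forall>t. coset_tree Q (C t) = C' (coset Q n (basis_vec t)))"
proof (induction rule: vertex_slot.induct)
  case (here ts)
  show ?case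
    using vertex_slot.here[of "map (coset_tree Q) ts"]
    by (intro exI[of _ "\<lambda>x. Vertex x (map (coset_tree Q) ts)"]) auto
next
  case (below n C y ts us)
  then obtain C' where C': "vertex_slot n C'" "\<forall>t. coset_tree Q (C t) = C' (coset Q n (basis_vec t))"
    by blast
  show ?case
    by (rule exI[of _ "\<lambda>x. Vertex (coset Q (length ts + length us + 1) (basis_vec y))
          (map (coset_tree Q) ts @ C' x # map (coset_tree Q) us)"])
      (use C' in \<open>auto intro: vertex_slot.below\<close>)
qed

locale quadratic =
  fixes Q :: "('b, 'k::field) quad_data"
  assumes finite_ops: "finite (ops Q)"
begin

abbreviation P where "P \<equiv> quadratic_operad Q"
abbreviation M where "M \<equiv> tree_operad (\<lambda>_ _. True) (ops Q)"
abbreviation cls where "cls n x \<equiv> coset Q n x"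

lemma comps_M: "comps M n = monomials Q n"
proof -
  have "normal (\<lambda>_ _. True) t" for t :: "'b tree"
    by (induction t) (auto simp: right_ok_def split: tree.split)
  then show ?thesis by (auto simp: tree_operad_def monomials_def)
qed

text \<open>
  Sums over all pairs of monomials, in place of the pairs with a given grafting, can be interchanged.
\<close>

lemma free_pcomp_double_sum:
  "free_pcomp Q m n i x y t =
     (\<Sum>s\<in>monomials Q m. \<Sum>u\<in>monomials Q n. if graft i s u = t then x s * y u else 0)"
proof -
  have "free_pcomp Q m n i x y t =
      (\<Sum>(s, u)\<in>{p \<in> monomials Q m \<times> monomials Q n. graft i (fst p) (snd p) = t}. x s * y u)"
    unfolding free_pcomp_def by (rule sum.cong) auto
  also have "\<dots> = (\<Sum>p\<in>monomials Q m \<times> monomials Q n. if graft i (fst p) (snd p) = t then x (fst p) * y (snd p) else 0)"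
    using finite_monomials[OF finite_ops] by (subst sum.inter_filter[symmetric]) (auto simp: case_prod_unfold)
  finally show ?thesis
    by (simp add: sum.cartesian_product case_prod_unfold)
qed

lemma free_pcomp_closed:
  assumes "1 \<le> i" "i \<le> m"
  shows "free_pcomp Q m n i x y \<in> free_comps Q (m + n - 1)"
proof -
  have "t \<in> monomials Q (m + n - 1)" if "free_pcomp Q m n i x y t \<noteq> 0" for t
  proof (rule ccontr)
    assume "t \<notin> monomials Q (m + n - 1)"
    then have "graft i s u \<noteq> t" if "s \<in> monomials Q m" "u \<in> monomials Q n" for s u
      using graft_monomials[OF that assms] by auto
    then have "free_pcomp Q m n i x y t = 0"
      unfolding free_pcomp_double_sum by (intro sum.neutral ballI) auto
    with that show False by simp
  qed
  then show ?thesis by (simp add: free_comps_def)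
qed

lemma free_pcomp_linear:
  "free_pcomp Q m n i (x + x') y = free_pcomp Q m n i x y + free_pcomp Q m n i x' y"
  "free_pcomp Q m n i x (y + y') = free_pcomp Q m n i x y + free_pcomp Q m n i x y'"
  "free_pcomp Q m n i (x - x') y = free_pcomp Q m n i x y - free_pcomp Q m n i x' y"
  "free_pcomp Q m n i x (y - y') = free_pcomp Q m n i x y - free_pcomp Q m n i x y'"
  "free_pcomp Q m n i (fscale c x) y = fscale c (free_pcomp Q m n i x y)"
  "free_pcomp Q m n i x (fscale c y) = fscale c (free_pcomp Q m n i x y)"
  by (auto simp: fun_eq_iff free_pcomp_def fscale_def case_prod_unfold sum.distrib sum_subtractf
      sum_distrib_left algebra_simps)

lemma free_pcomp_basis_vec:
  assumes "s \<in> monomials Q m" "u \<in> monomials Q n"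
  shows "free_pcomp Q m n i (basis_vec s) (basis_vec u) = basis_vec (graft i s u)"
proof
  fix t
  have "free_pcomp Q m n i (basis_vec s) (basis_vec u) t =
      (\<Sum>s'\<in>monomials Q m. \<Sum>u'\<in>monomials Q n. if u = u' then if s = s' then if graft i s u = t then 1 else 0 else 0 else 0)"
    unfolding free_pcomp_double_sum by (intro sum.cong refl) (auto simp: basis_vec_def)
  then show "free_pcomp Q m n i (basis_vec s) (basis_vec u) t = basis_vec (graft i s u) t"
    using assms finite_monomials[OF finite_ops] by (simp add: sum.delta basis_vec_def)
qed

lemma free_pcomp_support:
  assumes "free_pcomp Q m n i x y t \<noteq> 0"
  obtains s u where "s \<in> monomials Q m" "u \<in> monomials Q n" "t = graft i s u" "x s \<noteq> 0" "y u \<noteq> 0"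
proof -
  have "\<exists>s\<in>monomials Q m. \<exists>u\<in>monomials Q n. t = graft i s u \<and> x s \<noteq> 0 \<and> y u \<noteq> 0"
  proof (rule ccontr)
    assume "\<not> ?thesis"
    then have "free_pcomp Q m n i x y t = 0"
      unfolding free_pcomp_double_sum by (intro sum.neutral ballI) auto
    with assms show False by simp
  qed
  with that show ?thesis by blast
qed

lemma free_comps_expand:
  assumes "x \<in> free_comps Q n"
  shows "x = (\<Sum>t\<in>monomials Q n. fscale (x t) (basis_vec t))"
proof
  fix s
  have "(\<Sum>t\<in>monomials Q n. fscale (x t) (basis_vec t) s) = (\<Sum>t\<in>monomials Q n. if s = t then x t else 0)"
    by (intro sum.cong refl) (auto simp: fscale_def basis_vec_def)
  also have "\<dots> = (if s \<in> monomials Q n then x s else 0)"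
    using finite_monomials[OF finite_ops] by (simp add: sum.delta)
  also have "\<dots> = x s"
    using assms by (auto simp: free_comps_def)
  finally show "x s = (\<Sum>t\<in>monomials Q n. fscale (x t) (basis_vec t)) s"
    by (simp add: sum_fun_apply)
qed

lemma equiv_ideal_rel: "equiv (free_comps Q n) (ideal_rel Q n)"
proof (rule equivI)
  show "refl_on (free_comps Q n) (ideal_rel Q n)"
    by (auto simp: refl_on_def ideal_rel_def intro: in_ideal.zero)
  show "sym (ideal_rel Q n)"
    using in_ideal.scale[of Q n _ "- 1"] by (fastforce simp: sym_def ideal_rel_def fscale_simps)
  show "trans (ideal_rel Q n)"
    using in_ideal.plus[of Q n] by (fastforce simp: trans_def ideal_rel_def)
qed (auto simp: ideal_rel_def)

lemma cls_eq_iff: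
  "x \<in> free_comps Q n \<Longrightarrow> y \<in> free_comps Q n \<Longrightarrow> cls n x = cls n y \<longleftrightarrow> in_ideal Q n (x - y)"
  using eq_equiv_class_iff[OF equiv_ideal_rel] by (auto simp: ideal_rel_def)

lemma cls_memD: "x' \<in> cls n x \<Longrightarrow> x' \<in> free_comps Q n" "x' \<in> cls n x \<Longrightarrow> in_ideal Q n (x - x')"
  by (auto simp: ideal_rel_def)

lemma cls_memI: "x \<in> free_comps Q n \<Longrightarrow> x' \<in> free_comps Q n \<Longrightarrow> in_ideal Q n (x - x') \<Longrightarrow> x' \<in> cls n x"
  by (auto simp: ideal_rel_def)

lemma comps_P: "X \<in> comps P n \<longleftrightarrow> (\<exists>x\<in>free_comps Q n. X = cls n x)"
  by (auto simp: quadratic_operad_def quotient_def)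

lemma UN_cls_const:
  assumes "x \<in> free_comps Q n" "\<And>x'. x' \<in> cls n x \<Longrightarrow> f x' = c"
  shows "(\<Union>x'\<in>cls n x. f x') = c"
proof -
  have "f ` cls n x = {c}"
    using assms(2) equiv_class_self[OF equiv_ideal_rel assms(1)] by (intro equalityI subsetI) (auto simp: image_iff)
  then show ?thesis by simp
qed

lemma add_cls:
  assumes "x \<in> free_comps Q n" "y \<in> free_comps Q n"
  shows "add P n (cls n x) (cls n y) = cls n (x + y)"
proof -
  have "cls n (x' + y') = cls n (x + y)" if "x' \<in> cls n x" "y' \<in> cls n y" for x' y'
  proof -
    have "in_ideal Q n ((x - x') + (y - y'))"
      using that by (intro in_ideal.plus) (auto simp: ideal_rel_def)
    moreover have "(x - x') + (y - y') = (x + y) - (x' + y')" by simp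
    ultimately show ?thesis
      using that assms by (subst eq_commute, subst cls_eq_iff) (auto intro: free_comps_add simp: ideal_rel_def)
  qed
  then have "(\<Union>x'\<in>cls n x. \<Union>y'\<in>cls n y. cls n (x' + y')) = cls n (x + y)"
    by (intro UN_cls_const assms)
  then show ?thesis by (simp add: quadratic_operad_def)
qed

lemma smul_cls:
  assumes "x \<in> free_comps Q n"
  shows "smul P n c (cls n x) = cls n (fscale c x)"
proof -
  have "cls n (fscale c x') = cls n (fscale c x)" if "x' \<in> cls n x" for x'
    using that assms in_ideal.scale[of Q n "x - x'" c]
    by (subst eq_commute, subst cls_eq_iff) (auto intro: free_comps_fscale simp: ideal_rel_def fscale_simps)
  then have "(\<Union>x'\<in>cls n x. cls n (fscale c x')) = cls n (fscale c x)"
    by (intro UN_cls_const assms)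
  then show ?thesis by (simp add: quadratic_operad_def)
qed

lemma pcomp_cls:
  assumes "x \<in> free_comps Q m" "y \<in> free_comps Q n" "1 \<le> i" "i \<le> m"
  shows "pcomp P m n i (cls m x) (cls n y) = cls (m + n - 1) (free_pcomp Q m n i x y)"
proof -
  have "cls (m + n - 1) (free_pcomp Q m n i x' y') = cls (m + n - 1) (free_pcomp Q m n i x y)"
    if "x' \<in> cls m x" "y' \<in> cls n y" for x' y'
  proof -
    have "in_ideal Q (m + n - 1) (free_pcomp Q m n i (x - x') y + free_pcomp Q m n i x' (y - y'))"
      using that assms by (intro in_ideal.plus in_ideal.comp_left in_ideal.comp_right) (auto simp: ideal_rel_def)
    moreover have "free_pcomp Q m n i (x - x') y + free_pcomp Q m n i x' (y - y') =
        free_pcomp Q m n i x y - free_pcomp Q m n i x' y'"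
      by (simp add: free_pcomp_linear)
    ultimately show ?thesis
      using assms by (subst eq_commute, subst cls_eq_iff) (auto intro: free_pcomp_closed simp del: One_nat_def)
  qed
  then have "(\<Union>x'\<in>cls m x. \<Union>y'\<in>cls n y. cls (m + n - 1) (free_pcomp Q m n i x' y')) =
      cls (m + n - 1) (free_pcomp Q m n i x y)"
    by (intro UN_cls_const assms)
  then show ?thesis by (simp add: quadratic_operad_def)
qed

lemma linear_operad_P: "linear_operad P"
proof
  fix X Y :: "('b, 'k) tvec set" and n
  assume "X \<in> comps P n" "Y \<in> comps P n"
  then show "add P n X Y \<in> comps P n"
    unfolding comps_P using add_cls free_comps_add by metis
next
  fix X :: "('b, 'k) tvec set" and n c
  assume "X \<in> comps P n"
  then show "smul P n c X \<in> comps P n"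
    unfolding comps_P using smul_cls free_comps_fscale by metis
next
  fix X Y :: "('b, 'k) tvec set" and m n i :: nat
  assume XY: "X \<in> comps P m" "Y \<in> comps P n" and i: "1 \<le> i" "i \<le> m"
  then obtain x y where xy: "x \<in> free_comps Q m" "y \<in> free_comps Q n" and X: "X = cls m x" and Y: "Y = cls n y"
    unfolding comps_P by blast
  show "pcomp P m n i X Y \<in> comps P (m + n - 1)"
    unfolding X Y pcomp_cls[OF xy i] comps_P using free_pcomp_closed[OF i] by blast
  show "pcomp P m n i (smul P m c X) Y = smul P (m + n - 1) c (pcomp P m n i X Y)" for c
    unfolding X Y using xy i
    by (simp add: smul_cls pcomp_cls free_comps_fscale free_pcomp_closed[OF i] free_pcomp_linear
          del: One_nat_def)
  show "pcomp P m n i X (smul P n c Y) = smul P (m + n - 1) c (pcomp P m n i X Y)" for c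
    unfolding X Y using xy i
    by (simp add: smul_cls pcomp_cls free_comps_fscale free_pcomp_closed[OF i] free_pcomp_linear
          del: One_nat_def)
  fix Z
  show "pcomp P m n i (add P m X Z) Y = add P (m + n - 1) (pcomp P m n i X Y) (pcomp P m n i Z Y)"
    if "Z \<in> comps P m"
  proof -
    obtain z where "z \<in> free_comps Q m" "Z = cls m z"
      using \<open>Z \<in> comps P m\<close> unfolding comps_P by blast
    then show ?thesis
      unfolding X Y using xy i
      by (simp add: add_cls pcomp_cls free_comps_add free_pcomp_closed[OF i] free_pcomp_linear
          del: One_nat_def)
  qed
  show "pcomp P m n i X (add P n Y Z) = add P (m + n - 1) (pcomp P m n i X Y) (pcomp P m n i X Z)"
    if "Z \<in> comps P n"
  proof -
    obtain z where "z \<in> free_comps Q n" "Z = cls n z"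
      using \<open>Z \<in> comps P n\<close> unfolding comps_P by blast
    then show ?thesis
      unfolding X Y using xy i
      by (simp add: add_cls pcomp_cls free_comps_add free_pcomp_closed[OF i] free_pcomp_linear
          del: One_nat_def)
  qed
qed

sublocale linear_operad P
  by (rule linear_operad_P)

lemma decorated_coset_tree: "decorated M Z \<Longrightarrow> decorated P (coset_tree Q Z)"
  by (induction Z) (auto simp: comps_M comps_P list_all_iff intro!: bexI free_comps_basis_vec)

text \<open>
  Classes of monomials compose by grafting.
\<close>

lemma contractions_coset_tree:
  "decorated M Z \<Longrightarrow> contractions P (coset_tree Q Z) = map (coset_tree Q) (contractions M Z)"
proof (induction Z)
  case PLeaf
  then show ?case by simp
next
  case (Vertex s ts)
  have "edge_contractions P (cls (length ts) (basis_vec s)) (map (coset_tree Q) ts) i =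
      map (coset_tree Q) (edge_contractions M s ts i)" if i: "i < length ts" for i
  proof -
    have dec: "decorated M (ts ! i)"
      using Vertex.prems i by (auto simp: list_all_iff)
    have IH: "contractions P (coset_tree Q (ts ! i)) = map (coset_tree Q) (contractions M (ts ! i))"
      using Vertex.IH[of "ts ! i"] dec i by simp
    have s: "s \<in> monomials Q (length ts)"
      using Vertex.prems by (simp add: comps_M)
    have "pcomp P (length ts) (length us) (Suc i) (cls (length ts) (basis_vec s)) (cls (length us) (basis_vec y)) =
        cls (i + (length us + (length ts - Suc i))) (basis_vec (graft (Suc i) s y))" if "ts ! i = Vertex y us" for y us
    proof -
      have y: "y \<in> monomials Q (length us)"
        using dec that by (simp add: comps_M)
      have "i + (length us + (length ts - Suc i)) = length ts + length us - 1"
        using i by simp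
      then show ?thesis
        using s y i by (simp add: pcomp_cls free_comps_basis_vec free_pcomp_basis_vec del: One_nat_def)
    qed
    then show ?thesis
      using i IH by (auto simp: edge_contractions_def map_update take_map drop_map tree_operad_def split: ptree.split)
  qed
  then show ?case
    by (auto simp: contractions_Vertex map_concat intro!: arg_cong[where f = concat])
qed

lemma multilinear_zero:
  assumes "multilinear P \<phi>" "vertex_slot n C"
  shows "\<phi> (C (cls n 0)) = 0"
proof -
  have "cls n 0 \<in> comps P n"
    unfolding comps_P using free_comps_zero by blast
  from multilinear_smul[OF assms this, of 0] show ?thesis
    by (simp add: smul_cls free_comps_zero fscale_simps)
qed

lemma multilinear_expand:
  assumes \<phi>: "multilinear P \<phi>" and C: "vertex_slot n C" and x: "x \<in> free_comps Q n"
  shows "\<phi> (C (cls n x)) = (\<Sum>t\<in>monomials Q n. x t * \<phi> (C (cls n (basis_vec t))))"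
proof -
  have "\<phi> (C (cls n (\<Sum>t\<in>A. fscale (x t) (basis_vec t)))) = (\<Sum>t\<in>A. x t * \<phi> (C (cls n (basis_vec t))))"
    if "A \<subseteq> monomials Q n" for A
    using finite_subset[OF that finite_monomials[OF finite_ops]] that
  proof (induction A rule: finite_induct)
    case empty
    then show ?case using multilinear_zero[OF \<phi> C] by (simp add: zero_fun_def)
  next
    case (insert t A)
    let ?y = "fscale (x t) (basis_vec t)" and ?z = "\<Sum>t\<in>A. fscale (x t) (basis_vec t)"
    have t: "basis_vec t \<in> free_comps Q n"
      using insert.prems by (auto intro: free_comps_basis_vec)
    have z: "?z \<in> free_comps Q n"
      using insert.prems by (intro free_comps_sum free_comps_fscale free_comps_basis_vec) auto
    have "\<phi> (C (cls n (?y + ?z))) = \<phi> (C (add P n (smul P n (x t) (cls n (basis_vec t))) (cls n ?z)))"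
      using t z by (simp add: add_cls smul_cls free_comps_fscale)
    also have "\<dots> = \<phi> (C (smul P n (x t) (cls n (basis_vec t)))) + \<phi> (C (cls n ?z))"
      using smul_closed[of _ n "x t"] t z by (intro multilinear_add[OF \<phi> C]) (auto simp: comps_P)
    also have "\<phi> (C (smul P n (x t) (cls n (basis_vec t)))) = x t * \<phi> (C (cls n (basis_vec t)))"
      using t by (intro multilinear_smul[OF \<phi> C]) (auto simp: comps_P)
    finally show ?case
      using insert by simp
  qed
  from this[OF subset_refl] show ?thesis
    using free_comps_expand[OF x] by simp
qed

text \<open>
  The decorations are expanded into monomials one after the other, first at the root of \<open>Y\<close> and then in
  its subtrees from left to right. The context \<open>D\<close> records what lies around the current subtree.
\<close>

lemma multilinear_eq_zero_slot:
  assumes \<phi>: "multilinear P \<phi>"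
  shows "decorated P Y \<Longrightarrow> subtree_slot D \<Longrightarrow>
    (\<And>Z. decorated M Z \<Longrightarrow> nleaves Z = nleaves Y \<Longrightarrow> \<phi> (D (coset_tree Q Z)) = 0) \<Longrightarrow> \<phi> (D Y) = 0"
proof (induction Y arbitrary: D)
  case PLeaf
  then show ?case using PLeaf.prems(3)[of PLeaf] by simp
next
  case (Vertex X ts)
  obtain x where x: "x \<in> free_comps Q (length ts)" "X = cls (length ts) x"
    using Vertex.prems(1) by (auto simp: comps_P)
  have "\<phi> (D (Vertex (cls (length ts) (basis_vec s)) (map (coset_tree Q) us @ vs))) = 0"
    if "list_all (decorated M) us" "set vs \<subseteq> set ts" "length us + length vs = length ts"
      "sum_list (map nleaves us) + sum_list (map nleaves vs) = nleaves (Vertex X ts)"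
      "s \<in> monomials Q (length ts)" for us vs s
    using that
  proof (induction vs arbitrary: us)
    case Nil
    have "\<phi> (D (coset_tree Q (Vertex s us))) = 0"
      using Nil Vertex.prems(1) by (intro Vertex.prems(3)) (auto simp: comps_M)
    then show ?case using Nil by simp
  next
    case (Cons v vs)
    let ?D = "\<lambda>t. D (Vertex (cls (length ts) (basis_vec s)) (map (coset_tree Q) us @ t # vs))"
    have "\<phi> (?D v) = 0"
    proof (rule Vertex.IH[of v ?D])
      show "v \<in> set ts" "decorated P v"
        using Cons.prems Vertex.prems(1) by (auto simp: list_all_iff)
      show "subtree_slot ?D"
        by (rule subtree_slot_child[OF Vertex.prems(2)])
      show "\<phi> (?D (coset_tree Q Z)) = 0" if "decorated M Z" "nleaves Z = nleaves v" for Z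
        using Cons.IH[of "us @ [Z]"] Cons.prems that by simp
    qed
    then show ?case .
  qed
  from this[of "[]" ts] have "\<phi> (D (Vertex (cls (length ts) (basis_vec s)) ts)) = 0"
    if "s \<in> monomials Q (length ts)" for s
    using that by simp
  then show ?case
    unfolding x(2) using multilinear_expand[OF \<phi> subtree_slot_vertex[OF Vertex.prems(2)] x(1)] by simp
qed

lemma multilinear_eq_zero:
  assumes "multilinear P \<phi>" "decorated P Y"
    and "\<And>Z. decorated M Z \<Longrightarrow> nleaves Z = nleaves Y \<Longrightarrow> \<phi> (coset_tree Q Z) = 0"
  shows "\<phi> Y = 0"
  using multilinear_eq_zero_slot[OF assms(1,2) subtree_slot.here] assms(3) by blast

lemma bar_diff_blocks:
  assumes "root_uncut T" "cut_ok (\<lambda>_ _. True) (ops Q) T"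
  shows "bar_diff P \<phi> (coset_tree Q (blocks T)) = alt (\<lambda>T'. \<phi> (coset_tree Q (blocks T'))) (uncuts T)"
  using assms
  by (simp add: bar_diff_alt decorated_coset_tree decorated_blocks contractions_coset_tree contractions_blocks)

lemma cut_ok_True: "cut_ok (\<lambda>_ _. True) \<Omega> T \<longleftrightarrow> set_tree (map_tree fst T) \<subseteq> \<Omega>"
proof (induction T)
  case (Node l x r)
  then show ?case by (cases r) auto
qed auto

lemma cut_ok_uncuts:
  "cut_ok (\<lambda>_ _. True) \<Omega> T \<Longrightarrow> T' \<in> set (uncuts T) \<Longrightarrow> cut_ok (\<lambda>_ _. True) \<Omega> T'"
  using uncuts_invariants[of T' T] unfolding cut_ok_True by simp

text \<open>
  A form is determined by its values on cut trees.
\<close>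

lemma bar_eq_zero:
  assumes "\<phi> \<in> bar P n j" "n \<ge> 2"
    and "\<And>T. root_uncut T \<Longrightarrow> size1 T = n \<Longrightarrow> cut_ok (\<lambda>_ _. True) (ops Q) T \<Longrightarrow> \<phi> (coset_tree Q (blocks T)) = 0"
  shows "\<phi> = 0"
proof (rule ext)
  fix Y
  have "\<phi> Y = 0" if Y: "decorated P Y" "nleaves Y = n"
  proof (rule multilinear_eq_zero[OF _ Y(1)])
    show "multilinear P \<phi>" using assms(1) by (simp add: bar_def)
    fix Z
    assume Z: "decorated M Z" "nleaves Z = nleaves Y"
    then obtain T where T: "root_uncut T" "Z = blocks T"
      using blocks_surj assms(2) Y(2) by metis
    then show "\<phi> (coset_tree Q Z) = 0"
      using assms(3)[OF T(1)] Z Y(2) decorated_blocks[OF T(1)] by (simp add: nleaves_blocks)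
  qed
  then show "\<phi> Y = 0 Y"
    using assms(1) by (fastforce simp: bar_def)
qed

text \<open>
  The square of the differential is a form again, so it can be computed on cut trees.
\<close>

lemma bar_diff_squared:
  assumes "\<phi> \<in> bar P n (j - 1)" "n \<ge> 2"
  shows "bar_diff P (bar_diff P \<phi>) = 0"
proof (rule bar_eq_zero)
  show "bar_diff P (bar_diff P \<phi>) \<in> bar P n (j + 1)"
    using bar_diff_bar[of "bar_diff P \<phi>" n "j + 1"] bar_diff_bar[OF assms(1)] by simp
  fix T
  assume T: "root_uncut T" "cut_ok (\<lambda>_ _. True) (ops Q) T"
  have "bar_diff P (bar_diff P \<phi>) (coset_tree Q (blocks T)) =
      alt (\<lambda>T'. alt (\<lambda>T''. \<phi> (coset_tree Q (blocks T''))) (uncuts T')) (uncuts T)"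
    unfolding bar_diff_blocks[OF T]
    using T by (intro alt_cong bar_diff_blocks) (auto dest: uncuts_invariants cut_ok_uncuts)
  then show "bar_diff P (bar_diff P \<phi>) (coset_tree Q (blocks T)) = 0"
    by (simp add: uncuts_squared)
qed fact

end


section \<open>Normal forms\<close>

lemma sum_list_strict_mono_nat:
  fixes ds es :: "nat list"
  shows "list_all2 (\<le>) ds es \<Longrightarrow> ds = es \<or> sum_list ds < sum_list es"
  by (induction rule: list_all2_induct) auto

lemma lower_measure:
  "lower w t s \<Longrightarrow> (t, s) \<in> measures [\<lambda>t. sum_list (right_depths t), label_weight w]"
  using sum_list_strict_mono_nat[of "right_depths t" "right_depths s"] by (auto simp: lower_def)

lemma lower_Node_left: "lower w t l \<Longrightarrow> lower w \<langle>t, a, r\<rangle> \<langle>l, a, r\<rangle>"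
  by (auto simp: lower_def list_all2_appendI list_all2_refl dest: list_all2_lengthD)

lemma lower_Node_right: "lower w t r \<Longrightarrow> lower w \<langle>l, a, t\<rangle> \<langle>l, a, r\<rangle>"
  by (auto simp: lower_def list_all2_map1 list_all2_map2 inj_map_eq_map intro!: list_all2_appendI list_all2_refl)

lemma lower_rotate: "lower w \<langle>\<langle>l, a', y\<rangle>, b', z\<rangle> \<langle>l, a, \<langle>y, b, z\<rangle>\<rangle>"
proof -
  have "map Suc ds \<noteq> map Suc (map Suc ds)" if "ds \<noteq> []" for ds
    using that by (cases ds) auto
  moreover have "right_depths z \<noteq> []"
    using length_right_depths[of z] by (auto simp: size1_size)
  ultimately show ?thesis
    by (auto simp: lower_def list_all2_map1 list_all2_map2 intro!: list_all2_appendI list_all2_refl)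
qed

lemma lower_relabel: "w b' < w b \<Longrightarrow> lower w \<langle>l, a, \<langle>y, b', z\<rangle>\<rangle> \<langle>l, a, \<langle>y, b, z\<rangle>\<rangle>"
  by (auto simp: lower_def intro!: list_all2_refl)

text \<open>
  Well-founded recursion for a triangular system: \<open>H i\<close> sees the solution only below \<open>i\<close>.
\<close>

lemma wfrec_solution:
  assumes "wf R"
  shows "\<exists>g. \<forall>i. g i = H i (\<lambda>j. if (j, i) \<in> R then g j else (0 :: 'k::zero))"
proof -
  define F where "F r i = H i (\<lambda>j. if (j, i) \<in> R then r j else 0)" for r i
  have "wfrec R F i = H i (\<lambda>j. if (j, i) \<in> R then wfrec R F j else 0)" for i
    by (subst wfrec[OF assms]) (simp add: F_def cut_def cong: if_cong)
  then show ?thesis by blast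
qed

lemma cut_ok_mono: "cut_ok ok \<Omega> T \<Longrightarrow> cut_ok (\<lambda>_ _. True) \<Omega> T"
  by (induction T) (auto split: tree.splits)

lemma finite_cut_trees:
  assumes "finite \<Omega>"
  shows "finite {T. root_uncut T \<and> size1 T = n \<and> cut_ok ok \<Omega> T}"
proof -
  have "set_tree T \<subseteq> \<Omega> \<times> UNIV" if "cut_ok ok \<Omega> T" for T
    using that by (induction T) auto
  then show ?thesis
    by (intro finite_subset[OF _ finite_trees[of "\<Omega> \<times> UNIV" n]]) (use assms in auto)
qed

lemma bar_minus: "\<phi> \<in> bar P n j \<Longrightarrow> \<psi> \<in> bar P n j \<Longrightarrow> \<phi> - \<psi> \<in> bar P n j"
  unfolding bar_def multilinear_def by (auto simp: algebra_simps) (metis diff_0_right)+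

lemma bar_diff_minus: "bar_diff P (\<phi> - \<psi>) = bar_diff P \<phi> - bar_diff P \<psi>"
  by (auto simp: fun_eq_iff bar_diff_alt fun_diff_def alt_diff)

text \<open>
  A quadratic datum with a Poincare-Birkhoff-Witt basis. A bad monomial \<open>x a (y b z)\<close> has coefficient 1 in
  some relation whose other terms are left combs, on which there is no condition, or differ from it
  in the label \<open>b\<close> only, with smaller weight. The last assumption makes this rewriting confluent:
  normal forms are unique.
\<close>

locale right_pbw = quadratic Q for Q :: "('b, 'k::field) quad_data" +
  fixes ok :: "'b \<Rightarrow> 'b \<Rightarrow> bool" and w :: "'b \<Rightarrow> nat"
  assumes rels_support: "(u, v) \<in> rels Q \<Longrightarrow> u (a, b) \<noteq> 0 \<or> v (a, b) \<noteq> 0 \<Longrightarrow> a \<in> ops Q \<and> b \<in> ops Q"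
    and reducible: "a \<in> ops Q \<Longrightarrow> b \<in> ops Q \<Longrightarrow> \<not> ok a b \<Longrightarrow>
      \<exists>(u, v)\<in>rels Q. v (a, b) = 1 \<and> (\<forall>a' b'. v (a', b') \<noteq> 0 \<longrightarrow> a' = a \<and> (b' = b \<or> w b' < w b))"
    and independent: "in_ideal Q n x \<Longrightarrow> x \<in> free_comps Q n \<Longrightarrow> (\<And>t. x t \<noteq> 0 \<Longrightarrow> normal ok t) \<Longrightarrow> x = 0"
begin

abbreviation N where "N \<equiv> tree_operad ok (ops Q)"

lemma comps_N: "comps N n = {t \<in> monomials Q n. normal ok t}"
  by (auto simp: tree_operad_def monomials_def)

lemma decorated_N_M: "decorated N Z \<Longrightarrow> decorated M Z"
  by (induction Z) (auto simp: comps_M comps_N list_all_iff)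

text \<open>
  Adding a relation cancels the bad monomial, because \<open>rel_vec\<close> enters \<open>v\<close> with a minus sign.
\<close>

lemma reduce_right_comb:
  assumes ab: "a \<in> ops Q" "b \<in> ops Q" "\<not> ok a b"
    and t: "t = \<langle>\<langle>\<rangle>, a, \<langle>\<langle>\<rangle>, b, \<langle>\<rangle>\<rangle>\<rangle>"
  shows "\<exists>c\<in>free_comps Q 3. in_ideal Q 3 (basis_vec t - c) \<and> (\<forall>s. c s \<noteq> 0 \<longrightarrow>
    (\<exists>a' b'. s = \<langle>\<langle>\<langle>\<rangle>, a', \<langle>\<rangle>\<rangle>, b', \<langle>\<rangle>\<rangle>) \<or> (\<exists>b'. s = \<langle>\<langle>\<rangle>, a, \<langle>\<langle>\<rangle>, b', \<langle>\<rangle>\<rangle>\<rangle> \<and> w b' < w b))"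
proof -
  obtain u v where uv: "(u, v) \<in> rels Q" "v (a, b) = 1"
      "\<And>a' b'. v (a', b') \<noteq> 0 \<Longrightarrow> a' = a \<and> (b' = b \<or> w b' < w b)"
    using reducible[OF ab] by blast
  let ?c = "basis_vec t + rel_vec (u, v)"
  have rel: "(\<exists>a' b'. s = \<langle>\<langle>\<langle>\<rangle>, a', \<langle>\<rangle>\<rangle>, b', \<langle>\<rangle>\<rangle> \<and> u (a', b') \<noteq> 0) \<or>
      (\<exists>a' b'. s = \<langle>\<langle>\<rangle>, a', \<langle>\<langle>\<rangle>, b', \<langle>\<rangle>\<rangle>\<rangle> \<and> v (a', b') \<noteq> 0)" if "rel_vec (u, v) s \<noteq> 0" for s
    using that by (cases "((u, v), s)" rule: rel_vec.cases) auto
  have "rel_vec (u, v) \<in> free_comps Q 3"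
    using rel rels_support[OF uv(1)] by (force simp: free_comps_def monomials_def)
  moreover have "t \<in> monomials Q 3"
    using ab by (simp add: t monomials_def)
  ultimately have "?c \<in> free_comps Q 3"
    by (intro free_comps_add free_comps_basis_vec)
  moreover have "in_ideal Q 3 (basis_vec t - ?c)"
    using in_ideal.scale[OF in_ideal.rel[OF uv(1)], of "- 1"] by (simp add: fscale_simps)
  moreover have "(\<exists>a' b'. s = \<langle>\<langle>\<langle>\<rangle>, a', \<langle>\<rangle>\<rangle>, b', \<langle>\<rangle>\<rangle>) \<or> (\<exists>b'. s = \<langle>\<langle>\<rangle>, a, \<langle>\<langle>\<rangle>, b', \<langle>\<rangle>\<rangle>\<rangle> \<and> w b' < w b)"
    if "?c s \<noteq> 0" for s
  proof (cases "s = t")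
    case True
    then show ?thesis using that uv(2) by (simp add: t basis_vec_def)
  next
    case False
    then have "rel_vec (u, v) s \<noteq> 0" using that by (simp add: basis_vec_def)
    from rel[OF this] show ?thesis using False uv(3) t by blast
  qed
  ultimately show ?thesis by blast
qed

text \<open>
  One rewriting step inside a tree: the ideal is stable under composition on both sides, and so is the
  order. At the root the bad right comb is composed with the subtrees \<open>z\<close>, \<open>y\<close>, \<open>l\<close> at its leaves 3, 2, 1,
  from right to left so that the numbering of the remaining leaves does not change.
\<close>

lemma reduce_nonnormal:
  "t \<in> monomials Q n \<Longrightarrow> \<not> normal ok t \<Longrightarrow>
    \<exists>c\<in>free_comps Q n. in_ideal Q n (basis_vec t - c) \<and> (\<forall>s. c s \<noteq> 0 \<longrightarrow> lower w s t)"
proof (induction t arbitrary: n)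
  case Leaf
  then show ?case by simp
next
  case (Node l a r)
  have n: "n = size1 l + size1 r" and a: "a \<in> ops Q"
    and l: "l \<in> monomials Q (size1 l)" and r: "r \<in> monomials Q (size1 r)"
    using Node.prems by (auto simp: monomials_def)
  consider "\<not> normal ok l" | "\<not> normal ok r" | "\<not> right_ok ok a r"
    using Node.prems by auto
  then show ?case
  proof cases
    case 1
    obtain c where c: "c \<in> free_comps Q (size1 l)" "in_ideal Q (size1 l) (basis_vec l - c)"
        "\<And>s. c s \<noteq> 0 \<Longrightarrow> lower w s l"
      using Node.IH(1)[OF l 1] by blast
    let ?p = "\<langle>\<langle>\<rangle>, a, r\<rangle>" and ?m = "Suc (size1 r)"
    let ?f = "free_pcomp Q ?m (size1 l) 1 (basis_vec ?p)"
    have p: "?p \<in> monomials Q ?m" using a r by (auto simp: monomials_def)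
    have n': "n = ?m + size1 l - 1" using n by simp
    have "in_ideal Q n (?f (basis_vec l - c))"
      unfolding n' using c p by (intro in_ideal.comp_right free_comps_basis_vec) auto
    then have "in_ideal Q n (basis_vec \<langle>l, a, r\<rangle> - ?f c)"
      using free_pcomp_basis_vec[OF p l, of 1] by (simp add: free_pcomp_linear)
    moreover have "?f c \<in> free_comps Q n"
      unfolding n' by (rule free_pcomp_closed) auto
    moreover have "lower w s \<langle>l, a, r\<rangle>" if "?f c s \<noteq> 0" for s
      using that by (elim free_pcomp_support) (auto simp: basis_vec_def c(3) lower_Node_left split: if_splits)
    ultimately show ?thesis by blast
  next
    case 2
    obtain c where c: "c \<in> free_comps Q (size1 r)" "in_ideal Q (size1 r) (basis_vec r - c)"
        "\<And>s. c s \<noteq> 0 \<Longrightarrow> lower w s r"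
      using Node.IH(2)[OF r 2] by blast
    let ?p = "\<langle>l, a, \<langle>\<rangle>\<rangle>" and ?m = "Suc (size1 l)"
    let ?f = "free_pcomp Q ?m (size1 r) ?m (basis_vec ?p)"
    have p: "?p \<in> monomials Q ?m" using a l by (auto simp: monomials_def)
    have n': "n = ?m + size1 r - 1" using n by simp
    have "in_ideal Q n (?f (basis_vec r - c))"
      unfolding n' using c p by (intro in_ideal.comp_right free_comps_basis_vec) auto
    then have "in_ideal Q n (basis_vec \<langle>l, a, r\<rangle> - ?f c)"
      using free_pcomp_basis_vec[OF p r, of ?m] by (simp add: free_pcomp_linear)
    moreover have "?f c \<in> free_comps Q n"
      unfolding n' by (rule free_pcomp_closed) auto
    moreover have "lower w s \<langle>l, a, r\<rangle>" if "?f c s \<noteq> 0" for s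
      using that by (elim free_pcomp_support) (auto simp: basis_vec_def c(3) lower_Node_right split: if_splits)
    ultimately show ?thesis by blast
  next
    case 3
    then obtain y b z where r': "r = \<langle>y, b, z\<rangle>" and ok: "\<not> ok a b"
      by (auto simp: right_ok_def split: tree.splits)
    have b: "b \<in> ops Q" and y: "y \<in> monomials Q (size1 y)" and z: "z \<in> monomials Q (size1 z)"
      using r by (auto simp: monomials_def r')
    let ?t = "\<langle>\<langle>\<rangle>, a, \<langle>\<langle>\<rangle>, b, \<langle>\<rangle>\<rangle>\<rangle>"
    obtain c where c: "c \<in> free_comps Q 3" "in_ideal Q 3 (basis_vec ?t - c)"
      "\<And>s. c s \<noteq> 0 \<Longrightarrow> (\<exists>a' b'. s = \<langle>\<langle>\<langle>\<rangle>, a', \<langle>\<rangle>\<rangle>, b', \<langle>\<rangle>\<rangle>) \<or> (\<exists>b'. s = \<langle>\<langle>\<rangle>, a, \<langle>\<langle>\<rangle>, b', \<langle>\<rangle>\<rangle>\<rangle> \<and> w b' < w b)"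
      using reduce_right_comb[OF a b ok refl] by blast
    have t: "?t \<in> monomials Q 3" using a b by (simp add: monomials_def)
    let ?m = "3 + size1 z - 1"
    let ?k = "?m + size1 y - 1"
    let ?f = "\<lambda>x. free_pcomp Q ?k (size1 l) 1 (free_pcomp Q ?m (size1 y) 2
        (free_pcomp Q 3 (size1 z) 3 x (basis_vec z)) (basis_vec y)) (basis_vec l)"
    have sizes: "size1 y \<ge> 1" "size1 z \<ge> 1" by (simp_all add: size1_size)
    have n': "n = ?k + size1 l - 1" using n sizes by (simp add: r')
    have i: "(1::nat) \<le> 2" "2 \<le> ?m" "(1::nat) \<le> 1" "1 \<le> ?k" "(1::nat) \<le> 3" "(3::nat) \<le> 3"
      using sizes by auto
    have "in_ideal Q n (?f (basis_vec ?t - c))"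
      unfolding n' by (intro in_ideal.comp_left free_comps_basis_vec c(2) l y z i)
    moreover have "?f (basis_vec ?t) = basis_vec \<langle>l, a, r\<rangle>"
    proof -
      have t1: "graft 3 ?t z \<in> monomials Q ?m" by (rule graft_monomials[OF t z i(5,6)])
      have t2: "graft 2 (graft 3 ?t z) y \<in> monomials Q ?k" by (rule graft_monomials[OF t1 y i(1,2)])
      show ?thesis
        unfolding free_pcomp_basis_vec[OF t z] free_pcomp_basis_vec[OF t1 y] free_pcomp_basis_vec[OF t2 l]
        by (simp add: r' numeral_eq_Suc)
    qed
    ultimately have "in_ideal Q n (basis_vec \<langle>l, a, r\<rangle> - ?f c)"
      by (simp only: free_pcomp_linear)
    moreover have "?f c \<in> free_comps Q n"
      unfolding n' by (rule free_pcomp_closed[OF i(3,4)])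
    moreover have "lower w s \<langle>l, a, r\<rangle>" if "?f c s \<noteq> 0" for s
    proof -
      obtain s' where "c s' \<noteq> 0" "s = graft 1 (graft 2 (graft 3 s' z) y) l"
      proof -
        obtain s1 where s1: "s = graft 1 s1 l"
            "free_pcomp Q ?m (size1 y) 2 (free_pcomp Q 3 (size1 z) 3 c (basis_vec z)) (basis_vec y) s1 \<noteq> 0"
          using free_pcomp_support[OF \<open>?f c s \<noteq> 0\<close>] by (metis basis_vec_nonzero)
        obtain s2 where s2: "s1 = graft 2 s2 y" "free_pcomp Q 3 (size1 z) 3 c (basis_vec z) s2 \<noteq> 0"
          using free_pcomp_support[OF s1(2)] by (metis basis_vec_nonzero)
        obtain s3 where "s2 = graft 3 s3 z" "c s3 \<noteq> 0"
          using free_pcomp_support[OF s2(2)] by (metis basis_vec_nonzero)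
        then show thesis
          using that[of s3] s1 s2 by simp
      qed
      then show ?thesis
        using c(3)[of s'] by (auto simp: r' numeral_eq_Suc lower_rotate lower_relabel)
    qed
    ultimately show ?thesis by blast
  qed
qed

lemma normal_form_monomial:
  "t \<in> monomials Q n \<Longrightarrow> \<exists>c\<in>free_comps Q n. in_ideal Q n (basis_vec t - c) \<and> (\<forall>s. c s \<noteq> 0 \<longrightarrow> normal ok s)"
proof (induction t rule: wf_induct_rule[OF wf_measures[of "[\<lambda>t. sum_list (right_depths t), label_weight w]"]])
  case (1 t)
  show ?case
  proof (cases "normal ok t")
    case True
    then show ?thesis
      using 1(2) by (intro bexI[of _ "basis_vec t"])
        (auto simp: in_ideal.zero[unfolded zero_fun_def] free_comps_basis_vec basis_vec_nonzero)
  next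
    case False
    obtain c where c: "c \<in> free_comps Q n" "in_ideal Q n (basis_vec t - c)" "\<And>s. c s \<noteq> 0 \<Longrightarrow> lower w s t"
      using reduce_nonnormal[OF 1(2) False] by blast
    let ?S = "{s \<in> monomials Q n. c s \<noteq> 0}"
    have "\<forall>s\<in>?S. \<exists>d. d \<in> free_comps Q n \<and> in_ideal Q n (basis_vec s - d) \<and> (\<forall>s'. d s' \<noteq> 0 \<longrightarrow> normal ok s')"
      using 1(1) c(3) lower_measure by blast
    from bchoice[OF this] obtain d where d: "\<And>s. s \<in> ?S \<Longrightarrow> d s \<in> free_comps Q n \<and> in_ideal Q n (basis_vec s - d s) \<and>
        (\<forall>s'. d s s' \<noteq> 0 \<longrightarrow> normal ok s')"
      by blast
    let ?d = "\<Sum>s\<in>?S. fscale (c s) (d s)"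
    have "c = (\<Sum>s\<in>?S. fscale (c s) (basis_vec s))"
      by (subst free_comps_expand[OF c(1)], rule sum.mono_neutral_right)
        (auto simp: finite_monomials finite_ops fscale_simps)
    then have "c - ?d = (\<Sum>s\<in>?S. fscale (c s) (basis_vec s - d s))"
      by (simp add: fscale_simps sum_subtractf)
    moreover have "in_ideal Q n (\<Sum>s\<in>?S. fscale (c s) (basis_vec s - d s))"
      using d by (intro in_ideal_sum in_ideal.scale) auto
    ultimately have "in_ideal Q n (basis_vec t - c + (c - ?d))"
      using in_ideal.plus[OF c(2)] by simp
    then have "in_ideal Q n (basis_vec t - ?d)"
      by simp
    moreover have "?d \<in> free_comps Q n"
      using d by (intro free_comps_sum free_comps_fscale) auto
    moreover have "normal ok s'" if "?d s' \<noteq> 0" for s'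
    proof -
      obtain s where "s \<in> ?S" "fscale (c s) (d s) s' \<noteq> 0"
        using \<open>?d s' \<noteq> 0\<close> unfolding sum_fun_apply by (rule sum.not_neutral_contains_not_neutral)
      then show ?thesis using d by (auto simp: fscale_def)
    qed
    ultimately show ?thesis by blast
  qed
qed

text \<open>
  The unique element of a class that is supported on normal trees; its values are the coordinates of
  the class in the basis of normal trees.
\<close>

definition normal_form :: "nat \<Rightarrow> ('b, 'k) tvec set \<Rightarrow> ('b, 'k) tvec" where
  "normal_form n X = (SOME c. c \<in> X \<and> (\<forall>s. c s \<noteq> 0 \<longrightarrow> normal ok s))"

lemma normal_form_exists:
  assumes x: "x \<in> free_comps Q n"
  shows "\<exists>c. c \<in> cls n x \<and> (\<forall>s. c s \<noteq> 0 \<longrightarrow> normal ok s)"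
proof -
  have "\<forall>s\<in>monomials Q n. \<exists>d. d \<in> free_comps Q n \<and> in_ideal Q n (basis_vec s - d) \<and>
      (\<forall>s'. d s' \<noteq> 0 \<longrightarrow> normal ok s')"
    using normal_form_monomial by blast
  from bchoice[OF this] obtain d where d: "\<And>s. s \<in> monomials Q n \<Longrightarrow> d s \<in> free_comps Q n \<and>
      in_ideal Q n (basis_vec s - d s) \<and> (\<forall>s'. d s s' \<noteq> 0 \<longrightarrow> normal ok s')"
    by blast
  let ?d = "\<Sum>s\<in>monomials Q n. fscale (x s) (d s)"
  have "x - ?d = (\<Sum>s\<in>monomials Q n. fscale (x s) (basis_vec s - d s))"
    using free_comps_expand[OF x] by (simp add: fscale_simps sum_subtractf)
  then have "in_ideal Q n (x - ?d)"
    using d by (auto intro: in_ideal_sum in_ideal.scale)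
  moreover have "?d \<in> free_comps Q n"
    using d by (intro free_comps_sum free_comps_fscale) auto
  moreover have "normal ok s'" if "?d s' \<noteq> 0" for s'
  proof -
    obtain s where "s \<in> monomials Q n" "fscale (x s) (d s) s' \<noteq> 0"
      using \<open>?d s' \<noteq> 0\<close> unfolding sum_fun_apply by (rule sum.not_neutral_contains_not_neutral)
    then show ?thesis using d by (auto simp: fscale_def)
  qed
  ultimately show ?thesis
    using x by (intro exI[of _ ?d] conjI cls_memI) auto
qed

lemma normal_form_unique:
  assumes x: "x \<in> free_comps Q n" and c: "c \<in> cls n x" "\<And>s. c s \<noteq> 0 \<Longrightarrow> normal ok s"
  shows "normal_form n (cls n x) = c"
proof -
  let ?d = "normal_form n (cls n x)"
  have d: "?d \<in> cls n x" "\<And>s. ?d s \<noteq> 0 \<Longrightarrow> normal ok s"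
    using someI_ex[OF normal_form_exists[OF x]] unfolding normal_form_def by auto
  have "in_ideal Q n ((x - c) - (x - ?d))"
    using c(1) d(1) by (intro in_ideal_diff cls_memD)
  then have "in_ideal Q n (?d - c)"
    by simp
  moreover have "?d - c \<in> free_comps Q n"
    using c(1) d(1) by (intro free_comps_diff cls_memD(1))
  moreover have "normal ok s" if "(?d - c) s \<noteq> 0" for s
    using that c(2)[of s] d(2)[of s] by (cases "c s = 0") (auto simp: fun_diff_def)
  ultimately have "?d - c = 0"
    by (rule independent)
  then show ?thesis by simp
qed

lemma normal_form_mem:
  assumes "x \<in> free_comps Q n"
  shows "normal_form n (cls n x) \<in> cls n x" "normal_form n (cls n x) s \<noteq> 0 \<Longrightarrow> normal ok s"
  using someI_ex[OF normal_form_exists[OF assms]] unfolding normal_form_def by auto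

lemma normal_form_add:
  assumes "X \<in> comps P n" "Y \<in> comps P n"
  shows "normal_form n (add P n X Y) = normal_form n X + normal_form n Y"
proof -
  obtain x y where x: "x \<in> free_comps Q n" "X = cls n x" and y: "y \<in> free_comps Q n" "Y = cls n y"
    using assms unfolding comps_P by blast
  let ?c = "normal_form n X" and ?d = "normal_form n Y"
  have "in_ideal Q n ((x - ?c) + (y - ?d))"
    using normal_form_mem(1)[OF x(1)] normal_form_mem(1)[OF y(1)]
    unfolding x(2) y(2) by (intro in_ideal.plus cls_memD)
  then have "in_ideal Q n ((x + y) - (?c + ?d))"
    by (simp add: algebra_simps)
  then have "?c + ?d \<in> cls n (x + y)"
    using cls_memD(1)[OF normal_form_mem(1)[OF x(1)]] cls_memD(1)[OF normal_form_mem(1)[OF y(1)]] x y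
    by (intro cls_memI free_comps_add) auto
  moreover have "normal ok s" if "(?c + ?d) s \<noteq> 0" for s
    using that normal_form_mem(2)[OF x(1), of s] normal_form_mem(2)[OF y(1), of s] x y
    by (cases "?d s = 0") auto
  ultimately have "normal_form n (cls n (x + y)) = ?c + ?d"
    by (rule normal_form_unique[OF free_comps_add[OF x(1) y(1)]])
  then show ?thesis
    using x y by (simp add: add_cls)
qed

lemma normal_form_smul:
  assumes "X \<in> comps P n"
  shows "normal_form n (smul P n c X) = fscale c (normal_form n X)"
proof -
  obtain x where x: "x \<in> free_comps Q n" "X = cls n x"
    using assms unfolding comps_P by blast
  let ?d = "normal_form n X"
  have "in_ideal Q n (fscale c (x - ?d))"
    using normal_form_mem(1)[OF x(1)] unfolding x(2) by (intro in_ideal.scale cls_memD)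
  then have "fscale c ?d \<in> cls n (fscale c x)"
    using cls_memD(1)[OF normal_form_mem(1)[OF x(1)]] x
    by (intro cls_memI free_comps_fscale) (auto simp: fscale_simps)
  moreover have "normal ok s" if "fscale c ?d s \<noteq> 0" for s
    using that normal_form_mem(2)[OF x(1), of s] x by (auto simp: fscale_def)
  ultimately have "normal_form n (cls n (fscale c x)) = fscale c ?d"
    by (rule normal_form_unique[OF free_comps_fscale[OF x(1)]])
  then show ?thesis
    using x by (simp add: smul_cls)
qed

lemma normal_form_basis_vec:
  assumes "t \<in> monomials Q n" "normal ok t"
  shows "normal_form n (cls n (basis_vec t)) = basis_vec t"
  using assms by (intro normal_form_unique free_comps_basis_vec cls_memI)
    (auto simp: in_ideal.zero basis_vec_nonzero)

end

context right_pbw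
begin


section \<open>Contracting the bar complex\<close>

text \<open>
  The product, over the vertices, of the coordinates of the decorations of \<open>Y\<close> in the basis of normal
  trees, at those decorating \<open>Z\<close>; it is 0 if the shapes differ. As functions of \<open>Y\<close> these
  form the basis of the bar complex that is dual to the trees of normal trees.
\<close>

primrec coefficient :: "('b, 'k) tvec set ptree \<Rightarrow> 'b tree ptree \<Rightarrow> 'k" where
  "coefficient PLeaf Z = (if Z = PLeaf then 1 else 0)"
| "coefficient (Vertex X ts) Z =
     (case Z of PLeaf \<Rightarrow> 0
      | Vertex s us \<Rightarrow>
          if length us = length ts
          then normal_form (length ts) X s * prod_list (map2 (\<lambda>f u. f u) (map coefficient ts) us)
          else 0)"

lemma coefficient_linear:
  assumes "vertex_slot n C" "X \<in> comps P n"
  shows "Y \<in> comps P n \<Longrightarrow> coefficient (C (add P n X Y)) Z = coefficient (C X) Z + coefficient (C Y) Z"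
    and "coefficient (C (smul P n c X)) Z = c * coefficient (C X) Z"
proof -
  have "(\<forall>Y\<in>comps P n. coefficient (C (add P n X Y)) Z = coefficient (C X) Z + coefficient (C Y) Z) \<and>
      coefficient (C (smul P n c X)) Z = c * coefficient (C X) Z"
    using assms
  proof (induction arbitrary: Z rule: vertex_slot.induct)
    case (here ts)
    then show ?case
      by (auto simp: normal_form_add normal_form_smul fscale_def algebra_simps split: ptree.split)
  next
    case (below n C y ts us)
    show ?case
    proof (cases Z)
      case (Vertex s vs)
      show ?thesis
      proof (cases "length vs = length ts + length us + 1")
        case True
        define vs1 v vs2 where "vs1 = take (length ts) vs" "v = vs ! length ts" "vs2 = drop (Suc (length ts)) vs"
        have vs: "vs = vs1 @ v # vs2" "length vs1 = length ts" "length vs2 = length us"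
          using True by (auto simp: vs1_v_vs2_def id_take_nth_drop)
        show ?thesis
          using below.IH[OF below.prems] by (simp add: Vertex vs algebra_simps)
      qed (simp add: Vertex)
    qed simp
  qed
  then show "Y \<in> comps P n \<Longrightarrow> coefficient (C (add P n X Y)) Z = coefficient (C X) Z + coefficient (C Y) Z"
    and "coefficient (C (smul P n c X)) Z = c * coefficient (C X) Z"
    by auto
qed

lemma coefficient_shape:
  "coefficient Y Z \<noteq> 0 \<Longrightarrow> nleaves Y = nleaves Z \<and> nverts Y = nverts Z"
proof (induction Y arbitrary: Z)
  case (Vertex X ts)
  then obtain s us where Z: "Z = Vertex s us" "length us = length ts"
      "prod_list (map2 (\<lambda>f u. f u) (map coefficient ts) us) \<noteq> 0"
    by (auto split: ptree.splits if_splits)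
  have "map nleaves ts = map nleaves us \<and> map nverts ts = map nverts us"
    if "length us = length ts" "prod_list (map2 (\<lambda>f u. f u) (map coefficient ts) us) \<noteq> 0"
      "\<And>t Z. t \<in> set ts \<Longrightarrow> coefficient t Z \<noteq> 0 \<Longrightarrow> nleaves t = nleaves Z \<and> nverts t = nverts Z" for ts us
    using that by (induction us ts rule: list_induct2) auto
  from this[OF Z(2,3) Vertex.IH] show ?case
    by (simp add: Z(1))
qed (auto split: if_splits)

lemma coefficient_coset_tree:
  "decorated N Z' \<Longrightarrow> coefficient (coset_tree Q Z') Z = (if Z = Z' then 1 else 0)"
proof (induction Z' arbitrary: Z)
  case (Vertex s ts)
  have s: "s \<in> monomials Q (length ts)" "normal ok s"
    using Vertex.prems by (auto simp: comps_N)
  have prod: "prod_list (map2 (\<lambda>f u. f u) (map coefficient (map (coset_tree Q) ts)) us) = (if us = ts then 1 else 0)"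
    if "length us = length ts" "\<And>t Z. t \<in> set ts \<Longrightarrow> coefficient (coset_tree Q t) Z = (if Z = t then 1 else 0)"
    for us and ts
    using that by (induction us ts rule: list_induct2) auto
  have "coefficient (coset_tree Q t) Z = (if Z = t then 1 else 0)" if "t \<in> set ts" for t Z
    using Vertex that by (auto simp: list_all_iff)
  moreover have "normal_form (length ts) (cls (length ts) (basis_vec s)) s' = (if s' = s then 1 else 0)" for s'
    unfolding normal_form_basis_vec[OF s] by (simp add: basis_vec_def)
  ultimately show ?case
    using prod[of _ ts] by (auto split: ptree.split)
qed auto

definition cut_trees :: "nat \<Rightarrow> 'b cut_tree set" where
  "cut_trees n = {T. root_uncut T \<and> size1 T = n \<and> cut_ok ok (ops Q) T}"

text \<open>
  The form with prescribed values on the cut trees into normal pieces.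
\<close>

definition extension :: "nat \<Rightarrow> ('b cut_tree \<Rightarrow> 'k) \<Rightarrow> (('b, 'k) tvec set ptree \<Rightarrow> 'k)" where
  "extension n g = (\<lambda>Y. if decorated P Y then \<Sum>T\<in>cut_trees n. coefficient Y (blocks T) * g T else 0)"

abbreviation val :: "(('b, 'k) tvec set ptree \<Rightarrow> 'k) \<Rightarrow> 'b cut_tree \<Rightarrow> 'k" where
  "val \<phi> T \<equiv> \<phi> (coset_tree Q (blocks T))"

lemma finite_cut_trees_n: "finite (cut_trees n)"
  unfolding cut_trees_def using finite_cut_trees[OF finite_ops] .

lemma decorated_blocks_N: "T \<in> cut_trees n \<Longrightarrow> decorated N (blocks T)"
  by (simp add: cut_trees_def decorated_blocks)

lemma extension_multilinear: "multilinear P (extension n g)"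
  unfolding multilinear_def
proof (intro allI impI conjI ballI)
  fix k and C :: "('b, 'k) tvec set \<Rightarrow> ('b, 'k) tvec set ptree" and X
  assume C: "vertex_slot k C" and X: "X \<in> comps P k"
  have dec: "decorated P (C Y) \<longleftrightarrow> decorated P (C X)" if "Y \<in> comps P k" for Y
    using vertex_slot_replace[OF C] that X by blast
  show "extension n g (C (smul P k c X)) = c * extension n g (C X)" for c
    using dec[OF smul_closed[OF X]]
    by (simp add: extension_def coefficient_linear[OF C X] sum_distrib_left mult.assoc)
  show "extension n g (C (add P k X Y)) = extension n g (C X) + extension n g (C Y)" if Y: "Y \<in> comps P k" for Y
    using dec[OF add_closed[OF X Y]] dec[OF Y]
    by (simp add: extension_def coefficient_linear[OF C X] Y sum.distrib distrib_right)
qed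

lemma extension_bar:
  assumes "\<And>T. T \<in> cut_trees n \<Longrightarrow> g T \<noteq> 0 \<Longrightarrow> int (ncuts T) = int n + j - 2"
  shows "extension n g \<in> bar P n j"
proof -
  have "nleaves Y = n \<and> int (nverts Y) = int n + j - 1" if "extension n g Y \<noteq> 0" for Y
  proof -
    have "(\<Sum>T\<in>cut_trees n. coefficient Y (blocks T) * g T) \<noteq> 0"
      using that by (auto simp: extension_def split: if_splits)
    then obtain T where T: "T \<in> cut_trees n" "coefficient Y (blocks T) * g T \<noteq> 0"
      by (rule sum.not_neutral_contains_not_neutral)
    then show ?thesis
      using coefficient_shape[of Y "blocks T"] assms[OF T(1)]
      by (auto simp: nleaves_blocks nverts_blocks cut_trees_def)
  qed
  then show ?thesis
    using extension_multilinear by (auto simp: bar_def extension_def)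
qed

lemma val_extension:
  assumes "T \<in> cut_trees n"
  shows "val (extension n g) T = g T"
proof -
  have dec: "decorated P (coset_tree Q (blocks T))"
    using decorated_coset_tree decorated_N_M decorated_blocks_N[OF assms] by blast
  have "(\<Sum>T'\<in>cut_trees n. coefficient (coset_tree Q (blocks T)) (blocks T') * g T') =
      (\<Sum>T'\<in>cut_trees n. if T = T' then g T' else 0)"
    by (intro sum.cong refl)
      (auto simp: coefficient_coset_tree[OF decorated_blocks_N[OF assms]] dest: blocks_inject)
  also have "\<dots> = g T"
    using finite_cut_trees_n assms by (simp add: sum.delta)
  finally show ?thesis
    using dec by (simp add: extension_def)
qed

lemma extension_minus: "extension n (\<lambda>T. g T - h T) = extension n g - extension n h"
  by (auto simp: extension_def fun_eq_iff sum_subtractf algebra_simps)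

text \<open>
  A tree of monomials that are not all normal has a vertex to which rewriting applies.
\<close>

lemma nonnormal_slot:
  "decorated M Z \<Longrightarrow> \<not> decorated N Z \<Longrightarrow>
     \<exists>n C s. vertex_slot n C \<and> Z = C s \<and> s \<in> monomials Q n \<and> \<not> normal ok s"
proof (induction Z)
  case (Vertex s ts)
  show ?case
  proof (cases "normal ok s")
    case False
    then show ?thesis
      using vertex_slot.here[of ts] Vertex.prems(1) by (auto simp: comps_M)
  next
    case True
    then obtain t where t: "t \<in> set ts" "decorated M t" "\<not> decorated N t"
      using Vertex.prems by (auto simp: comps_M comps_N list_all_iff)
    then obtain n C s' where C: "vertex_slot n C" "t = C s'" "s' \<in> monomials Q n" "\<not> normal ok s'"
      using Vertex.IH by blast
    obtain us vs where "ts = us @ t # vs"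
      using t(1) by (meson split_list)
    then show ?thesis
      using vertex_slot.below[OF C(1), of s us vs] C by blast
  qed
qed simp

text \<open>
  Rewriting a piece that is not normal expresses the value of a form through its values at lower trees
  of monomials, to which the same applies until all pieces are normal.
\<close>

lemma vanish_nonnormal:
  assumes \<phi>: "multilinear P \<phi>"
  shows "decorated M Z \<Longrightarrow> \<not> decorated N Z \<Longrightarrow>
    (\<And>Y. decorated N Y \<Longrightarrow> nleaves Y = nleaves Z \<Longrightarrow> (Y, Z) \<in> ptree_less w \<Longrightarrow> \<phi> (coset_tree Q Y) = 0) \<Longrightarrow>
    \<phi> (coset_tree Q Z) = 0"
proof (induction Z rule: wf_induct_rule[OF wf_ptree_less[of w]])
  case (1 Z)
  obtain n C s where C: "vertex_slot n C" "Z = C s" "s \<in> monomials Q n" "\<not> normal ok s"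
    using nonnormal_slot[OF 1(2,3)] by blast
  obtain C' where C': "vertex_slot n C'" "\<And>t. coset_tree Q (C t) = C' (cls n (basis_vec t))"
    using vertex_slot_coset_tree[OF C(1)] by blast
  obtain c where c: "c \<in> free_comps Q n" "in_ideal Q n (basis_vec s - c)" "\<And>t. c t \<noteq> 0 \<Longrightarrow> lower w t s"
    using reduce_nonnormal[OF C(3,4)] by blast
  have "\<phi> (coset_tree Q Z) = \<phi> (C' (cls n c))"
    using cls_eq_iff[OF free_comps_basis_vec[OF C(3)] c(1)] c(2) C(2) C'(2) by simp
  also have "\<dots> = (\<Sum>t\<in>monomials Q n. c t * \<phi> (coset_tree Q (C t)))"
    by (simp add: multilinear_expand[OF \<phi> C'(1) c(1)] C'(2))
  also have "\<dots> = 0"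
  proof (intro sum.neutral ballI)
    fix t
    assume t: "t \<in> monomials Q n"
    show "c t * \<phi> (coset_tree Q (C t)) = 0"
    proof (cases "c t = 0")
      case False
      have dec: "decorated M (C t)"
        using vertex_slot_replace[OF C(1), of M s t] 1(2) C(2) t by (simp add: comps_M)
      have less: "(C t, Z) \<in> ptree_less w"
        using vertex_slot_lower[OF C(1), of _ "ops Q" s t w] 1(2) C(2) t c(3)[OF False]
        by (auto simp: monomials_def)
      have leaves: "nleaves (C t) = nleaves Z"
        using vertex_slot_nleaves[OF C(1)] C(2) by blast
      have trans: "(Y, Z) \<in> ptree_less w" if "(Y, C t) \<in> ptree_less w" for Y
        using that less by (auto simp: ptree_less_def)
      have "\<phi> (coset_tree Q (C t)) = 0"
        using 1(1)[OF less dec] 1(4) less leaves trans by (cases "decorated N (C t)") auto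
      then show ?thesis by simp
    qed simp
  qed
  finally show ?case .
qed

text \<open>
  The leading term of the differential at a tree whose first good edge is cut. Gluing that edge gives
  the tree on the right-hand side. Gluing another good edge keeps the first one cut, where the form
  vanishes by assumption. Gluing a bad edge creates a piece that is not normal, and the form is
  then determined by its values at lower trees, which vanish as well. The sign \<open>e\<close> depends on the
  position of the edge, hence on \<open>T\<close> but not on the form.
\<close>

lemma first_good_contraction:
  assumes T: "T \<in> cut_trees n" "has_good ok T" "mark ok True T = T"
  shows "\<exists>e::'k. e * e = 1 \<and> (\<forall>\<phi>. multilinear P \<phi> \<longrightarrow>
      (\<forall>T'\<in>cut_trees n. has_good ok T' \<longrightarrow> mark ok True T' = T' \<longrightarrow> val \<phi> T' = 0) \<longrightarrow>
      (\<forall>T'\<in>cut_trees n. (blocks T', blocks T) \<in> ptree_less w \<longrightarrow> val \<phi> T' = 0) \<longrightarrow>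
      val (bar_diff P \<phi>) T = e * val \<phi> (mark ok False T))"
proof -
  obtain xs ys where unc: "uncuts T = xs @ mark ok False T # ys"
    and rest: "\<And>T'. T' \<in> set xs \<union> set ys \<Longrightarrow> has_good ok T' \<and> mark ok True T' = T'"
    using uncuts_first_good[OF T(2,3)] by blast
  have T': "root_uncut T" "cut_ok ok (ops Q) T" "size1 T = n"
    using T(1) by (auto simp: cut_trees_def)
  have "val (bar_diff P \<phi>) T = (- 1) ^ length xs * val \<phi> (mark ok False T)"
    if \<phi>: "multilinear P \<phi>"
      and marked: "\<And>T'. T' \<in> cut_trees n \<Longrightarrow> has_good ok T' \<Longrightarrow> mark ok True T' = T' \<Longrightarrow> val \<phi> T' = 0"
      and less: "\<And>T'. T' \<in> cut_trees n \<Longrightarrow> (blocks T', blocks T) \<in> ptree_less w \<Longrightarrow> val \<phi> T' = 0" for \<phi>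
  proof -
    have zero: "val \<phi> U = 0" if U: "U \<in> set xs \<union> set ys" for U
    proof -
      have inv: "map_tree fst U = map_tree fst T" "root_uncut U"
        using uncuts_invariants[of U T] U unc T'(1) by auto
      have size: "size1 U = n"
        using arg_cong[OF inv(1), of size1] T'(3) by (simp add: size1_size)
      have okU: "cut_ok (\<lambda>_ _. True) (ops Q) U"
        using cut_ok_uncuts[OF cut_ok_mono[OF T'(2)], of U] U unc by auto
      show ?thesis
      proof (cases "cut_ok ok (ops Q) U")
        case True
        then show ?thesis
          using marked[of U] rest[OF U] inv size by (simp add: cut_trees_def)
      next
        case False
        show ?thesis
        proof (rule vanish_nonnormal[OF \<phi>])
          show "decorated M (blocks U)" "\<not> decorated N (blocks U)"
            using okU False by (simp_all add: decorated_blocks inv(2))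
          fix Y
          assume Y: "decorated N Y" "nleaves Y = nleaves (blocks U)" "(Y, blocks U) \<in> ptree_less w"
          have "n \<ge> 2"
            using T'(1,3) by (auto simp: root_uncut_def size1_size)
          then obtain T'' where T'': "root_uncut T''" "Y = blocks T''"
            using blocks_surj[OF Y(1)] Y(2) size by (metis nleaves_blocks)
          have "T'' \<in> cut_trees n"
            using T'' Y(1,2) size decorated_blocks[OF T''(1)] by (simp add: cut_trees_def nleaves_blocks)
          moreover have "sum_list (right_depths U) = sum_list (right_depths T)"
            using inv(1) by (metis right_depths_map_tree)
          then have "(blocks T'', blocks T) \<in> ptree_less w"
            using Y(3) inv(1) unfolding T''(2) ptree_less_def
            by (simp add: depth_sum_blocks label_sum_blocks)
          ultimately show "\<phi> (coset_tree Q Y) = 0"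
            using less T''(2) by simp
        qed
      qed
    qed
    have "val (bar_diff P \<phi>) T = alt (val \<phi>) (uncuts T)"
      using bar_diff_blocks[OF T'(1) cut_ok_mono[OF T'(2)]] .
    also have "\<dots> = (- 1) ^ length xs * val \<phi> (mark ok False T)"
      using zero by (simp add: unc alt_zero)
    finally show ?thesis .
  qed
  then show ?thesis
    by (intro exI[of _ "(- 1) ^ length xs"]) (auto simp flip: power_mult_distrib)
qed

lemma mark_cut_trees: "mark ok c T \<in> cut_trees n \<longleftrightarrow> T \<in> cut_trees n"
  by (simp add: cut_trees_def root_uncut_mark size1_mark cut_ok_mark)

lemma ptree_less_blocks_mark:
  "(blocks T', blocks (mark ok c T)) \<in> ptree_less w \<longleftrightarrow> (blocks T', blocks T) \<in> ptree_less w"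
proof -
  have "sum_list (right_depths (mark ok c T)) = sum_list (right_depths T)"
    by (metis map_tree_mark right_depths_map_tree)
  then show ?thesis
    by (simp add: ptree_less_def depth_sum_blocks label_sum_blocks map_tree_mark)
qed

text \<open>
  A primitive \<open>g\<close> is sought among the functions that vanish wherever the first good edge is cut. Its
  differential at a tree with that edge cut is, up to sign, the value of \<open>g\<close> at the tree with that edge
  glued plus terms at lower trees. So \<open>g\<close> is found by well-founded recursion such that \<open>\<phi>\<close> minus
  the differential vanishes at all trees whose first good edge is cut. Being a cocycle, this
  difference then vanishes at the trees whose first good edge is not cut, by induction, and for reasons
  of degree at those without good edges.
\<close>

lemma cocycle_is_coboundary:
  assumes n: "n \<ge> 2" and j: "j \<noteq> 0" and \<phi>: "\<phi> \<in> bar P n j" "bar_diff P \<phi> = 0"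
  shows "\<exists>\<psi>\<in>bar P n (j - 1). \<phi> = bar_diff P \<psi>"
proof -
  \<comment> \<open>The cut trees of the degree of a primitive whose first good edge is not cut.\<close>
  let ?U = "{T \<in> cut_trees n. has_good ok T \<and> mark ok False T = T \<and> int (ncuts T) = int n + j - 3}"
  let ?R = "{(T', T). (blocks T', blocks T) \<in> ptree_less w}"
  have "\<forall>T\<in>{T \<in> cut_trees n. has_good ok T \<and> mark ok True T = T}. \<exists>e::'k. e * e = 1 \<and> (\<forall>\<phi>. multilinear P \<phi> \<longrightarrow>
      (\<forall>T'\<in>cut_trees n. has_good ok T' \<longrightarrow> mark ok True T' = T' \<longrightarrow> val \<phi> T' = 0) \<longrightarrow>
      (\<forall>T'\<in>cut_trees n. (blocks T', blocks T) \<in> ptree_less w \<longrightarrow> val \<phi> T' = 0) \<longrightarrow>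
      val (bar_diff P \<phi>) T = e * val \<phi> (mark ok False T))"
    using first_good_contraction by blast
  from bchoice[OF this] obtain e :: "'b cut_tree \<Rightarrow> 'k" where
    e: "\<And>T. T \<in> cut_trees n \<Longrightarrow> has_good ok T \<Longrightarrow> mark ok True T = T \<Longrightarrow> e T * e T = 1" and
    key: "\<And>T \<phi>. T \<in> cut_trees n \<Longrightarrow> has_good ok T \<Longrightarrow> mark ok True T = T \<Longrightarrow> multilinear P \<phi> \<Longrightarrow>
      (\<And>T'. T' \<in> cut_trees n \<Longrightarrow> has_good ok T' \<Longrightarrow> mark ok True T' = T' \<Longrightarrow> val \<phi> T' = 0) \<Longrightarrow>
      (\<And>T'. T' \<in> cut_trees n \<Longrightarrow> (blocks T', blocks T) \<in> ptree_less w \<Longrightarrow> val \<phi> T' = 0) \<Longrightarrow>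
      val (bar_diff P \<phi>) T = e T * val \<phi> (mark ok False T)"
    by blast
  have wf: "wf ?R"
    using wf_inv_image[OF wf_ptree_less[of w], of blocks] by (simp add: inv_image_def)
  obtain g where g: "\<And>T. g T = (if T \<in> ?U then e (mark ok True T) * (val \<phi> (mark ok True T) -
      val (bar_diff P (extension n (\<lambda>T'. if (T', T) \<in> ?R then g T' else 0))) (mark ok True T)) else 0)"
    using wfrec_solution[OF wf, of "\<lambda>T r. if T \<in> ?U then e (mark ok True T) * (val \<phi> (mark ok True T) -
      val (bar_diff P (extension n r)) (mark ok True T)) else 0"] by blast
  let ?\<psi> = "extension n g"
  have \<psi>: "?\<psi> \<in> bar P n (j - 1)"
    by (rule extension_bar) (subst (asm) g, auto split: if_splits)
  have d\<psi>: "bar_diff P ?\<psi> \<in> bar P n j"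
    by (rule bar_diff_bar[OF \<psi>])
  define \<phi>' where "\<phi>' = \<phi> - bar_diff P ?\<psi>"
  have \<phi>': "\<phi>' \<in> bar P n j"
    unfolding \<phi>'_def by (rule bar_minus[OF \<phi>(1) d\<psi>])
  have degree: "val \<phi>' T = 0" if "T \<in> cut_trees n" "int (ncuts T) \<noteq> int n + j - 2" for T
    using \<phi>' that by (auto simp: bar_def nverts_coset_tree nverts_blocks)
  have closed: "bar_diff P \<phi>' = 0"
    unfolding \<phi>'_def bar_diff_minus using \<phi>(2) bar_diff_squared[OF \<psi> n] by simp
  have marked: "val \<phi>' T = 0" if T: "T \<in> cut_trees n" "has_good ok T" "mark ok True T = T" for T
  proof (cases "int (ncuts T) = int n + j - 2")
    case False
    then show ?thesis using degree T(1) by blast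
  next
    case True
    let ?Z = "mark ok False T"
    let ?g = "\<lambda>T'. if (T', ?Z) \<in> ?R then g T' else 0"
    have Z: "mark ok True ?Z = T" "?Z \<in> ?U"
      using T True ncuts_mark[OF T(2)] by (auto simp: mark_mark mark_cut_trees has_good_mark)
    \<comment> \<open>\<open>g\<close> and its truncation \<open>?g\<close> below \<open>?Z\<close> agree at all lower trees, so their difference has only
      the leading term.\<close>
    have "val (bar_diff P (extension n (\<lambda>T. g T - ?g T))) T = e T * val (extension n (\<lambda>T. g T - ?g T)) ?Z"
    proof (rule key[OF T extension_multilinear])
      fix T'
      assume T': "T' \<in> cut_trees n" "has_good ok T'" "mark ok True T' = T'"
      have "mark ok False T' \<noteq> T'"
        using ncuts_mark[OF T'(2)] T'(3) by auto
      then have "g T' = 0"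
        by (subst g) simp
      then show "val (extension n (\<lambda>T. g T - ?g T)) T' = 0"
        by (simp add: val_extension[OF T'(1)])
    next
      fix T'
      assume T': "T' \<in> cut_trees n" "(blocks T', blocks T) \<in> ptree_less w"
      then show "val (extension n (\<lambda>T. g T - ?g T)) T' = 0"
        by (simp add: val_extension[OF T'(1)] ptree_less_blocks_mark)
    qed
    also have "val (extension n (\<lambda>T. g T - ?g T)) ?Z = g ?Z"
      using Z(2) by (subst val_extension) (auto simp: ptree_less_def)
    also have "g ?Z = e T * (val \<phi> T - val (bar_diff P (extension n ?g)) T)"
      using Z by (subst g) simp
    finally have "val (bar_diff P ?\<psi>) T - val (bar_diff P (extension n ?g)) T =
        (e T * e T) * (val \<phi> T - val (bar_diff P (extension n ?g)) T)"
      unfolding extension_minus bar_diff_minus by (simp only: minus_apply mult.assoc)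
    then show ?thesis
      using e[OF T] by (simp add: \<phi>'_def)
  qed
  have normal: "val \<phi>' T = 0" if "T \<in> cut_trees n" for T
    using that
  proof (induction T rule: wf_induct_rule[OF wf])
    case (1 T)
    show ?case
    proof (cases "has_good ok T")
      case False
      have "ncuts T = n - 2"
        using ncuts_no_good[OF False, of "ops Q"] 1(2) by (auto simp: cut_trees_def root_uncut_def size1_size)
      then show ?thesis
        using degree[OF 1(2)] n j by auto
    next
      case good: True
      show ?thesis
      proof (cases "mark ok True T = T")
        case True
        then show ?thesis using marked 1(2) good by blast
      next
        case False
        then have T: "mark ok False T = T"
          using mark_cases[of T ok] by auto
        let ?T = "mark ok True T"
        have "val (bar_diff P \<phi>') ?T = e ?T * val \<phi>' (mark ok False ?T)"
        proof (rule key)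
          show "multilinear P \<phi>'" using \<phi>' by (simp add: bar_def)
          show "val \<phi>' T' = 0" if "T' \<in> cut_trees n" "(blocks T', blocks ?T) \<in> ptree_less w" for T'
            using 1(1)[of T'] that by (simp add: ptree_less_blocks_mark)
        qed (use 1(2) good marked in \<open>auto simp: mark_cut_trees has_good_mark mark_mark\<close>)
        moreover have "e ?T \<noteq> 0"
          using e[of ?T] 1(2) good by (auto simp: mark_cut_trees has_good_mark mark_mark)
        ultimately show ?thesis
          using closed T by (simp add: mark_mark)
      qed
    qed
  qed
  have "\<phi>' = 0"
  proof (rule bar_eq_zero[OF \<phi>' n])
    fix T
    assume T: "root_uncut T" "size1 T = n" "cut_ok (\<lambda>_ _. True) (ops Q) T"
    show "val \<phi>' T = 0"
    proof (cases "cut_ok ok (ops Q) T")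
      case True
      then show ?thesis using normal T by (simp add: cut_trees_def)
    next
      case False
      show ?thesis
      proof (rule vanish_nonnormal)
        show "multilinear P \<phi>'" using \<phi>' by (simp add: bar_def)
        show "decorated M (blocks T)" "\<not> decorated N (blocks T)"
          using T False by (simp_all add: decorated_blocks)
        fix Y
        assume Y: "decorated N Y" "nleaves Y = nleaves (blocks T)"
        obtain T'' where T'': "root_uncut T''" "Y = blocks T''"
          using blocks_surj[OF Y(1)] Y(2) T(2) n by (metis nleaves_blocks)
        then have "T'' \<in> cut_trees n"
          using Y T(2) decorated_blocks[OF T''(1)] by (simp add: cut_trees_def nleaves_blocks)
        then show "\<phi>' (coset_tree Q Y) = 0"
          using normal T''(2) by simp
      qed
    qed
  qed
  then show ?thesis
    using \<psi> by (intro bexI[of _ ?\<psi>]) (simp_all add: \<phi>'_def)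
qed

theorem koszul_right_pbw: "koszul P"
  unfolding koszul_def
proof (intro allI impI equalityI subsetI)
  fix n :: nat and j :: int and \<phi>
  assume n: "n \<ge> 2" and j: "j \<noteq> 0"
  show "\<phi> \<in> bar_diff P ` bar P n (j - 1)" if "\<phi> \<in> {\<phi> \<in> bar P n j. bar_diff P \<phi> = 0}"
    using cocycle_is_coboundary[OF n j] that by blast
  show "\<phi> \<in> {\<phi> \<in> bar P n j. bar_diff P \<phi> = 0}" if "\<phi> \<in> bar_diff P ` bar P n (j - 1)"
    using that bar_diff_bar bar_diff_squared[OF _ n] by auto
qed

end


section \<open>Realizing monomials by comparison of points\<close>

definition join :: "'p::{semilattice_sup, order_bot} list \<Rightarrow> 'p" where
  "join k = foldr sup k bot"

lemma sup_bot_simps [simp]: "sup bot p = p" "sup p bot = p" for p :: "'p::{semilattice_sup, order_bot}"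
  by (auto intro: sup_absorb1 sup_absorb2)

lemma join_simps [simp]: "join [] = bot" "join (p # k) = sup p (join k)" "join (k @ k') = sup (join k) (join k')"
  by (induction k) (auto simp: join_def sup_assoc)

text \<open>
  Points at the leaves label each shape of tree in exactly one way, by comparing the joins over the two
  subtrees of a node. A monomial fits the points if its labels are these.
\<close>

primrec fits :: "('p::{semilattice_sup, order_bot} \<Rightarrow> 'p \<Rightarrow> 'b) \<Rightarrow> 'b tree \<Rightarrow> 'p list \<Rightarrow> bool" where
  "fits c \<langle>\<rangle> k \<longleftrightarrow> True"
| "fits c \<langle>l, a, r\<rangle> k \<longleftrightarrow> fits c l (take (size1 l) k) \<and> fits c r (drop (size1 l) k) \<and>
     a = c (join (take (size1 l) k)) (join (drop (size1 l) k))"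

text \<open>
  Grafting turns the points at the leaves of \<open>u\<close> into one point at a leaf of \<open>s\<close>, their join.
\<close>

lemma fits_graft:
  "length k\<^sub>2 = size1 u \<Longrightarrow> length k\<^sub>1 + length k\<^sub>3 + 1 = size1 s \<Longrightarrow>
     fits c (graft (Suc (length k\<^sub>1)) s u) (k\<^sub>1 @ k\<^sub>2 @ k\<^sub>3) \<longleftrightarrow> fits c u k\<^sub>2 \<and> fits c s (k\<^sub>1 @ join k\<^sub>2 # k\<^sub>3)"
proof (induction s arbitrary: k\<^sub>1 k\<^sub>3)
  case (Node l a r)
  show ?case
  proof (cases "Suc (length k\<^sub>1) \<le> size1 l")
    case True
    define k\<^sub>4 k\<^sub>5 where "k\<^sub>4 = take (size1 l - Suc (length k\<^sub>1)) k\<^sub>3" and "k\<^sub>5 = drop (size1 l - Suc (length k\<^sub>1)) k\<^sub>3"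
    have k: "k\<^sub>3 = k\<^sub>4 @ k\<^sub>5" "length k\<^sub>1 + length k\<^sub>4 + 1 = size1 l"
      using Node.prems True by (auto simp: k\<^sub>4_def k\<^sub>5_def)
    have "size1 (graft (Suc (length k\<^sub>1)) l u) = length (k\<^sub>1 @ k\<^sub>2 @ k\<^sub>4)"
      using True Node.prems(1) k(2) by (simp add: size1_graft)
    then show ?thesis
      using True Node.IH(1)[OF Node.prems(1) k(2)] k(2)[symmetric] by (simp add: k(1) sup_assoc)
  next
    case False
    define k\<^sub>4 k\<^sub>5 where "k\<^sub>4 = take (size1 l) k\<^sub>1" and "k\<^sub>5 = drop (size1 l) k\<^sub>1"
    have k: "k\<^sub>1 = k\<^sub>4 @ k\<^sub>5" "length k\<^sub>4 = size1 l"
      using False by (auto simp: k\<^sub>4_def k\<^sub>5_def)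
    have "length k\<^sub>5 + length k\<^sub>3 + 1 = size1 r"
      using Node.prems(2) k by simp
    from Node.IH(2)[OF Node.prems(1) this] show ?thesis
      using False k(2)[symmetric] by (auto simp: k(1) sup_assoc)
  qed
qed auto

text \<open>
  The right and left combs with three leaves have one fitting labelling each; a relation is respected if
  its two sides have the same coefficient there.
\<close>

locale realization = quadratic Q for Q :: "('b, 'k::field) quad_data" +
  fixes c :: "'p::{semilattice_sup, order_bot} \<Rightarrow> 'p \<Rightarrow> 'b"
  assumes rels_support: "(u, v) \<in> rels Q \<Longrightarrow> u (a, b) \<noteq> 0 \<or> v (a, b) \<noteq> 0 \<Longrightarrow> a \<in> ops Q \<and> b \<in> ops Q"
    and rels_realized: "(u, v) \<in> rels Q \<Longrightarrow> u (c p q, c (sup p q) s) = v (c p (sup q s), c q s)"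
begin

definition evaluate :: "nat \<Rightarrow> ('b, 'k) tvec \<Rightarrow> 'p list \<Rightarrow> 'k" where
  "evaluate n x k = (\<Sum>t\<in>monomials Q n. if fits c t k then x t else 0)"

lemma evaluate_rel:
  assumes "(u, v) \<in> rels Q"
  shows "evaluate 3 (rel_vec (u, v)) [p, q, s] = 0"
proof -
  let ?t = "\<langle>\<langle>\<langle>\<rangle>, c p q, \<langle>\<rangle>\<rangle>, c (sup p q) s, \<langle>\<rangle>\<rangle>" and ?t' = "\<langle>\<langle>\<rangle>, c p (sup q s), \<langle>\<langle>\<rangle>, c q s, \<langle>\<rangle>\<rangle>\<rangle>"
  let ?f = "\<lambda>t. if fits c t [p, q, s] then rel_vec (u, v) t else 0"
  \<comment> \<open>Each of the two shapes has a single fitting labelling.\<close>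
  have shape: "t = ?t \<or> t = ?t'" if "?f t \<noteq> 0" for t
    using that by (cases "((u, v), t)" rule: rel_vec.cases) (auto split: if_splits)
  have "evaluate 3 (rel_vec (u, v)) [p, q, s] = (\<Sum>t\<in>{?t, ?t'}. ?f t)"
    unfolding evaluate_def
  proof (rule sum.mono_neutral_cong)
    show "?f t = 0" if "t \<in> {?t, ?t'} - monomials Q 3" for t
      using rels_support[OF assms, of "c p q" "c (sup p q) s"] rels_support[OF assms, of "c p (sup q s)" "c q s"] that
      by (auto simp: monomials_def)
    show "?f t = 0" if "t \<in> monomials Q 3 - {?t, ?t'}" for t
      using shape that by blast
  qed (auto simp: finite_monomials finite_ops)
  also have "\<dots> = 0"
    using rels_realized[OF assms] by simp
  finally show ?thesis .
qed

text \<open>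
  Evaluation turns compositions into products, since a grafted tree fits exactly if both parts do.
\<close>

lemma evaluate_free_pcomp:
  assumes len: "length k\<^sub>2 = n" "length k\<^sub>1 + length k\<^sub>3 + 1 = m"
  shows "evaluate (m + n - 1) (free_pcomp Q m n (Suc (length k\<^sub>1)) x y) (k\<^sub>1 @ k\<^sub>2 @ k\<^sub>3)
    = evaluate m x (k\<^sub>1 @ join k\<^sub>2 # k\<^sub>3) * evaluate n y k\<^sub>2"
proof -
  let ?i = "Suc (length k\<^sub>1)" and ?k = "k\<^sub>1 @ k\<^sub>2 @ k\<^sub>3"
  let ?A = "monomials Q m" and ?B = "monomials Q n" and ?C = "monomials Q (m + n - 1)"
  have fin: "finite ?C" by (simp add: finite_monomials finite_ops)
  have "evaluate (m + n - 1) (free_pcomp Q m n ?i x y) ?k =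
      (\<Sum>t\<in>?C. \<Sum>s\<in>?A. \<Sum>u\<in>?B. if graft ?i s u = t then if fits c t ?k then x s * y u else 0 else 0)"
    unfolding evaluate_def free_pcomp_double_sum by (intro sum.cong refl) (auto cong: if_cong)
  also have "\<dots> = (\<Sum>s\<in>?A. \<Sum>u\<in>?B. \<Sum>t\<in>?C. if graft ?i s u = t then if fits c t ?k then x s * y u else 0 else 0)"
    by (subst sum.swap) (intro sum.cong refl sum.swap)
  also have "\<dots> = (\<Sum>s\<in>?A. \<Sum>u\<in>?B. (if fits c s (k\<^sub>1 @ join k\<^sub>2 # k\<^sub>3) then x s else 0) * (if fits c u k\<^sub>2 then y u else 0))"
  proof (intro sum.cong refl)
    fix s u
    assume s: "s \<in> ?A" and u: "u \<in> ?B"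
    have "graft ?i s u \<in> ?C"
      using len by (intro graft_monomials[OF s u]) auto
    moreover have "fits c (graft ?i s u) ?k \<longleftrightarrow> fits c u k\<^sub>2 \<and> fits c s (k\<^sub>1 @ join k\<^sub>2 # k\<^sub>3)"
      using s u len by (intro fits_graft) (auto simp: monomials_def)
    ultimately show "(\<Sum>t\<in>?C. if graft ?i s u = t then if fits c t ?k then x s * y u else 0 else 0) =
        (if fits c s (k\<^sub>1 @ join k\<^sub>2 # k\<^sub>3) then x s else 0) * (if fits c u k\<^sub>2 then y u else 0)"
      using fin by (simp add: sum.delta)
  qed
  finally show ?thesis
    by (simp add: evaluate_def sum_product)
qed

lemma evaluate_linear:
  "evaluate n 0 k = 0" "evaluate n (x + y) k = evaluate n x k + evaluate n y k"
  "evaluate n (fscale a x) k = a * evaluate n x k"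
  by (auto simp: evaluate_def fscale_def sum_distrib_left if_distrib sum.distrib[symmetric] intro!: sum.cong cong: if_cong)

lemma evaluate_ideal: "in_ideal Q n x \<Longrightarrow> length k = n \<Longrightarrow> evaluate n x k = 0"
proof (induction arbitrary: k rule: in_ideal.induct)
  case (rel r)
  then obtain p q s where "k = [p, q, s]"
    by (auto simp: numeral_eq_Suc length_Suc_conv)
  then show ?case
    using evaluate_rel rel.hyps by (cases r) blast
next
  case (comp_left m x y n i)
  define k\<^sub>1 k\<^sub>2 k\<^sub>3 where "k\<^sub>1 = take (i - 1) k" and "k\<^sub>2 = take n (drop (i - 1) k)" and "k\<^sub>3 = drop n (drop (i - 1) k)"
  show ?case
  proof (cases "n = 0")
    case False
    then have "length k\<^sub>2 = n" "length k\<^sub>1 + length k\<^sub>3 + 1 = m" "i = Suc (length k\<^sub>1)"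
      using comp_left by (auto simp: k\<^sub>1_def k\<^sub>2_def k\<^sub>3_def)
    moreover have "k = k\<^sub>1 @ k\<^sub>2 @ k\<^sub>3"
      unfolding k\<^sub>1_def k\<^sub>2_def k\<^sub>3_def by (simp only: append_take_drop_id)
    ultimately show ?thesis
      using evaluate_free_pcomp[of k\<^sub>2 n k\<^sub>1 k\<^sub>3 m x y] comp_left.IH[of "k\<^sub>1 @ join k\<^sub>2 # k\<^sub>3"] by simp
  next
    \<comment> \<open>There are no trees without leaves, so there is nothing to compose with.\<close>
    case True
    have "monomials Q 0 = {}" by (auto simp: monomials_def)
    then show ?thesis
      unfolding evaluate_def free_pcomp_double_sum True by (intro sum.neutral) simp
  qed
next
  case (comp_right x m n y i)
  define k\<^sub>1 k\<^sub>2 k\<^sub>3 where "k\<^sub>1 = take (i - 1) k" and "k\<^sub>2 = take n (drop (i - 1) k)" and "k\<^sub>3 = drop n (drop (i - 1) k)"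
  show ?case
  proof (cases "n = 0")
    case False
    then have "length k\<^sub>2 = n" "length k\<^sub>1 + length k\<^sub>3 + 1 = m" "i = Suc (length k\<^sub>1)"
      using comp_right by (auto simp: k\<^sub>1_def k\<^sub>2_def k\<^sub>3_def)
    moreover have "k = k\<^sub>1 @ k\<^sub>2 @ k\<^sub>3"
      unfolding k\<^sub>1_def k\<^sub>2_def k\<^sub>3_def by (simp only: append_take_drop_id)
    ultimately show ?thesis
      using evaluate_free_pcomp[of k\<^sub>2 n k\<^sub>1 k\<^sub>3 m x y] comp_right.IH[of k\<^sub>2] by simp
  next
    \<comment> \<open>There are no trees without leaves, so there is nothing to compose with.\<close>
    case True
    have "monomials Q 0 = {}" by (auto simp: monomials_def)
    then show ?thesis
      unfolding evaluate_def free_pcomp_double_sum True by (intro sum.neutral) simp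
  qed
qed (simp_all add: evaluate_linear)

text \<open>
  If each normal tree has points at which only that tree and smaller normal trees fit, the
  evaluations at these points form a triangular matrix.
\<close>

lemma triangular_independent:
  assumes wf: "wf R"
    and point: "\<And>t. t \<in> monomials Q n \<Longrightarrow> normal ok t \<Longrightarrow> \<exists>k. length k = n \<and> fits c t k \<and>
      (\<forall>t'. normal ok t' \<longrightarrow> size1 t' = n \<longrightarrow> fits c t' k \<longrightarrow> t' = t \<or> (t', t) \<in> R)"
    and x: "in_ideal Q n x" "x \<in> free_comps Q n" "\<And>t. x t \<noteq> 0 \<Longrightarrow> normal ok t"
  shows "x = 0"
proof
  fix t
  show "x t = 0 t"
    using wf
  proof (induction t rule: wf_induct_rule)
    case (less t)
    show ?case
    proof (rule ccontr)
      assume "x t \<noteq> 0 t"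
      then have t: "t \<in> monomials Q n" "normal ok t" "x t \<noteq> 0"
        using x(2,3) by (auto simp: free_comps_def)
      obtain k where k: "length k = n" "fits c t k"
          "\<And>t'. normal ok t' \<Longrightarrow> size1 t' = n \<Longrightarrow> fits c t' k \<Longrightarrow> t' = t \<or> (t', t) \<in> R"
        using point[OF t(1,2)] by blast
      have "(if fits c t' k then x t' else 0) = (if t = t' then x t' else 0)" if "t' \<in> monomials Q n" for t'
        using k(2) k(3)[of t'] x(3)[of t'] less.IH[of t'] that by (auto simp: monomials_def)
      then have "evaluate n x k = x t"
        using t(1) by (simp add: evaluate_def finite_monomials finite_ops sum.delta)
      then show False
        using evaluate_ideal[OF x(1) k(1)] t(3) by simp
    qed
  qed
qed

end


section \<open>Powers of the dendriform operad\<close>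

text \<open>
  The condition on right edges for powers of the dendriform operad: some factor has \<open>\<prec>\<close> at the parent and
  \<open>\<succ>\<close> at the child.
\<close>

fun ascends :: "dend_op label \<Rightarrow> dend_op label \<Rightarrow> bool" where
  "ascends (Gen x) (Gen y) \<longleftrightarrow> x = Prec \<and> y = Succ"
| "ascends (Tensor a a') (Tensor b b') \<longleftrightarrow> ascends a b \<or> ascends a' b'"
| "ascends _ _ \<longleftrightarrow> False"

primrec prec_count :: "dend_op label \<Rightarrow> nat" where
  "prec_count (Gen x) = (if x = Prec then 1 else 0)"
| "prec_count (Tensor a b) = prec_count a + prec_count b"

text \<open>
  The power with \<open>d + 1\<close> factors, so that there is no empty product to exclude.
\<close>

abbreviation dend_power :: "nat \<Rightarrow> (dend_op label, 'k::field) quad_data" where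
  "dend_power d \<equiv> (black_square Dend ^^ d) Dend"

lemma ops_black_square: "ops (black_square Q Q') = {Tensor a a' | a a'. a \<in> ops Q \<and> a' \<in> ops Q'}"
  by (simp add: black_square_def)

lemma rels_black_square:
  "rels (black_square Q Q') =
     rel.span {(s23 u u', s23 v v') | u v u' v'. (u, v) \<in> rels Q \<and> (u', v') \<in> rels Q'}"
  by (simp add: black_square_def)

lemma dend_power_Suc: "dend_power (Suc d) = black_square Dend (dend_power d)"
  by simp

text \<open>
  On functions on \<open>\<nat>\<close>, the products \<open>x n * (\<Sum>k\<le>n. y k)\<close> and \<open>(\<Sum>k<n. x k) * y n\<close> are a dendriform structure.
  For \<open>x\<close> and \<open>y\<close> the indicator functions of \<open>p\<close> and \<open>q\<close>, the operation chosen here is the one with nonzero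
  product, which is the indicator function of the maximum.
\<close>

definition dend_compare :: "nat \<Rightarrow> nat \<Rightarrow> dend_op label" where
  "dend_compare p q = Gen (if q \<le> p then Prec else Succ)"

text \<open>
  Points are sequences of numbers, of which the first \<open>d + 1\<close> entries are compared, so that one type
  serves all powers.
\<close>

primrec compare :: "nat \<Rightarrow> (nat \<Rightarrow> nat) \<Rightarrow> (nat \<Rightarrow> nat) \<Rightarrow> dend_op label" where
  "compare 0 p q = dend_compare (p 0) (q 0)"
| "compare (Suc d) p q = Tensor (dend_compare (p 0) (q 0)) (compare d (\<lambda>i. p (Suc i)) (\<lambda>i. q (Suc i)))"

lemma ops_Dend: "ops Dend = {Gen Prec, Gen Succ}"
  by (simp add: Dend_def Let_def)

lemma finite_ops_dend_power: "finite (ops (dend_power d :: (dend_op label, 'k::field) quad_data))"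
proof (induction d)
  case 0
  then show ?case by (simp add: ops_Dend)
next
  case (Suc d)
  let ?A = "ops (Dend :: (dend_op label, 'k) quad_data)"
  let ?B = "ops (dend_power d :: (dend_op label, 'k) quad_data)"
  have "{Tensor a a' | a a'. a \<in> ?A \<and> a' \<in> ?B} = (\<lambda>(a, a'). Tensor a a') ` (?A \<times> ?B)"
    by auto
  then show ?case
    unfolding dend_power_Suc ops_black_square using Suc by (simp add: ops_Dend)
qed

lemma rel_span_induct:
  assumes "(u, v) \<in> rel.span S" "(\<And>u v. (u, v) \<in> S \<Longrightarrow> P u v)" "P 0 0"
    "\<And>u v u' v'. P u v \<Longrightarrow> P u' v' \<Longrightarrow> P (u + u') (v + v')" "\<And>a u v. P u v \<Longrightarrow> P (fscale a u) (fscale a v)"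
  shows "P u v"
proof -
  have "rel.subspace {(u, v). P u v}"
    using assms(3-5) by (auto simp: rel.subspace_def zero_prod_def rscale_def)
  then have "rel.span S \<subseteq> {(u, v). P u v}"
    using assms(2) by (intro rel.span_minimal) auto
  then show ?thesis using assms(1) by auto
qed

lemma rels_Dend_induct:
  assumes "(u, v) \<in> rels Dend" "P 0 0"
    and "\<And>u v u' v'. P u v \<Longrightarrow> P u' v' \<Longrightarrow> P (u + u') (v + v')" "\<And>a u v. P u v \<Longrightarrow> P (fscale a u) (fscale a v)"
    and "P (tens (basis_vec (Gen Prec)) (basis_vec (Gen Prec)))
           (tens (basis_vec (Gen Prec)) (basis_vec (Gen Prec) + basis_vec (Gen Succ)))"
      "P (tens (basis_vec (Gen Succ)) (basis_vec (Gen Prec))) (tens (basis_vec (Gen Succ)) (basis_vec (Gen Prec)))"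
      "P (tens (basis_vec (Gen Prec) + basis_vec (Gen Succ)) (basis_vec (Gen Succ)))
           (tens (basis_vec (Gen Succ)) (basis_vec (Gen Succ)))"
  shows "P u v"
proof -
  let ?p = "basis_vec (Gen Prec)" and ?s = "basis_vec (Gen Succ)"
  have "(u, v) \<in> rel.span {(tens ?p ?p, tens ?p (?p + ?s)), (tens ?s ?p, tens ?s ?p), (tens (?p + ?s) ?s, tens ?s ?s)}"
    using assms(1) by (simp add: Dend_def Let_def)
  then show ?thesis
    by (rule rel_span_induct[where P = P]) (use assms in auto)
qed

lemma s23_Tensor: "s23 u u' (Tensor a a', Tensor b b') = u (a, b) * u' (a', b')"
  by (simp add: s23_def)

lemma s23_nonzero:
  assumes "s23 u u' (a, b) \<noteq> 0"
  obtains x a' y b' where "a = Tensor x a'" "b = Tensor y b'" "u (x, y) \<noteq> 0" "u' (a', b') \<noteq> 0"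
  using assms by (auto simp: s23_def split: label.splits)

definition supported :: "'b set \<Rightarrow> ('b \<times> 'b \<Rightarrow> 'k::field) \<Rightarrow> ('b \<times> 'b \<Rightarrow> 'k) \<Rightarrow> bool" where
  "supported \<Omega> u v \<longleftrightarrow> (\<forall>a b. u (a, b) \<noteq> 0 \<or> v (a, b) \<noteq> 0 \<longrightarrow> a \<in> \<Omega> \<and> b \<in> \<Omega>)"

lemma supported_linear:
  "supported \<Omega> 0 0" "supported \<Omega> u v \<Longrightarrow> supported \<Omega> u' v' \<Longrightarrow> supported \<Omega> (u + u') (v + v')"
  "supported \<Omega> u v \<Longrightarrow> supported \<Omega> (fscale a u) (fscale a v)"
  unfolding supported_def fscale_def plus_fun_apply by (fastforce, metis add_0, fastforce)

lemma rels_Dend_support: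
  "(u, v) \<in> rels (Dend :: (dend_op label, 'k::field) quad_data) \<Longrightarrow>
     supported (ops (Dend :: (dend_op label, 'k) quad_data)) u v"
  by (erule rels_Dend_induct, rule supported_linear(1), erule (1) supported_linear(2), erule supported_linear(3))
    (auto simp: supported_def tens_def basis_vec_def ops_Dend split: if_splits)

lemma rels_dend_power_support:
  "(u, v) \<in> rels (dend_power d :: (dend_op label, 'k::field) quad_data) \<Longrightarrow>
     supported (ops (dend_power d :: (dend_op label, 'k) quad_data)) u v"
proof (induction d arbitrary: u v)
  case 0
  then show ?case using rels_Dend_support by auto
next
  case (Suc d)
  from Suc.prems show ?case
    unfolding dend_power_Suc rels_black_square
  proof (rule rel_span_induct)
    fix u v :: "dend_op label \<times> dend_op label \<Rightarrow> 'k"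
    assume "(u, v) \<in> {(s23 u u', s23 v v') | u v u' v'. (u, v) \<in> rels Dend \<and> (u', v') \<in> rels (dend_power d)}"
    then obtain u1 v1 u2 v2 where *: "u = s23 u1 u2" "v = s23 v1 v2" "(u1, v1) \<in> rels Dend" "(u2, v2) \<in> rels (dend_power d)"
      by blast
    show "supported (ops (black_square (Dend :: (dend_op label, 'k) quad_data) (dend_power d))) u v"
      unfolding supported_def
    proof (intro allI impI)
      fix a b
      assume "u (a, b) \<noteq> 0 \<or> v (a, b) \<noteq> 0"
      then obtain x a' y b' where "a = Tensor x a'" "b = Tensor y b'" "u1 (x, y) \<noteq> 0 \<or> v1 (x, y) \<noteq> 0"
          "u2 (a', b') \<noteq> 0 \<or> v2 (a', b') \<noteq> 0"
        unfolding * by (metis s23_nonzero)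
      then show "a \<in> ops (black_square (Dend :: (dend_op label, 'k) quad_data) (dend_power d)) \<and>
          b \<in> ops (black_square (Dend :: (dend_op label, 'k) quad_data) (dend_power d))"
        using rels_Dend_support[OF *(3)] Suc.IH[OF *(4)] by (simp add: ops_black_square supported_def)
    qed
  qed (rule supported_linear; assumption)+
qed

text \<open>
  The three defining relations correspond to the maximum being at \<open>p\<close>, \<open>q\<close> or \<open>s\<close>, the
  leftmost place counting in case of a tie.
\<close>

lemma rels_Dend_realized:
  "(u, v) \<in> rels Dend \<Longrightarrow>
     u (dend_compare p q, dend_compare (sup p q) s) = v (dend_compare p (sup q s), dend_compare q s)"
  by (erule rels_Dend_induct) (auto simp: tens_def basis_vec_def fscale_def dend_compare_def sup_nat_def)

lemma sup_shift: "(\<lambda>i. sup p q (Suc i)) = sup (\<lambda>i. p (Suc i)) (\<lambda>i. q (Suc i))" for p q :: "nat \<Rightarrow> nat"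
  by (simp add: sup_fun_def)

lemma rels_dend_power_realized:
  "(u, v) \<in> rels (dend_power d :: (dend_op label, 'k::field) quad_data) \<Longrightarrow>
     u (compare d p q, compare d (sup p q) s) = v (compare d p (sup q s), compare d q s)"
proof (induction d arbitrary: u v p q s)
  case 0
  then show ?case using rels_Dend_realized[of u v "p 0" "q 0" "s 0"] by simp
next
  case (Suc d)
  from Suc.prems show ?case
    unfolding dend_power_Suc rels_black_square
  proof (rule rel_span_induct)
    fix u v :: "dend_op label \<times> dend_op label \<Rightarrow> 'k"
    assume "(u, v) \<in> {(s23 u u', s23 v v') | u v u' v'. (u, v) \<in> rels Dend \<and> (u', v') \<in> rels (dend_power d)}"
    then obtain u1 v1 u2 v2 where *: "u = s23 u1 u2" "v = s23 v1 v2" "(u1, v1) \<in> rels Dend" "(u2, v2) \<in> rels (dend_power d)"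
      by blast
    show "u (compare (Suc d) p q, compare (Suc d) (sup p q) s) = v (compare (Suc d) p (sup q s), compare (Suc d) q s)"
      using rels_Dend_realized[OF *(3)] Suc.IH[OF *(4)] by (simp add: * s23_Tensor sup_shift)
  qed (auto simp: fscale_def)
qed

lemma rels_Dend_reducible:
  assumes "a \<in> ops (Dend :: (dend_op label, 'k::field) quad_data)"
    and "b \<in> ops (Dend :: (dend_op label, 'k) quad_data)" "\<not> ascends a b"
  shows "\<exists>(u, v)\<in>rels (Dend :: (dend_op label, 'k) quad_data). v (a, b) = 1 \<and>
    (\<forall>a' b'. v (a', b') \<noteq> 0 \<longrightarrow> a' = a \<and> (b' = b \<or> prec_count b' < prec_count b))"
proof -
  let ?p = "basis_vec (Gen Prec) :: _ \<Rightarrow> 'k" and ?s = "basis_vec (Gen Succ) :: _ \<Rightarrow> 'k"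
  have rels: "(tens ?p ?p, tens ?p (?p + ?s)) \<in> rels Dend" "(tens ?s ?p, tens ?s ?p) \<in> rels Dend"
      "(tens (?p + ?s) ?s, tens ?s ?s) \<in> rels Dend"
    by (auto simp: Dend_def Let_def intro: rel.span_base)
  consider "a = Gen Prec" "b = Gen Prec" | "a = Gen Succ" "b = Gen Prec" | "a = Gen Succ" "b = Gen Succ"
    using assms by (auto simp: ops_Dend)
  then show ?thesis
  proof cases
    case 1
    then show ?thesis by (intro bexI[OF _ rels(1)]) (auto simp: tens_def basis_vec_def split: if_splits)
  next
    case 2
    then show ?thesis by (intro bexI[OF _ rels(2)]) (auto simp: tens_def basis_vec_def split: if_splits)
  next
    case 3
    then show ?thesis by (intro bexI[OF _ rels(3)]) (auto simp: tens_def basis_vec_def split: if_splits)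
  qed
qed

text \<open>
  A pair of labels is bad exactly if it is bad in both factors, and the product of the two relations has
  the product of the leading terms. In the other terms each factor keeps or lowers its weight.
\<close>

lemma rels_dend_power_reducible:
  "a \<in> ops (dend_power d :: (dend_op label, 'k::field) quad_data) \<Longrightarrow>
   b \<in> ops (dend_power d :: (dend_op label, 'k) quad_data) \<Longrightarrow> \<not> ascends a b \<Longrightarrow>
   \<exists>(u, v)\<in>rels (dend_power d :: (dend_op label, 'k) quad_data). v (a, b) = 1 \<and>
    (\<forall>a' b'. v (a', b') \<noteq> 0 \<longrightarrow> a' = a \<and> (b' = b \<or> prec_count b' < prec_count b))"
proof (induction d arbitrary: a b)
  case 0
  then show ?case using rels_Dend_reducible by simp
next
  case (Suc d)
  obtain x a' y b' where ab: "a = Tensor x a'" "b = Tensor y b'"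
      "x \<in> ops (Dend :: (dend_op label, 'k) quad_data)" "y \<in> ops (Dend :: (dend_op label, 'k) quad_data)"
      "a' \<in> ops (dend_power d :: (dend_op label, 'k) quad_data)"
      "b' \<in> ops (dend_power d :: (dend_op label, 'k) quad_data)"
    using Suc.prems(1,2) unfolding dend_power_Suc ops_black_square by blast
  obtain u1 v1 where 1: "(u1, v1) \<in> rels (Dend :: (dend_op label, 'k) quad_data)" "v1 (x, y) = 1"
      "\<And>x' y'. v1 (x', y') \<noteq> 0 \<Longrightarrow> x' = x \<and> (y' = y \<or> prec_count y' < prec_count y)"
    using rels_Dend_reducible[OF ab(3,4)] Suc.prems(3) ab by fastforce
  obtain u2 v2 where 2: "(u2, v2) \<in> rels (dend_power d :: (dend_op label, 'k) quad_data)" "v2 (a', b') = 1"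
      "\<And>x' y'. v2 (x', y') \<noteq> 0 \<Longrightarrow> x' = a' \<and> (y' = b' \<or> prec_count y' < prec_count b')"
    using Suc.IH[OF ab(5,6)] Suc.prems(3) ab by fastforce
  have "(s23 u1 u2, s23 v1 v2) \<in> rels (dend_power (Suc d))"
    unfolding dend_power_Suc rels_black_square using 1(1) 2(1) by (blast intro: rel.span_base)
  moreover have "s23 v1 v2 (a, b) = 1"
    using 1(2) 2(2) ab by (simp add: s23_Tensor)
  moreover have "c = a \<and> (e = b \<or> prec_count e < prec_count b)" if "s23 v1 v2 (c, e) \<noteq> 0" for c e
    using that by (rule s23_nonzero) (auto simp: ab dest!: 1(3) 2(3))
  ultimately show ?case by blast
qed

text \<open>
  Where \<open>z i \<le> y i\<close> the lower label is \<open>\<prec>\<close> in that coordinate, and where \<open>x i < z i\<close> the upper label is \<open>\<succ>\<close>.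
\<close>

lemma compare_not_ascends:
  "(\<And>i. z i \<le> y i \<or> x i < z i) \<Longrightarrow> \<not> ascends (compare d x (sup y z)) (compare d y z)"
proof (induction d arbitrary: x y z)
  case 0
  from 0[of 0] show ?case by (auto simp: dend_compare_def sup_nat_def)
next
  case (Suc d)
  from Suc.prems[of 0] have "\<not> ascends (dend_compare (x 0) (sup y z 0)) (dend_compare (y 0) (z 0))"
    by (auto simp: dend_compare_def sup_nat_def)
  then show ?case
    using Suc.IH[of "\<lambda>i. z (Suc i)" "\<lambda>i. y (Suc i)" "\<lambda>i. x (Suc i)"] Suc.prems by (simp add: sup_shift)
qed

lemma compare_shift: "compare d (\<lambda>i. p i + \<alpha> i) (\<lambda>i. q i + \<alpha> i) = compare d p q"
  by (induction d arbitrary: p q \<alpha>) (auto simp: dend_compare_def)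

text \<open>
  In each coordinate the points on the winning side are raised above all points on the other side.
\<close>

lemma separating_shifts:
  "a \<in> ops (dend_power d :: (dend_op label, 'k::field) quad_data) \<Longrightarrow> \<exists>\<alpha> \<beta>. (\<forall>i. \<alpha> i = N \<and> \<beta> i = 0 \<or> \<alpha> i = 0 \<and> \<beta> i = N) \<and>
     (\<forall>p q. (\<forall>i. p i < N) \<longrightarrow> (\<forall>i. q i < N) \<longrightarrow> compare d (\<lambda>i. p i + \<alpha> i) (\<lambda>i. q i + \<beta> i) = a)"
proof (induction d arbitrary: a)
  case 0
  then consider "a = Gen Prec" | "a = Gen Succ" by (auto simp: ops_Dend)
  then show ?case
  proof cases
    case 1
    show ?thesis
      unfolding 1 by (rule exI[of _ "\<lambda>_. N"], rule exI[of _ "\<lambda>_. 0"]) (auto simp: dend_compare_def intro: less_imp_le trans_le_add2)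
  next
    case 2
    show ?thesis
      unfolding 2 by (rule exI[of _ "\<lambda>_. 0"], rule exI[of _ "\<lambda>_. N"]) (auto simp: dend_compare_def, metis add_leD2 not_le)
  qed
next
  case (Suc d)
  then obtain x a' where a: "a = Tensor x a'" "x \<in> ops (Dend :: (dend_op label, 'k) quad_data)"
      "a' \<in> ops (dend_power d :: (dend_op label, 'k) quad_data)"
    unfolding dend_power_Suc ops_black_square by blast
  obtain \<alpha> \<beta> where IH: "\<And>i. \<alpha> i = N \<and> \<beta> i = 0 \<or> \<alpha> i = 0 \<and> \<beta> i = N"
      "\<And>p q. (\<forall>i. p i < N) \<Longrightarrow> (\<forall>i. q i < N) \<Longrightarrow> compare d (\<lambda>i. p i + \<alpha> i) (\<lambda>i. q i + \<beta> i) = a'"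
    using Suc.IH[OF a(3)] by blast
  define e where "e = (if x = Gen Prec then N else 0)"
  define f where "f = (if x = Gen Prec then 0 else N)"
  have "dend_compare (p + e) (q + f) = x" if "p < N" "q < N" for p q
    using a(2) that by (auto simp: dend_compare_def e_def f_def ops_Dend)
  then have "compare (Suc d) (\<lambda>i. p i + case_nat e \<alpha> i) (\<lambda>i. q i + case_nat f \<beta> i) = a" if "\<forall>i. p i < N" "\<forall>i. q i < N" for p q
    using that IH(2)[of "\<lambda>i. p (Suc i)" "\<lambda>i. q (Suc i)"] by (simp add: a(1))
  moreover have "case_nat e \<alpha> i = N \<and> case_nat f \<beta> i = 0 \<or> case_nat e \<alpha> i = 0 \<and> case_nat f \<beta> i = N" for i
    using IH(1) by (cases i) (auto simp: e_def f_def)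
  ultimately show ?case by blast
qed

lemma join_least: "(\<And>p. p \<in> set k \<Longrightarrow> p i \<le> b) \<Longrightarrow> join k i \<le> b" for k :: "(nat \<Rightarrow> nat) list"
  by (induction k) auto

lemma join_less: "(\<And>p. p \<in> set k \<Longrightarrow> p i < b) \<Longrightarrow> 0 < b \<Longrightarrow> join k i < b" for k :: "(nat \<Rightarrow> nat) list"
  by (induction k) (auto simp: sup_nat_def bot_nat_def)

lemma join_ge: "p \<in> set k \<Longrightarrow> p i \<le> join k i" for p :: "nat \<Rightarrow> nat"
  by (induction k) (auto intro: le_supI2)

lemma join_plus: "k \<noteq> [] \<Longrightarrow> join (map (\<lambda>p i. p i + \<alpha> i) k) = (\<lambda>i. join k i + \<alpha> i)" for \<alpha> :: "nat \<Rightarrow> nat"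
proof (induction k)
  case (Cons p k)
  then show ?case by (cases k) (auto simp: fun_eq_iff sup_nat_def)
qed simp

lemma fits_shift:
  "length k = size1 t \<Longrightarrow> fits (compare d) t (map (\<lambda>p i. p i + \<alpha> i) k) \<longleftrightarrow> fits (compare d) t k"
proof (induction t arbitrary: k)
  case (Node l a r)
  have "take (size1 l) k \<noteq> []" "drop (size1 l) k \<noteq> []"
    using Node.prems by (auto simp: size1_size)
  then show ?case
    using Node by (simp add: take_map drop_map join_plus compare_shift)
qed simp

text \<open>
  If the points in \<open>k\<close> are separated from those in \<open>k'\<close> in each coordinate, a fitting normal tree cannot
  split off fewer points than \<open>k\<close> at its root. Otherwise the induction hypothesis, applied to the right
  subtree and the rest of \<open>k\<close>, yields a right edge such that the points left of the upper node
  are in \<open>k\<close>, those left of the lower node meet \<open>k\<close>, and those right of it are in \<open>k'\<close>. By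
  \<open>compare_not_ascends\<close> such an edge is bad.
\<close>

lemma separated_left_size:
  assumes "normal ascends t" "fits (compare d) t (k @ k')" "length (k @ k') = size1 t" "k \<noteq> []" "k' \<noteq> []"
    and "\<And>i. (\<forall>p\<in>set k. \<forall>q\<in>set k'. q i \<le> p i) \<or> (\<forall>p\<in>set k. \<forall>q\<in>set k'. p i < q i)"
  shows "\<exists>l a r. t = \<langle>l, a, r\<rangle> \<and> length k \<le> size1 l"
  using assms
proof (induction t arbitrary: k)
  case Leaf
  then show ?case by (cases k; cases k') auto
next
  case (Node l a r)
  show ?case
  proof (cases "length k \<le> size1 l")
    case False
    define k\<^sub>1 k\<^sub>2 where "k\<^sub>1 = take (size1 l) k" and "k\<^sub>2 = drop (size1 l) k"
    have k: "k = k\<^sub>1 @ k\<^sub>2" "length k\<^sub>1 = size1 l" "k\<^sub>2 \<noteq> []" "k\<^sub>1 \<noteq> []"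
      using False by (auto simp: k\<^sub>1_def k\<^sub>2_def size1_size)
    have sep: "(\<forall>p\<in>set k\<^sub>2. \<forall>q\<in>set k'. q i \<le> p i) \<or> (\<forall>p\<in>set k\<^sub>2. \<forall>q\<in>set k'. p i < q i)" for i
      using Node.prems(6)[of i] by (auto simp: k(1))
    have "fits (compare d) r (k\<^sub>2 @ k')"
      using Node.prems(2) k(2) by (simp add: k(1))
    moreover have "length (k\<^sub>2 @ k') = size1 r"
      using Node.prems(3) k(1,2) by simp
    ultimately obtain l' b r' where r: "r = \<langle>l', b, r'\<rangle>" "length k\<^sub>2 \<le> size1 l'"
      using Node.IH(2)[of k\<^sub>2, OF _ _ _ k(3) Node.prems(5) sep] Node.prems(1) by auto
    \<comment> \<open>The left subtree of the lower node takes \<open>k\<^sub>2\<close> and possibly a beginning of \<open>k'\<close>, but not all of \<open>k'\<close>.\<close>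
    define k\<^sub>3 k\<^sub>4 where "k\<^sub>3 = take (size1 l' - length k\<^sub>2) k'" and "k\<^sub>4 = drop (size1 l' - length k\<^sub>2) k'"
    have k': "k' = k\<^sub>3 @ k\<^sub>4" "length k\<^sub>2 + length k\<^sub>3 = size1 l'" "k\<^sub>4 \<noteq> []"
      using r \<open>length (k\<^sub>2 @ k') = size1 r\<close> by (auto simp: k\<^sub>3_def k\<^sub>4_def size1_size)
    let ?x = "join k\<^sub>1" and ?y = "join (k\<^sub>2 @ k\<^sub>3)" and ?z = "join k\<^sub>4"
    have "a = compare d ?x (sup ?y ?z)" "b = compare d ?y ?z"
      using Node.prems(2) k(2) k'(2)[symmetric] by (simp_all add: k(1) k'(1) r(1) sup_assoc)
    moreover have "ascends a b"
      using Node.prems(1) by (simp add: r(1) right_ok_def)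
    moreover have "?z i \<le> ?y i \<or> ?x i < ?z i" for i
    proof (cases "\<forall>p\<in>set k. \<forall>q\<in>set k'. q i \<le> p i")
      case True
      obtain p where p: "p \<in> set k\<^sub>2" using k(3) by (cases k\<^sub>2) auto
      have "?z i \<le> p i"
        using True p by (intro join_least) (auto simp: k(1) k'(1))
      also have "p i \<le> ?y i"
        using p by (intro join_ge) auto
      finally show ?thesis by simp
    next
      case False
      then have less: "\<forall>p\<in>set k. \<forall>q\<in>set k'. p i < q i" using Node.prems(6)[of i] by blast
      obtain q where q: "q \<in> set k\<^sub>4" using k'(3) by (cases k\<^sub>4) auto
      obtain p where p: "p \<in> set k\<^sub>1" using k(4) by (cases k\<^sub>1) auto
      have "p i < q i" using less p q by (auto simp: k(1) k'(1))
      then have "?x i < q i"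
        using less q by (intro join_less) (auto simp: k(1) k'(1))
      also have "q i \<le> ?z i"
        using q by (rule join_ge)
      finally show ?thesis by simp
    qed
    ultimately show ?thesis
      using compare_not_ascends by blast
  qed auto
qed

text \<open>
  The number of leaves of the right subtree of each node, in preorder. The first node at which two trees
  of equal size split differently decides their lexicographic comparison.
\<close>

primrec right_sizes :: "'a tree \<Rightarrow> nat list" where
  "right_sizes \<langle>\<rangle> = []"
| "right_sizes \<langle>l, a, r\<rangle> = size1 r # right_sizes l @ right_sizes r"

lemma length_right_sizes: "length (right_sizes t) = size t"
  by (induction t) auto

text \<open>
  The points for the two subtrees are shifted apart in each coordinate in the direction demanded by the
  label of the root. By \<open>separated_left_size\<close> another fitting normal tree has at least as many leaves
  on the left of its root, and if there are equally many the subtrees fit the points chosen for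
  the two subtrees.
\<close>

lemma separating_point:
  "normal ascends t \<Longrightarrow> set_tree t \<subseteq> ops (dend_power d :: (dend_op label, 'k::field) quad_data) \<Longrightarrow>
   \<exists>k N. length k = size1 t \<and> (\<forall>p\<in>set k. \<forall>i. p i < N) \<and> fits (compare d) t k \<and>
     (\<forall>t'. normal ascends t' \<longrightarrow> size1 t' = size1 t \<longrightarrow> fits (compare d) t' k \<longrightarrow>
        t' = t \<or> (right_sizes t', right_sizes t) \<in> lenlex less_than)"
proof (induction t)
  case Leaf
  show ?case
    by (intro exI[of _ "[\<lambda>_. 0]"] exI[of _ 1]) (auto simp: size1_size)
next
  case (Node l a r)
  obtain kl N1 where l: "length kl = size1 l" "\<forall>p\<in>set kl. \<forall>i. p i < N1" "fits (compare d) l kl"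
      "\<And>t'. normal ascends t' \<Longrightarrow> size1 t' = size1 l \<Longrightarrow> fits (compare d) t' kl \<Longrightarrow>
        t' = l \<or> (right_sizes t', right_sizes l) \<in> lenlex less_than"
    using Node.IH(1) Node.prems by auto
  obtain kr N2 where r: "length kr = size1 r" "\<forall>p\<in>set kr. \<forall>i. p i < N2" "fits (compare d) r kr"
      "\<And>t'. normal ascends t' \<Longrightarrow> size1 t' = size1 r \<Longrightarrow> fits (compare d) t' kr \<Longrightarrow>
        t' = r \<or> (right_sizes t', right_sizes r) \<in> lenlex less_than"
    using Node.IH(2) Node.prems by auto
  define N where "N = max N1 N2"
  have N: "p i < N" if "p \<in> set kl \<union> set kr" for p i
    using that l(2) r(2) by (auto simp: N_def less_max_iff_disj)
  have ne: "kl \<noteq> []" "kr \<noteq> []" using l(1) r(1) by (auto simp: size1_size)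
  have pos: "0 < N"
    using N[of "hd kl" 0] ne(1) by simp
  have "a \<in> ops (dend_power d :: (dend_op label, 'k) quad_data)"
    using Node.prems(2) by simp
  from separating_shifts[OF this, of N] obtain \<alpha> \<beta> where
      "\<forall>i. \<alpha> i = N \<and> \<beta> i = 0 \<or> \<alpha> i = 0 \<and> \<beta> i = N"
      "\<forall>p q. (\<forall>i. p i < N) \<longrightarrow> (\<forall>i. q i < N) \<longrightarrow> compare d (\<lambda>i. p i + \<alpha> i) (\<lambda>i. q i + \<beta> i) = a"
    by (elim exE conjE)
  then have shifts: "\<And>i. \<alpha> i = N \<and> \<beta> i = 0 \<or> \<alpha> i = 0 \<and> \<beta> i = N"
      "\<And>p q. \<lbrakk>\<forall>i. p i < N; \<forall>i. q i < N\<rbrakk> \<Longrightarrow> compare d (\<lambda>i. p i + \<alpha> i) (\<lambda>i. q i + \<beta> i) = a"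
    by simp_all
  let ?kl = "map (\<lambda>p i. p i + \<alpha> i) kl" and ?kr = "map (\<lambda>q i. q i + \<beta> i) kr"
  have label: "compare d (join ?kl) (join ?kr) = a"
    unfolding join_plus[OF ne(1)] join_plus[OF ne(2)]
    using N pos by (intro shifts(2) allI join_less) auto
  have sep: "(\<forall>p\<in>set ?kl. \<forall>q\<in>set ?kr. q i \<le> p i) \<or> (\<forall>p\<in>set ?kl. \<forall>q\<in>set ?kr. p i < q i)" for i
    using shifts(1)[of i] N
    by (elim disjE) (force intro: less_imp_le trans_le_add2 trans_less_add2)+
  have fits: "fits (compare d) \<langle>l, a, r\<rangle> (?kl @ ?kr)"
    using l(1,3) r(1,3) label by (simp add: fits_shift)
  have "t' = \<langle>l, a, r\<rangle> \<or> (right_sizes t', right_sizes \<langle>l, a, r\<rangle>) \<in> lenlex less_than"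
    if t': "normal ascends t'" "size1 t' = size1 \<langle>l, a, r\<rangle>" "fits (compare d) t' (?kl @ ?kr)" for t'
  proof -
    obtain l' a' r' where T: "t' = \<langle>l', a', r'\<rangle>" "size1 l \<le> size1 l'"
      using separated_left_size[OF t'(1,3) _ _ _ sep] t'(2) l(1) r(1) ne by auto
    have sizes: "size l' + size r' = size l + size r"
      using t'(2) T(1) by (simp add: size1_size)
    show ?thesis
    proof (cases "size1 l' = size1 l")
      case False
      then have "size1 r' < size1 r"
        using T t'(2) by simp
      then show ?thesis
        using sizes by (simp add: T(1) Cons_lenlex_iff length_right_sizes)
    next
      case True
      have size_r: "size1 r' = size1 r"
        using True t'(2) T(1) by simp
      have "fits (compare d) l' kl" "fits (compare d) r' kr" "a' = a"
        using t'(3) True size_r l(1) r(1) label by (simp_all add: T(1) fits_shift)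
      then have "l' = l \<or> (right_sizes l', right_sizes l) \<in> lenlex less_than"
          "r' = r \<or> (right_sizes r', right_sizes r) \<in> lenlex less_than"
        using l(4)[of l'] r(4)[of r'] t'(1) True size_r by (auto simp: T(1))
      moreover have "length (right_sizes r') = length (right_sizes r)"
        using size_r by (simp add: length_right_sizes size1_size)
      ultimately show ?thesis
        using True size_r \<open>a' = a\<close> sizes
        by (auto simp: T(1) Cons_lenlex_iff length_right_sizes lenlex_append1 lenlex_append2 irrefl_on_def)
    qed
  qed
  moreover have "\<forall>p\<in>set (?kl @ ?kr). \<forall>i. p i < N + N"
    using shifts(1) N by (auto intro!: add_less_le_mono) (metis le0 order_refl)+
  ultimately show ?case
    using fits l(1) r(1) by (intro exI[of _ "?kl @ ?kr"] exI[of _ "N + N"]) auto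
qed

theorem theorem5p1:
  fixes m :: nat
  assumes "m \<ge> 1"
  shows "koszul (quadratic_operad
           (black_power (Dend :: (dend_op label, 'k::{alg_closed_field, field_char_0}) quad_data) m))"
proof -
  \<comment> \<open>\<open>dend_power (m - 1)\<close> has \<open>m\<close> factors.\<close>
  let ?Q = "dend_power (m - 1) :: (dend_op label, 'k) quad_data"
  interpret realization ?Q "compare (m - 1)"
  proof unfold_locales
    show "a \<in> ops ?Q \<and> b \<in> ops ?Q" if "(u, v) \<in> rels ?Q" "u (a, b) \<noteq> 0 \<or> v (a, b) \<noteq> 0" for u v a b
      using rels_dend_power_support[OF that(1)] that(2) unfolding supported_def by blast
  qed (use finite_ops_dend_power rels_dend_power_realized in blast)+
  interpret right_pbw ?Q ascends prec_count
  proof unfold_locales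
    show "x = 0" if x: "in_ideal ?Q n x" "x \<in> free_comps ?Q n" "\<And>t. x t \<noteq> 0 \<Longrightarrow> normal ascends t" for n x
    proof (rule triangular_independent[OF _ _ x])
      show "wf (inv_image (lenlex less_than) right_sizes)"
        by (simp add: wf_lenlex)
      fix t
      assume "t \<in> monomials ?Q n" "normal ascends t"
      then show "\<exists>k. length k = n \<and> fits (compare (m - 1)) t k \<and>
          (\<forall>t'. normal ascends t' \<longrightarrow> size1 t' = n \<longrightarrow> fits (compare (m - 1)) t' k \<longrightarrow>
            t' = t \<or> (t', t) \<in> inv_image (lenlex less_than) right_sizes)"
        using separating_point[of t "m - 1"] by (auto simp: monomials_def)
    qed
  qed (use rels_support rels_dend_power_reducible[of _ "m - 1"] in blast)+
  show ?thesis
    using koszul_right_pbw by (simp add: black_power_def)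
qed

end
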